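(* Let $\varphi:(0,\infty)\times(0,\infty)\to(0,\infty)$ be a $C^1$ function with $\partial_1\varphi\ge 0$ and $\partial_2\varphi\ge 0$ on $(0,\infty)\times(0,\infty)$, and suppose that at least one of these inequalities is strict (that is, $\partial_1\varphi>0$ everywhere or $\partial_2\varphi>0$ everywhere). (i) If $M^n\subset\mathbb{R}^{n+1}$ is a closed, smooth, strictly convex hypersurface whose support function $h$ is positive and whose Gauss curvature $\mathcal{K}$ satisfies $$\varphi(h,|Dh|)\,\mathcal{K}=1\qquad\text{on }\mathbb{S}^n,$$ then $M^n$ is a rescaling of $\mathbb{S}^n$, i.e. $M^n=r\,\mathbb{S}^n$ for some $r>0$. (ii) Moreover, if $\partial_1\varphi=0$ identically, so that $\varphi(x,y)=\phi(y)$ for a function $\phi:(0,\infty)\to(0,\infty)$, then the same conclusion holds under no assumption on the sign of $h$: if $M^n\subset\mathbb{R}^{n+1}$ is a closed, smooth, strictly convex hypersurface with support function $h$ and Gauss curvature $\mathcal{K}$ satisfying $\phi(|Dh|)\,\mathcal{K}=1$ (at all points of $\mathbb{S}^n$ where $|Dh|>0$), then $M^n=r\,\mathbb{S}^n$ for some $r>0$.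
   Context: $\mathbb{S}^n\subset\mathbb{R}^{n+1}$ is the unit sphere centred at the origin, with round metric $\bar g$ and Levi-Civita connection $\bar\nabla$. A closed, smooth, strictly convex hypersurface $M$ is the $C^\infty$-smooth boundary, with positive Gauss curvature, of a convex body (compact convex set with non-empty interior) in $\mathbb{R}^{n+1}$. Its outer unit normal $\nu:M\to\mathbb{S}^n$ (Gauss map) is a diffeomorphism, and the support function and Gauss curvature are regarded as functions on $\mathbb{S}^n$: $h(x)=\langle\nu^{-1}(x),x\rangle$ and $\frac{1}{\mathcal{K}(x)}=\frac{\det(\bar\nabla^2h+\bar g h)}{\det(\bar g)}\big|_x$. $Dh$ at $x\in\mathbb{S}^n$ denotes the Euclidean gradient at $x$ of the 1-homogeneous extension of $h$, i.e. $Dh(x)=\bar\nabla h(x)+h(x)x=\nu^{-1}(x)$, so $|Dh|^2=h^2+|\bar\nabla h|^2$. $\partial_1,\partial_2$ are the partial derivatives with respect to the first and second argument. *)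

theory Defs
  imports "HOL-Analysis.Analysis"
begin

text \<open>
  The ambient space \<open>\<real>\<^sup>n\<^sup>+\<^sup>1\<close> is \<^typ>\<open>real ^ 'm\<close> with \<open>CARD('m) = n + 1\<close>. A closed, smooth, strictly
  convex hypersurface \<open>M\<close> is represented by the convex body \<open>C\<close> that it bounds, that is
  \<open>M = frontier C\<close>; \<open>C\<close> is the convex hull of \<open>M\<close>, so either determines the other.
\<close>

text \<open>\<open>Ck_on k f S\<close>, for open \<open>S\<close> and a finite-dimensional domain, says that \<open>f\<close> is \<open>C\<^sup>k\<close> on \<open>S\<close>.\<close>

primrec Ck_on ::
  "nat \<Rightarrow> ('a::euclidean_space \<Rightarrow> 'b::real_normed_vector) \<Rightarrow> 'a set \<Rightarrow> bool" where
  "Ck_on 0 f S \<longleftrightarrow> continuous_on S f"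
| "Ck_on (Suc k) f S \<longleftrightarrow>
     (\<forall>x\<in>S. f differentiable (at x)) \<and>
     (\<forall>v. Ck_on k (\<lambda>x. frechet_derivative f (at x) v) S)"

definition smooth_on_open ::
  "('a::euclidean_space \<Rightarrow> 'b::real_normed_vector) \<Rightarrow> 'a set \<Rightarrow> bool" where
  "smooth_on_open f S \<longleftrightarrow> open S \<and> (\<forall>k. Ck_on k f S)"

definition gradient :: "('a::euclidean_space \<Rightarrow> real) \<Rightarrow> 'a \<Rightarrow> 'a" where
  "gradient f x = (THE g. GDERIV f x :> g)"

definition smooth_hypersurface :: "('a::euclidean_space) set \<Rightarrow> bool" where
  "smooth_hypersurface M \<longleftrightarrow>
     (\<forall>p\<in>M. \<exists>U f. p \<in> U \<and> smooth_on_open f U \<and>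
        (\<forall>x\<in>U. gradient f x \<noteq> 0) \<and> M \<inter> U = {x\<in>U. f x = 0})"

text \<open>
  For a convex body with smooth boundary there is exactly one such unit vector at each boundary point.
\<close>

definition outer_normal :: "('a::euclidean_space) set \<Rightarrow> 'a \<Rightarrow> 'a" where
  "outer_normal C p = (THE u. norm u = 1 \<and> (\<forall>q\<in>C. (q - p) \<bullet> u \<le> 0))"

definition gauss_map_inv :: "('a::euclidean_space) set \<Rightarrow> 'a \<Rightarrow> 'a" where
  "gauss_map_inv C = inv_into (frontier C) (outer_normal C)"

text \<open>
  The determinant of a linear endomorphism \<open>A\<close> of the hyperplane \<open>u\<^sup>\<bottom>\<close> (\<open>u\<close> a unit vector), computed as
  the determinant of the endomorphism of the whole space that agrees with \<open>A\<close> on \<open>u\<^sup>\<bottom>\<close> and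
  fixes \<open>u\<close>: in an orthonormal basis \<open>e\<^sub>1, \<dots>, e\<^sub>n, u\<close> its matrix is block triangular with
  diagonal blocks \<open>(e\<^sub>i \<bullet> A e\<^sub>j)\<close> and \<open>1\<close>. Only the values of \<open>A\<close> on \<open>u\<^sup>\<bottom>\<close> enter.
\<close>

definition hyperplane_det :: "real ^ 'm \<Rightarrow> (real ^ 'm \<Rightarrow> real ^ 'm) \<Rightarrow> real" where
  "hyperplane_det u A = det (matrix (\<lambda>v. A (v - (v \<bullet> u) *\<^sub>R u) + (v \<bullet> u) *\<^sub>R u))"

text \<open>
  The Gauss curvature of \<open>frontier C\<close> at \<open>p\<close> is the determinant of the differential of the Gauss map
  (the shape operator with respect to the outer normal) on the tangent space, which is the
  hyperplane orthogonal to the normal. The derivative of the Gauss map within the hypersurface is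
  only determined on tangent vectors, and only these are used.
\<close>

definition gauss_curvature :: "(real ^ 'm) set \<Rightarrow> real ^ 'm \<Rightarrow> real" where
  "gauss_curvature C p =
     hyperplane_det (outer_normal C p)
       (frechet_derivative (outer_normal C) (at p within frontier C))"

definition bounds_smooth_strictly_convex :: "(real ^ 'm) set \<Rightarrow> bool" where
  "bounds_smooth_strictly_convex C \<longleftrightarrow>
     compact C \<and> convex C \<and> interior C \<noteq> {} \<and>
     smooth_hypersurface (frontier C) \<and> (\<forall>p\<in>frontier C. gauss_curvature C p > 0)"

text \<open>
  The next three functions are only meaningful on the unit sphere. The reciprocal of
  \<open>sphere_curvature C\<close> is \<open>det (\<nabla>\<^sup>2h + g h) / det g\<close>, since \<open>\<nabla>\<^sup>2h + g h\<close> is the differential of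
  \<open>gauss_map_inv C\<close>.
\<close>

definition support_fun :: "('a::euclidean_space) set \<Rightarrow> 'a \<Rightarrow> real" where
  "support_fun C x = gauss_map_inv C x \<bullet> x"

definition sphere_curvature :: "(real ^ 'm) set \<Rightarrow> real ^ 'm \<Rightarrow> real" where
  "sphere_curvature C x = gauss_curvature C (gauss_map_inv C x)"

definition support_grad :: "('a::euclidean_space) set \<Rightarrow> 'a \<Rightarrow> 'a" where
  "support_grad C x = gradient (\<lambda>y. norm y * support_fun C (y /\<^sub>R norm y)) x"

end

theory Submission
  imports Defs
begin

text \<open>
  Let \<open>H\<close> be the \<open>1\<close>-homogeneous support function and \<open>X\<close> its gradient, the \<open>0\<close>-homogeneous
  extension of the inverse Gauss map, and let \<open>L\<close> be the least constant with
  \<open>H x - H y \<le> L * norm (x - y)\<close> for unit \<open>x\<close>, \<open>y\<close>. Suppose \<open>L > 0\<close>.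

  If \<open>L\<close> is attained at \<open>x \<noteq> y\<close>, let \<open>R\<close> be the reflection exchanging \<open>x\<close> and \<open>y\<close>. Then \<open>H\<close> touches
  \<open>H \<circ> R\<close> plus a linear function from below at \<open>x\<close>, so comparing Hessians bounds
  \<open>1 / K\<close> at \<open>x\<close> by \<open>1 / K\<close> at \<open>y\<close>; but \<open>H y < H x\<close> and \<open>norm (X y) < norm (X x)\<close>, so monotonicity of \<open>\<phi>\<close>
  gives the opposite strict inequality.

  Otherwise \<open>L = X x \<bullet> e\<close> for some \<open>x\<close> and a unit tangent vector \<open>e\<close>. Third order expansion of
  \<open>H x - H y \<le> L * norm (x - y)\<close> at this pair shows that \<open>1 / K\<close> does not increase at \<open>x\<close> in
  direction \<open>e\<close>, whereas \<open>\<phi> (H, norm X)\<close> strictly increases there.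

  Thus \<open>L = 0\<close>, \<open>H\<close> is constant on the sphere, and \<open>X x = c *\<^sub>R x\<close>.
\<close>

subsection \<open>Determinants\<close>

text \<open>Only pairs \<open>z\<close>, \<open>R z\<close> are compared. Where
  \<open>0 < z \<bullet> e\<close>, the chord \<open>norm (z - R z) = 2 * (z \<bullet> e)\<close> is
  linear in \<open>z\<close>, so it drops out of all derivatives beyond the first. When the two
  points have merged, the pairs are \<open>z + t *\<^sub>R e\<close>,
  \<open>z - t *\<^sub>R e\<close> with \<open>z\<close> orthogonal to \<open>e\<close>; the
  difference of \<open>H\<close> is odd in \<open>t\<close>, the second order term vanishes, and the
  third order decides. Extending \<open>H\<close> by homogeneity lets variations be straight lines
  instead of curves on the sphere; the price is a degenerate radial direction, which the
  determinants complete by the identity. The curvature equation enters only through an ordering of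
  \<open>F\<close> at two points and the sign of one derivative. These are hypotheses of the maximum
  principle, so both assertions share it. In the second one nothing is assumed where
  \<open>X\<close> vanishes; by injectivity this concerns at most one unit vector, and continuity of
  \<open>F\<close> covers it. The other obstacle is regularity: the hypersurface is given by local
  defining functions, while the argument differentiates \<open>H\<close> three times. So the Gauss
  map is first extended to open sets and then inverted.\<close>

definition outer :: "real^'n \<Rightarrow> real^'n \<Rightarrow> real^'n^'n" where
  "outer u v = (\<chi> i j. u $ i * v $ j)"

lemma outer_mult_vec: "outer u v *v x = (v \<bullet> x) *\<^sub>R u"
  by (simp add: outer_def vec_eq_iff matrix_vector_mult_def inner_vec_def sum_distrib_left mult_ac)

lemma matrix_mult_outer: "A ** outer u v = outer (A *v u) v"
  by (simp add: outer_def vec_eq_iff matrix_matrix_mult_def matrix_vector_mult_def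
      sum_distrib_left sum_distrib_right mult_ac)

lemma outer_mult_matrix: "outer u v ** A = outer u (transpose A *v v)"
  by (simp add: outer_def vec_eq_iff matrix_matrix_mult_def matrix_vector_mult_def transpose_def
      sum_distrib_left mult_ac)

lemma matrix_add_rdistrib: "(A + B) ** C = A ** C + B ** (C :: 'a::semiring_1^'n^'m)"
  by (simp add: matrix_matrix_mult_def vec_eq_iff distrib_right sum.distrib)

text \<open>After a rotation taking \<open>s\<close> to a multiple of a basis vector, only one column of the matrix is non-trivial.\<close>

lemma det_mat_1_add_outer: "det (mat 1 + outer w s) = 1 + s \<bullet> w"
proof -
  fix k :: 'a
  have "norm (norm s *\<^sub>R axis k (1::real) :: real^'a) = norm s"
    by simp
  then obtain f :: "real^'a \<Rightarrow> real^'a"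
    where f: "orthogonal_transformation f" "f (norm s *\<^sub>R axis k 1) = s"
    by (rule orthogonal_transformation_exists)
  define Q where "Q = matrix f"
  have Q: "orthogonal_matrix Q" and fQ: "\<And>x. f x = Q *v x"
    using f(1) unfolding Q_def orthogonal_transformation_matrix
    by (auto simp: matrix_works linear_matrix_vector_mul_eq)
  have QQ: "transpose Q ** Q = mat 1"
    using Q by (simp add: orthogonal_matrix)
  have Qs: "transpose Q *v s = norm s *\<^sub>R axis k 1"
    using f(2) QQ by (metis fQ matrix_vector_mul_assoc matrix_vector_mul_lid)
  define u where "u = transpose Q *v w"
  have "transpose Q ** (mat 1 + outer w s) ** Q = mat 1 + outer u (norm s *\<^sub>R axis k 1)"
    by (simp add: matrix_add_ldistrib matrix_add_rdistrib QQ matrix_mult_outer outer_mult_matrix Qs u_def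
        del: transpose_matrix_vector)
  moreover have "det (transpose Q) * det Q = 1"
    using QQ by (metis det_I det_mul)
  ultimately have "det (mat 1 + outer w s) = det (mat 1 + outer u (norm s *\<^sub>R axis k 1))"
    by (metis (no_types, lifting) det_mul mult.commute mult.left_commute mult.right_neutral)
  \<comment> \<open>This is the identity with column \<open>k\<close> replaced by the image of a
    vector under the identity, the shape in which Cramer's lemma returns the \<open>k\<close>-th
    coordinate of that vector.\<close>
  also have "mat 1 + outer u (norm s *\<^sub>R axis k 1) =
      (\<chi> i j. if j = k then (mat 1 *v (axis k 1 + norm s *\<^sub>R u)) $ i else (mat 1 :: real^'a^'a) $ i $ j)"
    unfolding matrix_vector_mul_lid by (auto simp: vec_eq_iff outer_def mat_def axis_def)
  also have "det \<dots> = 1 + norm s * u $ k"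
    unfolding cramer_lemma by (simp add: axis_def)
  also have "norm s * u $ k = (transpose Q *v s) \<bullet> u"
    by (simp add: Qs inner_axis' del: transpose_matrix_vector)
  also have "\<dots> = s \<bullet> w"
    using Q unfolding u_def orthogonal_matrix_def
    by (metis dot_lmul_matrix matrix_vector_mul_assoc matrix_vector_mul_lid transpose_matrix_vector)
  finally show ?thesis .
qed

text \<open>Solving \<open>P *v w = s\<close> turns the sum into the product
  \<open>P ** (mat 1 + outer w s)\<close>. The determinant is thus multiplied by
  \<open>1 + s \<bullet> w\<close>, and \<open>s \<bullet> w\<close> is the form of \<open>P\<close>
  at \<open>w\<close>.\<close>

lemma det_add_outer_ge:
  assumes P: "\<And>v. 0 \<le> v \<bullet> (P *v v)" and d: "0 < det P"
  shows "det P \<le> det (P + outer s s)"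
proof -
  obtain w where w: "P *v w = s"
    using d by (metis invertible_det_nz invertible_def less_irrefl matrix_vector_mul_assoc matrix_vector_mul_lid)
  have "P + outer s s = P ** (mat 1 + outer w s)"
    by (simp add: matrix_add_ldistrib matrix_mult_outer w)
  then have "det (P + outer s s) = det P * (1 + s \<bullet> w)"
    by (simp add: det_mul det_mat_1_add_outer)
  moreover have "0 \<le> s \<bullet> w"
    using P[of w] by (simp add: w inner_commute)
  ultimately show ?thesis
    using d by (simp add: algebra_simps)
qed

text \<open>Each step of the induction is a Cholesky step: it splits off a rank one summand and annihilates a column.\<close>

lemma det_add_psd_ge:
  fixes P S :: "real^'n^'n"
  assumes "transpose S = S" "\<And>v. 0 \<le> v \<bullet> (S *v v)"
    and "\<And>v. 0 \<le> v \<bullet> (P *v v)" "0 < det P"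
  shows "det P \<le> det (P + S)"
  using assms
proof (induction "card {j. column j S \<noteq> 0}" arbitrary: P S rule: less_induct)
  case less
  show ?case
  proof (cases "S = 0")
    case False
    have sym: "S $ i $ j = S $ j $ i" for i j
      using less.prems(1) by (metis (no_types) transpose_def vec_lambda_beta)
    obtain k where k: "column k S \<noteq> 0"
      using False by (auto simp: vec_eq_iff column_def)
    define c where "c = column k S"
    define a where "a = S $ k $ k"
    have Sk: "S *v axis k 1 = c"
      by (simp add: c_def matrix_vector_mult_basis)
    have vSk: "axis k 1 \<bullet> (S *v v) = v \<bullet> c" for v
      using less.prems(1) by (metis Sk dot_lmul_matrix inner_commute transpose_matrix_vector)
    \<comment> \<open>The form on \<open>v + t *\<^sub>R axis k 1\<close> is a quadratic polynomial
      in \<open>t\<close>. Its sign forces \<open>a \<noteq> 0\<close>, and its minimum, at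
      \<open>t = - (v \<bullet> c) / a\<close>, is the form of the Schur complement
      \<open>S'\<close>.\<close>
    have quad: "0 \<le> v \<bullet> (S *v v) + 2 * t * (v \<bullet> c) + t^2 * a" for v t
    proof -
      have "0 \<le> (v + t *\<^sub>R axis k 1) \<bullet> (S *v (v + t *\<^sub>R axis k 1))"
        by (rule less.prems)
      also have "axis k 1 \<bullet> c = a"
        by (simp add: inner_axis' c_def a_def column_def)
      ultimately show ?thesis
        by (simp add: matrix_vector_right_distrib matrix_vector_mult_scaleR Sk vSk inner_add_left
            inner_add_right algebra_simps power2_eq_square)
    qed
    have "0 \<le> a"
      using less.prems(2)[of "axis k 1"] by (simp add: Sk inner_axis' c_def a_def column_def)
    moreover have "a \<noteq> 0"
    proof
      assume "a = 0"
      have "c \<bullet> c \<noteq> 0"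
        using k by (simp add: c_def)
      \<comment> \<open>For \<open>a = 0\<close> the polynomial is affine in \<open>t\<close> with
        slope \<open>2 * (c \<bullet> c)\<close>, and this \<open>t\<close> gives it the value
        \<open>-1\<close>.\<close>
      then show False
        using quad[of c "- (c \<bullet> (S *v c) + 1) / (2 * (c \<bullet> c))"] \<open>a = 0\<close> by (simp add: field_simps)
    qed
    ultimately have a: "0 < a" by simp
    define s where "s = (1 / sqrt a) *\<^sub>R c"
    define S' where "S' = S - outer s s"
    have ss: "s $ i * s $ j = c $ i * c $ j / a" for i j
      using a by (simp add: s_def)
    have "det P \<le> det (P + outer s s)"
      using less.prems by (intro det_add_outer_ge)
    moreover have "det (P + outer s s) \<le> det (P + outer s s + S')"
    proof (rule less.hyps)
      have "column k S' = 0"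
        using a by (simp add: vec_eq_iff column_def S'_def outer_def ss) (simp add: c_def a_def column_def)
      moreover have "column j S' = 0" if "column j S = 0" for j
      proof -
        have "S $ i $ j = 0" for i
          using that by (simp add: vec_eq_iff column_def)
        then have "c $ j = 0" 
          by (simp add: c_def column_def sym[of j k])
        with \<open>\<And>i. S $ i $ j = 0\<close> show ?thesis
          by (simp add: vec_eq_iff column_def S'_def outer_def ss)
      qed
      ultimately have "{j. column j S' \<noteq> 0} \<subset> {j. column j S \<noteq> 0}"
        using k by blast
      then show "card {j. column j S' \<noteq> 0} < card {j. column j S \<noteq> 0}"
        by (simp add: psubset_card_mono)
      show "transpose S' = S'"
        by (simp add: vec_eq_iff transpose_def S'_def outer_def sym mult.commute)
      show "0 \<le> v \<bullet> (S' *v v)" for v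
      proof -
        have "v \<bullet> (S' *v v) = v \<bullet> (S *v v) - (s \<bullet> v)^2"
          by (simp add: S'_def matrix_vector_mult_diff_rdistrib outer_mult_vec inner_diff_right
              power2_eq_square inner_commute)
        also have "(s \<bullet> v)^2 = (v \<bullet> c)^2 / a"
          using a by (simp add: s_def power_divide inner_commute)
        also have "0 \<le> v \<bullet> (S *v v) - (v \<bullet> c)^2 / a"
          using quad[of v "- (v \<bullet> c) / a"] a by (simp add: power2_eq_square)
        finally show ?thesis .
      qed
      show "0 \<le> v \<bullet> ((P + outer s s) *v v)" for v
        using less.prems(3)[of v]
        by (simp add: matrix_vector_mult_add_rdistrib inner_add_right outer_mult_vec inner_commute)
      show "0 < det (P + outer s s)"
        using \<open>det P \<le> det (P + outer s s)\<close> less.prems(4) by simp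
    qed
    ultimately show ?thesis
      by (simp add: S'_def)
  qed simp
qed

section \<open>Differentiability of determinants and of solutions of linear systems\<close>

lemma differentiable_prod_finite:
  fixes f :: "'i \<Rightarrow> 'a::real_normed_vector \<Rightarrow> real"
  assumes "finite I" "\<And>i. i \<in> I \<Longrightarrow> f i differentiable (at x)"
  shows "(\<lambda>x. \<Prod>i\<in>I. f i x) differentiable (at x)"
  using assms by (induction I rule: finite_induct) auto

lemma differentiable_sum_finite:
  fixes f :: "'i \<Rightarrow> 'a::real_normed_vector \<Rightarrow> 'b::real_normed_vector"
  assumes "finite I" "\<And>i. i \<in> I \<Longrightarrow> f i differentiable (at x)"
  shows "(\<lambda>x. \<Sum>i\<in>I. f i x) differentiable (at x)"
  using assms by (induction I rule: finite_induct) auto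

lemma differentiable_det:
  fixes M :: "'a::real_normed_vector \<Rightarrow> real^'n^'n"
  assumes "\<And>i j. (\<lambda>y. M y $ i $ j) differentiable (at x)"
  shows "(\<lambda>y. det (M y)) differentiable (at x)"
  unfolding det_def
  by (intro differentiable_sum_finite differentiable_mult differentiable_const differentiable_prod_finite assms)
     (auto simp: finite_permutations)

lemma differentiable_vec_nth:
  fixes f :: "'a::real_normed_vector \<Rightarrow> 'b::real_normed_vector^'n"
  assumes "f differentiable (at x)"
  shows "(\<lambda>y. f y $ i) differentiable (at x)"
proof -
  obtain D where "(f has_derivative D) (at x)"
    using assms by (auto simp: differentiable_def)
  from bounded_linear.has_derivative[OF bounded_linear_vec_nth this, of i]
  show ?thesis
    by (auto simp: differentiable_def)
qed

lemma differentiable_vec_componentwise: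
  fixes f :: "'a::real_normed_vector \<Rightarrow> real^'n"
  assumes "\<And>i. (\<lambda>y. f y $ i) differentiable (at x)"
  shows "f differentiable (at x)"
  unfolding differentiable_componentwise_within[of f]
  using assms by (auto simp: Basis_vec_def inner_axis)

text \<open>By Cramer's rule each coordinate of \<open>s\<close> is, near \<open>x\<close>, a
  quotient of determinants with differentiable entries. Applied to the system solved by
  \<open>X'\<close>, this yields the third derivative of \<open>H\<close>.\<close>

lemma differentiable_linear_system:
  fixes M :: "'a::real_normed_vector \<Rightarrow> real^'n^'n"
  assumes M: "\<And>i j. (\<lambda>y. M y $ i $ j) differentiable (at x)" and c: "c differentiable (at x)"
    and eq: "eventually (\<lambda>y. M y *v s y = c y) (nhds x)" and d: "det (M x) \<noteq> 0"
  shows "s differentiable (at x)"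
proof (rule differentiable_vec_componentwise)
  fix k
  define N where "N y = (\<chi> i j. if j = k then c y $ i else M y $ i $ j)" for y
  have dN: "(\<lambda>y. det (N y)) differentiable (at x)"
  proof (rule differentiable_det)
    show "(\<lambda>y. N y $ i $ j) differentiable (at x)" for i j
      using M[of i j] differentiable_vec_nth[OF c, of i] by (cases "j = k") (simp_all add: N_def)
  qed
  have dM: "(\<lambda>y. det (M y)) differentiable (at x)"
    by (rule differentiable_det[OF M])
  then have "continuous (at x) (\<lambda>y. det (M y))"
    by (rule differentiable_imp_continuous_within)
  then have "eventually (\<lambda>y. det (M y) \<noteq> 0) (nhds x)"
    using d unfolding continuous_at eventually_nhds_conv_at by (simp add: tendsto_imp_eventually_ne)
  with eq have ev: "eventually (\<lambda>y. det (N y) / det (M y) = s y $ k) (nhds x)"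
  proof eventually_elim
    case (elim y)
    then show ?case
      unfolding N_def elim(1)[symmetric] cramer_lemma by simp
  qed
  have "(\<lambda>y. det (N y) / det (M y)) differentiable (at x)"
    by (intro differentiable_divide dN dM d)
  then obtain D where "((\<lambda>y. det (N y) / det (M y)) has_derivative D) (at x)"
    by (auto simp: differentiable_def)
  then have "((\<lambda>y. s y $ k) has_derivative D) (at x)"
    by (rule has_derivative_transform_eventually)
       (use ev in \<open>auto simp: eventually_nhds_conv_at\<close>)
  then show "(\<lambda>y. s y $ k) differentiable (at x)"
    by (auto simp: differentiable_def)
qed

lemma invertible_mult_vec_eq_0:
  fixes A :: "real^'n^'n"
  assumes "invertible A" "A *v x = 0"
  shows "x = 0"
  using assms by (metis invertible_def matrix_vector_mul_assoc matrix_vector_mul_lid matrix_vector_mult_0_right)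

lemma linear_matrix_works: "linear f \<Longrightarrow> matrix f *v x = f x"
  for f :: "real^'n \<Rightarrow> real^'m"
  by (simp add: matrix_works linear_matrix_vector_mul_eq)

lemma matrix_vector_mult_uminus: "(- A) *v x = - (A *v x)" for A :: "real^'n^'m"
  using matrix_vector_mult_diff_rdistrib[of 0 A x] by simp

lemma det_matrix_mono:
  fixes f g :: "real^'n \<Rightarrow> real^'n"
  assumes f: "linear f" and g: "linear g"
    and psd: "\<And>v. 0 \<le> v \<bullet> f v" and det: "0 < det (matrix f)"
    and sym: "\<And>u v. u \<bullet> (g v - f v) = v \<bullet> (g u - f u)"
    and le: "\<And>v. v \<bullet> f v \<le> v \<bullet> g v"
  shows "det (matrix f) \<le> det (matrix g)"
proof -
  define S where "S = matrix g - matrix f"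
  have S: "S *v v = g v - f v" for v
    by (simp add: S_def matrix_vector_mult_diff_rdistrib linear_matrix_works f g)
  have "det (matrix f) \<le> det (matrix f + S)"
  proof (rule det_add_psd_ge)
    have "S $ i $ j = axis i 1 \<bullet> (S *v axis j 1)" for i j
      by (simp add: matrix_vector_mult_basis inner_axis' column_def)
    then have "S $ i $ j = S $ j $ i" for i j
      by (metis S sym)
    then show "transpose S = S"
      by (simp add: transpose_def vec_eq_iff)
    show "0 \<le> v \<bullet> (S *v v)" for v
      using le[of v] by (simp add: S inner_diff_right)
    show "0 \<le> v \<bullet> (matrix f *v v)" for v
      using psd[of v] by (simp add: linear_matrix_works f)
  qed (rule det)
  then show ?thesis by (simp add: S_def)
qed

section \<open>Reflection in a hyperplane and conjugation by it\<close>

definition reflection :: "'a::real_inner \<Rightarrow> 'a \<Rightarrow> 'a" where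
  "reflection e v = v - (2 * (v \<bullet> e)) *\<^sub>R e"

lemma linear_reflection: "linear (reflection e)"
  by (rule linearI) (simp_all add: reflection_def inner_add_left algebra_simps)

lemma inner_reflection_left: "reflection e u \<bullet> v = u \<bullet> reflection e v"
  by (simp add: reflection_def inner_diff_left inner_diff_right inner_commute)

lemma reflection_reflection: "norm e = 1 \<Longrightarrow> reflection e (reflection e v) = v"
  by (simp add: reflection_def inner_diff_left dot_square_norm algebra_simps)

lemma norm_reflection: "norm e = 1 \<Longrightarrow> norm (reflection e v) = norm v"
  by (metis inner_reflection_left norm_eq_sqrt_inner reflection_reflection)

lemma det_reflection_conj:
  fixes f :: "real^'n \<Rightarrow> real^'n"
  assumes "norm e = 1" "linear f"
  shows "det (matrix (\<lambda>v. reflection e (f (reflection e v)))) = det (matrix f)"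
proof -
  let ?r = "reflection e :: real^'n \<Rightarrow> real^'n"
  have r: "linear ?r" by (rule linear_reflection)
  have "matrix (\<lambda>v. ?r (f (?r v))) = matrix ?r ** matrix f ** matrix ?r"
    using matrix_compose[of "f \<circ> ?r" ?r] matrix_compose[of ?r f] assms(2) r linear_compose[OF r assms(2)]
    unfolding linear_matrix_vector_mul_eq by (simp add: o_def matrix_mul_assoc)
  moreover have "matrix ?r ** matrix ?r = mat 1"
    using matrix_compose[of ?r ?r] r reflection_reflection[OF assms(1)]
    by (simp add: o_def matrix_id_mat_1[unfolded id_def])
  then have "det (matrix ?r) * det (matrix ?r) = 1"
    by (metis det_I det_mul)
  ultimately show ?thesis
    by (simp add: det_mul mult_ac)
qed

subsection \<open>Derivatives\<close>

text \<open>The second difference is the increment over \<open>[0, t]\<close> of the function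
  \<open>k\<close> below. The mean value theorem turns it into a difference of two values of
  \<open>g'\<close>, to which differentiability of \<open>g'\<close> at the single point
  \<open>x\<close> applies.\<close>

lemma second_difference_tendsto:
  fixes g :: "'a::real_normed_vector \<Rightarrow> real"
  assumes S: "open S" "x \<in> S"
    and g: "\<And>y. y \<in> S \<Longrightarrow> (g has_derivative g' y) (at y)"
    and T: "((\<lambda>y. g' y v) has_derivative T) (at x)"
  shows "((\<lambda>t. (g (x + t *\<^sub>R u + t *\<^sub>R v) - g (x + t *\<^sub>R u) - g (x + t *\<^sub>R v) + g x) / t^2)
           \<longlongrightarrow> T u) (at_right 0)"
proof (rule tendstoI)
  fix e :: real assume "0 < e"
  interpret T: bounded_linear T
    using T by (rule has_derivative_bounded_linear)
  \<comment> \<open>The two evaluation points lie within \<open>t * (norm u + norm v)\<close> and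
    \<open>t * norm v\<close> of \<open>x\<close>; \<open>K\<close> exceeds the sum of these bounds
    divided by \<open>t\<close>. So \<open>\<eta>\<close> keeps the total error below
    \<open>t * (e / 2)\<close>.\<close>
  define K where "K = norm u + 2 * norm v + 1"
  define \<eta> where "\<eta> = e / (2 * K)"
  have K: "0 < K" "0 < \<eta>"
    using \<open>0 < e\<close> by (auto simp: K_def \<eta>_def add_nonneg_pos)
  obtain d1 where d1: "0 < d1" "ball x d1 \<subseteq> S"
    using S open_contains_ball by blast
  obtain d2 where d2: "0 < d2" and
    T_approx: "\<And>y. norm (y - x) < d2 \<Longrightarrow> norm (g' y v - g' x v - T (y - x)) \<le> \<eta> * norm (y - x)"
    using T K(2) unfolding has_derivative_at_alt by blast
  define d where "d = min d1 d2 / K"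
  have "0 < d" using K d1 d2 by (simp add: d_def)
  have main: "dist ((g (x + t *\<^sub>R u + t *\<^sub>R v) - g (x + t *\<^sub>R u) - g (x + t *\<^sub>R v) + g x) / t^2) (T u) < e"
    if t: "0 < t" "t < d" for t
  proof -
    have small: "norm (a *\<^sub>R u + s *\<^sub>R v) < min d1 d2 \<and> norm (a *\<^sub>R u + s *\<^sub>R v) \<le> t * (norm u + norm v)"
      if "0 \<le> a" "a \<le> t" "0 \<le> s" "s \<le> t" for a s
    proof -
      have "norm (a *\<^sub>R u + s *\<^sub>R v) \<le> a * norm u + s * norm v"
        using that norm_triangle_ineq[of "a *\<^sub>R u" "s *\<^sub>R v"] by simp
      also have "\<dots> \<le> t * norm u + t * norm v"
        using that by (intro add_mono mult_right_mono) auto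
      finally have 1: "norm (a *\<^sub>R u + s *\<^sub>R v) \<le> t * (norm u + norm v)"
        by (simp add: algebra_simps)
      also have "\<dots> < t * K"
        using t by (intro mult_strict_left_mono) (auto simp: K_def add_increasing2 add_strict_increasing2)
      also have "\<dots> \<le> min d1 d2"
        using t K by (simp add: d_def field_simps)
      finally show ?thesis using 1 by simp
    qed
    have inS: "x + a *\<^sub>R u + s *\<^sub>R v \<in> S" if "0 \<le> a" "a \<le> t" "0 \<le> s" "s \<le> t" for a s
      using small[OF that] d1(2) by (auto simp: dist_norm add.assoc subset_iff norm_minus_commute)
    have der: "((\<lambda>s. g (x + a *\<^sub>R u + s *\<^sub>R v)) has_real_derivative g' (x + a *\<^sub>R u + s *\<^sub>R v) v) (at s)"
      if "0 \<le> a" "a \<le> t" "0 \<le> s" "s \<le> t" for a s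
    proof -
      interpret g': bounded_linear "g' (x + a *\<^sub>R u + s *\<^sub>R v)"
        using g[OF inS[OF that]] by (rule has_derivative_bounded_linear)
      have "((\<lambda>s. x + a *\<^sub>R u + s *\<^sub>R v) has_derivative (\<lambda>h. h *\<^sub>R v)) (at s)"
        by (auto intro!: derivative_eq_intros)
      from has_derivative_compose[OF this g[OF inS[OF that]]]
      show ?thesis
        by (simp add: has_field_derivative_def g'.scaleR mult_commute_abs)
    qed
    define k where "k s = g (x + t *\<^sub>R u + s *\<^sub>R v) - g (x + s *\<^sub>R v)" for s
    have "(k has_real_derivative g' (x + t *\<^sub>R u + s *\<^sub>R v) v - g' (x + s *\<^sub>R v) v) (at s)"
      if "0 \<le> s" "s \<le> t" for s
      unfolding k_def using der[of t s] der[of 0 s] that t by (auto intro!: derivative_eq_intros)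
    then obtain s where s: "0 < s" "s < t"
      and k: "k t - k 0 = (t - 0) * (g' (x + t *\<^sub>R u + s *\<^sub>R v) v - g' (x + s *\<^sub>R v) v)"
      using MVT2[of 0 t k "\<lambda>s. g' (x + t *\<^sub>R u + s *\<^sub>R v) v - g' (x + s *\<^sub>R v) v"] t by auto
    have 1: "norm (g' (x + t *\<^sub>R u + s *\<^sub>R v) v - g' x v - T (t *\<^sub>R u + s *\<^sub>R v)) \<le> \<eta> * (t * (norm u + norm v))"
      using T_approx[of "x + t *\<^sub>R u + s *\<^sub>R v"] small[of t s] s t K
      by (smt (verit, best) add.assoc add_diff_cancel_left' mult_left_mono)
    have "norm (s *\<^sub>R v) \<le> t * norm v" "norm (s *\<^sub>R v) < d2"
      using s small[of 0 s] by (auto intro!: mult_right_mono)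
    then have 2: "norm (g' (x + s *\<^sub>R v) v - g' x v - T (s *\<^sub>R v)) \<le> \<eta> * (t * norm v)"
      using T_approx[of "x + s *\<^sub>R v"] K by (smt (verit, best) add_diff_cancel_left' mult_left_mono)
    have "norm (g' (x + t *\<^sub>R u + s *\<^sub>R v) v - g' (x + s *\<^sub>R v) v - t * T u) \<le> \<eta> * (t * (norm u + norm v)) + \<eta> * (t * norm v)"
      using 1 2 by (simp add: T.add T.scaleR)
    also have "\<dots> = t * (\<eta> * (norm u + 2 * norm v))"
      by (simp add: algebra_simps)
    also have "\<dots> < t * (\<eta> * K)"
      using t K by (intro mult_strict_left_mono) (auto simp: K_def)
    also have "\<dots> = t * (e / 2)"
      using K by (simp add: \<eta>_def)
    finally have "\<bar>(k t - k 0) / t - t * T u\<bar> < t * (e/2)"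
      using k t by simp
    then have "\<bar>(k t - k 0) / t - t * T u\<bar> / t < e / 2"
      using t by (simp add: field_simps)
    moreover have "\<bar>(k t - k 0) / t - t * T u\<bar> / t = \<bar>(k t - k 0) / t^2 - T u\<bar>"
      using t by (simp add: abs_div_pos diff_divide_distrib power2_eq_square)
    ultimately have "\<bar>(k t - k 0) / t^2 - T u\<bar> < e / 2" by simp
    then show ?thesis
      using \<open>0 < e\<close> by (simp add: k_def dist_real_def algebra_simps)
  qed
  then show "\<forall>\<^sub>F t in at_right 0. dist ((g (x + t *\<^sub>R u + t *\<^sub>R v) - g (x + t *\<^sub>R u) - g (x + t *\<^sub>R v) + g x) / t^2) (T u) < e"
    unfolding eventually_at_right_field using \<open>0 < d\<close> by blast
qed

text \<open>The second difference is symmetric in \<open>u\<close> and \<open>v\<close>, so its two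
  limits coincide. This form of the theorem suits \<open>X'\<close>, which is only known to be
  differentiable at each point.\<close>

lemma second_derivative_symmetric:
  fixes g :: "'a::real_normed_vector \<Rightarrow> real"
  assumes S: "open S" "x \<in> S"
    and g: "\<And>y. y \<in> S \<Longrightarrow> (g has_derivative g' y) (at y)"
    and T: "\<And>v. ((\<lambda>y. g' y v) has_derivative T v) (at x)"
  shows "T u v = T v u"
proof -
  have 1: "((\<lambda>t. (g (x + t *\<^sub>R v + t *\<^sub>R u) - g (x + t *\<^sub>R v) - g (x + t *\<^sub>R u) + g x) / t^2)
           \<longlongrightarrow> T u v) (at_right 0)"
    by (rule second_difference_tendsto[OF S g T])
  have "((\<lambda>t. (g (x + t *\<^sub>R u + t *\<^sub>R v) - g (x + t *\<^sub>R u) - g (x + t *\<^sub>R v) + g x) / t^2)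
           \<longlongrightarrow> T v u) (at_right 0)"
    by (rule second_difference_tendsto[OF S g T])
  then have 2: "((\<lambda>t. (g (x + t *\<^sub>R v + t *\<^sub>R u) - g (x + t *\<^sub>R v) - g (x + t *\<^sub>R u) + g x) / t^2)
           \<longlongrightarrow> T v u) (at_right 0)"
    by (simp add: algebra_simps)
  show ?thesis
    using tendsto_unique[OF _ 1 2] by simp
qed

lemma pos_at_right_of_second_derivative:
  fixes g :: "real \<Rightarrow> real"
  assumes "0 < d" "\<And>t. 0 \<le> t \<Longrightarrow> t < d \<Longrightarrow> (g has_real_derivative g' t) (at t)"
    and "(g' has_real_derivative c) (at 0)" "g' 0 = 0" "g 0 = 0" "0 < c"
  shows "\<exists>r>0. \<forall>t. 0 < t \<and> t < r \<longrightarrow> 0 < g t"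
proof -
  obtain r where r: "0 < r" "\<And>t. 0 < t \<Longrightarrow> t < r \<Longrightarrow> g' 0 < g' t"
    using DERIV_pos_inc_right[OF assms(3,6)] by auto
  have "0 < g t" if t: "0 < t" "t < min r d" for t
  proof -
    obtain s where "0 < s" "s < t" "g t - g 0 = (t - 0) * g' s"
      using MVT2[of 0 t g g'] assms(2) t by (metis le_less_trans min_less_iff_conj)
    with r(2)[of s] t show ?thesis using assms(4,5) by simp
  qed
  then show ?thesis using r(1) assms(1) by (intro exI[of _ "min r d"]) auto
qed

lemma second_derivative_le_0:
  fixes g :: "real \<Rightarrow> real"
  assumes "0 < d" "\<And>t. 0 \<le> t \<Longrightarrow> t < d \<Longrightarrow> (g has_real_derivative g' t) (at t)"
    and "(g' has_real_derivative c) (at 0)" "g' 0 = 0" "g 0 = 0"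
    and le: "\<And>t. 0 < t \<Longrightarrow> t < d \<Longrightarrow> g t \<le> 0"
  shows "c \<le> 0"
proof (rule ccontr)
  assume "\<not> c \<le> 0"
  then obtain r where r: "0 < r" "\<And>t. 0 < t \<Longrightarrow> t < r \<Longrightarrow> 0 < g t"
    using pos_at_right_of_second_derivative[OF assms(1-5)] by auto
  define t where "t = min r d / 2"
  have "0 < t" "t < r" "t < d" using r(1) \<open>0 < d\<close> by (auto simp: t_def)
  then show False using le[of t] r(2)[of t] by simp
qed

text \<open>If \<open>c\<close> were positive, the second order test applied to \<open>g1\<close>
  would make \<open>g1\<close>, and hence \<open>g\<close>, positive to the right of
  \<open>0\<close>.\<close>

lemma third_derivative_le_0:
  fixes g :: "real \<Rightarrow> real"
  assumes "0 < d" and g1: "\<And>t. 0 \<le> t \<Longrightarrow> t < d \<Longrightarrow> (g has_real_derivative g1 t) (at t)"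
    and g2: "\<And>t. 0 \<le> t \<Longrightarrow> t < d \<Longrightarrow> (g1 has_real_derivative g2 t) (at t)"
    and "(g2 has_real_derivative c) (at 0)" "g2 0 = 0" "g1 0 = 0" "g 0 = 0"
    and le: "\<And>t. 0 < t \<Longrightarrow> t < d \<Longrightarrow> g t \<le> 0"
  shows "c \<le> 0"
proof (rule ccontr)
  assume "\<not> c \<le> 0"
  then obtain r where r: "0 < r" "\<And>t. 0 < t \<Longrightarrow> t < r \<Longrightarrow> 0 < g1 t"
    using pos_at_right_of_second_derivative[OF \<open>0 < d\<close> g2 assms(4)] assms by auto
  define t where "t = min r d / 2"
  have t: "0 < t" "t < r" "t < d" using r(1) \<open>0 < d\<close> by (auto simp: t_def)
  then obtain s where "0 < s" "s < t" "g t - g 0 = (t - 0) * g1 s"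
    using MVT2[of 0 t g g1] g1 by (metis le_less_trans)
  with r(2)[of s] t le[of t] assms(7) show False
    by (smt (verit) mult_pos_pos)
qed

text \<open>The error \<open>X z - X y - L (\<rho>' (z - y))\<close> is \<open>L\<close> applied to
  the difference of the Taylor remainders of \<open>\<rho>\<close> and \<open>\<Phi>\<close>. The
  latter is small only relative to \<open>norm (X z - X y)\<close>, so a Lipschitz bound for
  \<open>X\<close> at \<open>y\<close> comes first.\<close>

lemma has_derivative_implicit:
  fixes \<Phi> :: "'b::real_normed_vector \<Rightarrow> 'c::real_normed_vector" and X :: "'a::real_normed_vector \<Rightarrow> 'b"
  assumes eq: "eventually (\<lambda>z. \<Phi> (X z) = \<rho> z) (nhds y)"
    and cont: "continuous (at y) X"
    and \<rho>: "(\<rho> has_derivative \<rho>') (at y)"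
    and \<Phi>: "(\<Phi> has_derivative A) (at (X y))"
    and L: "bounded_linear L" "\<And>v. L (A v) = v"
  shows "(X has_derivative (\<lambda>v. L (\<rho>' v))) (at y)"
proof -
  interpret L: bounded_linear L by fact
  interpret A: bounded_linear A using \<Phi> by (rule has_derivative_bounded_linear)
  interpret \<rho>': bounded_linear \<rho>' using \<rho> by (rule has_derivative_bounded_linear)
  obtain CL where CL: "0 < CL" "\<And>x. norm (L x) \<le> norm x * CL"
    using L.pos_bounded by blast
  obtain CR where CR: "0 < CR" "\<And>x. norm (\<rho>' x) \<le> norm x * CR"
    using \<rho>'.pos_bounded by blast
  have \<Phi>y: "\<Phi> (X y) = \<rho> y" using eq by (rule eventually_nhds_x_imp_x)
  have key: "eventually (\<lambda>z. norm (X z - X y - L (\<rho>' (z - y))) \<le>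
      CL * (e * norm (z - y) + e * norm (X z - X y))) (nhds y)" if "0 < e" for e
  proof -
    obtain d1 where d1: "0 < d1" "\<And>z. norm (z - y) < d1 \<Longrightarrow> norm (\<rho> z - \<rho> y - \<rho>' (z - y)) \<le> e * norm (z - y)"
      using \<rho> \<open>0 < e\<close> unfolding has_derivative_at_alt by blast
    obtain d2 where d2: "0 < d2" "\<And>p. norm (p - X y) < d2 \<Longrightarrow> norm (\<Phi> p - \<Phi> (X y) - A (p - X y)) \<le> e * norm (p - X y)"
      using \<Phi> \<open>0 < e\<close> unfolding has_derivative_at_alt by blast
    have "eventually (\<lambda>z. norm (X z - X y) < d2) (nhds y)"
      using cont d2(1) unfolding continuous_at tendsto_iff eventually_nhds_conv_at dist_norm by auto
    moreover have "eventually (\<lambda>z. norm (z - y) < d1) (nhds y)"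
      using d1(1) by (auto simp: eventually_nhds_metric dist_norm)
    ultimately show ?thesis using eq
    proof eventually_elim
      case (elim z)
      have "X z - X y - L (\<rho>' (z - y)) = L ((\<rho> z - \<rho> y - \<rho>' (z - y)) - (\<Phi> (X z) - \<Phi> (X y) - A (X z - X y)))"
        using elim(3) \<Phi>y by (simp add: L.diff[symmetric] L(2)) (simp add: L.diff L(2))
      also have "norm \<dots> \<le> norm ((\<rho> z - \<rho> y - \<rho>' (z - y)) - (\<Phi> (X z) - \<Phi> (X y) - A (X z - X y))) * CL"
        by (rule CL)
      also have "\<dots> \<le> (e * norm (z - y) + e * norm (X z - X y)) * CL"
        using CL(1) d1(2)[OF elim(2)] d2(2)[OF elim(1)]
        by (intro mult_right_mono norm_triangle_le_diff) auto
      finally show ?case by (simp add: mult.commute)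
    qed
  qed
  \<comment> \<open>With \<open>e = 1 / (2 * CL)\<close> in \<open>key\<close>, half of
    \<open>norm (X z - X y)\<close> remains on the right and is absorbed on the left; doubling the
    other terms stays within \<open>B * norm (z - y)\<close>.\<close>
  define B where "B = 2 * (CL * CR + 1)"
  have "0 < B" using CL CR by (simp add: B_def add_pos_pos)
  have lip: "eventually (\<lambda>z. norm (X z - X y) \<le> B * norm (z - y)) (nhds y)"
    using key[of "1 / (2 * CL)", simplified, OF CL(1)]
  proof eventually_elim
    case (elim z)
    have "norm (L (\<rho>' (z - y))) \<le> CL * CR * norm (z - y)"
      using CL(2)[of "\<rho>' (z - y)"] CR(2)[of "z - y"] CL(1)
      by (smt (verit, best) mult.assoc mult.commute mult_right_mono)
    moreover have "norm (X z - X y) \<le> norm (X z - X y - L (\<rho>' (z - y))) + norm (L (\<rho>' (z - y)))"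
      by (metis diff_add_cancel norm_triangle_ineq)
    moreover have "norm (X z - X y - L (\<rho>' (z - y))) \<le> norm (z - y) / 2 + norm (X z - X y) / 2"
    proof -
      have "CL * (1 / (2 * CL) * norm (z - y) + 1 / (2 * CL) * norm (X z - X y)) = norm (z - y) / 2 + norm (X z - X y) / 2"
        using CL(1) by (simp add: field_simps)
      with elim show ?thesis by simp
    qed
    moreover have "B * norm (z - y) = 2 * (CL * CR * norm (z - y)) + 2 * norm (z - y)"
      by (simp add: B_def algebra_simps)
    ultimately show ?case using norm_ge_zero[of "z - y"] by linarith
  qed
  show ?thesis
    unfolding has_derivative_at_alt
  proof (intro conjI allI impI)
    show "bounded_linear (\<lambda>v. L (\<rho>' v))"
      by (rule bounded_linear_compose[OF L(1) \<rho>'.bounded_linear_axioms])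
    fix e :: real assume "0 < e"
    \<comment> \<open>Chosen so that \<open>CL * (e' + e' * B) = e\<close>.\<close>
    define e' where "e' = e / (CL * (1 + B))"
    have "0 < e'" using \<open>0 < e\<close> CL \<open>0 < B\<close> by (simp add: e'_def)
    have "eventually (\<lambda>z. norm (X z - X y - L (\<rho>' (z - y))) \<le> e * norm (z - y)) (nhds y)"
      using key[OF \<open>0 < e'\<close>] lip
    proof eventually_elim
      case (elim z)
      note elim(1)
      also have "CL * (e' * norm (z - y) + e' * norm (X z - X y)) \<le> CL * (e' * norm (z - y) + e' * (B * norm (z - y)))"
        using elim(2) CL \<open>0 < e'\<close> by (intro mult_left_mono add_left_mono) auto
      also have "\<dots> = e' * (CL * (1 + B)) * norm (z - y)"
        by (simp add: algebra_simps)
      also have "e' * (CL * (1 + B)) = e"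
        using CL \<open>0 < B\<close> by (simp add: e'_def)
      finally show ?case .
    qed
    then show "\<exists>d>0. \<forall>z. norm (z - y) < d \<longrightarrow> norm (X z - X y - L (\<rho>' (z - y))) \<le> e * norm (z - y)"
      by (auto simp: eventually_nhds_metric dist_norm)
  qed
qed

lemma has_derivative_line:
  fixes f :: "'a::real_normed_vector \<Rightarrow> 'b::real_normed_vector"
  assumes "(f has_derivative f') (at (a + t *\<^sub>R v))"
  shows "((\<lambda>s. f (a + s *\<^sub>R v)) has_derivative (\<lambda>h. h *\<^sub>R f' v)) (at t)"
proof -
  interpret f': bounded_linear f' using assms by (rule has_derivative_bounded_linear)
  have "((\<lambda>s. a + s *\<^sub>R v) has_derivative (\<lambda>h. h *\<^sub>R v)) (at t)"
    by (auto intro!: derivative_eq_intros)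
  from has_derivative_compose[OF this assms] show ?thesis
    by (simp add: f'.scaleR)
qed

lemma has_real_derivative_line:
  fixes f :: "'a::real_normed_vector \<Rightarrow> real"
  assumes "(f has_derivative f') (at (a + t *\<^sub>R v))"
  shows "((\<lambda>s. f (a + s *\<^sub>R v)) has_real_derivative f' v) (at t)"
  using has_derivative_line[OF assms] by (simp add: has_field_derivative_def mult_commute_abs)

lemma norm_add_diff_diff: "norm (z + a - (z - a)) = 2 * norm (a::'a::real_normed_vector)"
proof -
  have "z + a - (z - a) = 2 *\<^sub>R a" by (simp add: scaleR_2)
  then show ?thesis by simp
qed

lemma add_scaleR_nonzero:
  fixes x v :: "'a::real_normed_vector"
  assumes "\<bar>t\<bar> < norm x / (norm v + 1)"
  shows "x + t *\<^sub>R v \<noteq> 0"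
proof
  assume "x + t *\<^sub>R v = 0"
  then have "norm x = \<bar>t\<bar> * norm v"
    by (metis add_eq_0_iff norm_minus_cancel norm_scaleR)
  also have "\<dots> \<le> \<bar>t\<bar> * (norm v + 1)" by (simp add: distrib_left)
  also have "\<dots> < norm x" using assms by (subst (asm) pos_less_divide_eq) (auto simp: add_nonneg_pos)
  finally show False by simp
qed

lemma norm_cos_sin:
  fixes x e :: "'a::real_inner"
  assumes "norm x = 1" "norm e = 1" "e \<bullet> x = 0"
  shows "norm (cos t *\<^sub>R x + sin t *\<^sub>R e) = 1"
proof -
  have "(norm (cos t *\<^sub>R x + sin t *\<^sub>R e))\<^sup>2 = (cos t)\<^sup>2 * (norm x)\<^sup>2 + (sin t)\<^sup>2 * (norm e)\<^sup>2"
    using assms(3) unfolding power2_norm_eq_inner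
    by (simp add: inner_add_left inner_add_right inner_commute power2_eq_square)
  then have "(norm (cos t *\<^sub>R x + sin t *\<^sub>R e))\<^sup>2 = 1" using assms by simp
  then show ?thesis by (simp add: power2_eq_1_iff) (metis norm_ge_zero neg_0_le_iff_le not_one_le_zero)
qed

subsection \<open>The two-point maximum principle\<close>

text \<open>
  On the unit sphere \<open>X\<close> is the inverse Gauss map, \<open>H\<close> below is the support function and \<open>F\<close> is the
  reciprocal of the Gauss curvature: the summand \<open>(v \<bullet> x) *\<^sub>R x\<close> completes \<open>X' x\<close>, which vanishes
  on \<open>x\<close>, by the identity in the normal direction.
\<close>

locale smooth_support =
  fixes X :: "real^'m \<Rightarrow> real^'m" and X' :: "real^'m \<Rightarrow> real^'m \<Rightarrow> real^'m"
  assumes has_derivative: "y \<noteq> 0 \<Longrightarrow> (X has_derivative X' y) (at y)"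
    and differentiable_X': "y \<noteq> 0 \<Longrightarrow> (\<lambda>y. X' y v) differentiable (at y)"
    and homogeneous: "y \<noteq> 0 \<Longrightarrow> 0 < t \<Longrightarrow> X (t *\<^sub>R y) = X y"
    and support: "x \<noteq> 0 \<Longrightarrow> y \<noteq> 0 \<Longrightarrow> X x \<bullet> y \<le> X y \<bullet> y"
    and inj: "inj_on X (sphere 0 1)"
    and det_pos: "norm x = 1 \<Longrightarrow> 0 < det (matrix (\<lambda>v. X' x v + (v \<bullet> x) *\<^sub>R x))"
begin

definition "H y = X y \<bullet> y"
definition "M y = (\<lambda>v. X' y v + (v \<bullet> y) *\<^sub>R y)"
definition "F y = det (matrix (M y))"
text \<open>The direction of differentiation is \<open>u\<close>, and \<open>v\<close> is held
  fixed; \<open>X'' y u v \<bullet> w\<close> is the third derivative of \<open>H\<close>.\<close>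

definition "X'' y u v = frechet_derivative (\<lambda>y. X' y v) (at y) u"

section \<open>Derivatives of \<open>H\<close> and convexity\<close>

lemma linear_X': "y \<noteq> 0 \<Longrightarrow> linear (X' y)"
  using has_derivative has_derivative_linear by blast

lemma linear_M: assumes "y \<noteq> 0" shows "linear (M y)"
proof -
  interpret linear "X' y" using assms by (rule linear_X')
  show ?thesis by (rule linearI) (simp_all add: M_def add scaleR inner_add_left algebra_simps)
qed

lemma F_pos: "norm x = 1 \<Longrightarrow> 0 < F x"
  using det_pos by (simp add: F_def M_def)

lemma isCont_X: "y \<noteq> 0 \<Longrightarrow> isCont X y"
  using has_derivative has_derivative_continuous by blast

text \<open>For fixed \<open>y\<close>, \<open>support\<close> says that
  \<open>X z \<bullet> y\<close> is maximal at \<open>z = y\<close>. This cancels the second term of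
  the product rule for \<open>H\<close> and makes \<open>X\<close> its gradient.\<close>

lemma X'_inner_self:
  assumes "y \<noteq> 0" shows "X' y v \<bullet> y = 0"
proof -
  have "((\<lambda>z. X z \<bullet> y) has_derivative (\<lambda>v. X' y v \<bullet> y)) (at y)"
    by (auto intro!: derivative_eq_intros has_derivative assms)
  then have "(\<lambda>v. X' y v \<bullet> y) = (\<lambda>v. 0)"
    by (rule differential_zero_maxmin[of y "- {0}", rotated 2]) (use assms support in auto)
  then show ?thesis by metis
qed

lemma has_derivative_H:
  assumes "y \<noteq> 0" shows "(H has_derivative (\<lambda>v. X y \<bullet> v)) (at y)"
  unfolding H_def using assms
  by (auto intro!: derivative_eq_intros has_derivative simp: X'_inner_self)

lemma isCont_H: "y \<noteq> 0 \<Longrightarrow> isCont H y"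
  using has_derivative_H has_derivative_continuous by blast

lemma has_derivative_X_inner:
  "y \<noteq> 0 \<Longrightarrow> ((\<lambda>y. X y \<bullet> w) has_derivative (\<lambda>u. X' y u \<bullet> w)) (at y)"
  by (auto intro!: derivative_eq_intros has_derivative)

text \<open>\<open>X' y\<close> is the Hessian of \<open>H\<close>.\<close>

lemma X'_symmetric: "y \<noteq> 0 \<Longrightarrow> X' y u \<bullet> v = X' y v \<bullet> u"
  using second_derivative_symmetric[of "- {0}" y H "\<lambda>y v. X y \<bullet> v" "\<lambda>v u. X' y u \<bullet> v" v u]
  by (simp add: has_derivative_H has_derivative_X_inner open_Compl)

lemma has_derivative_X':
  "y \<noteq> 0 \<Longrightarrow> ((\<lambda>y. X' y v) has_derivative (\<lambda>u. X'' y u v)) (at y)"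
  using differentiable_X' unfolding X''_def frechet_derivative_works .

lemma has_derivative_X'_inner:
  "y \<noteq> 0 \<Longrightarrow> ((\<lambda>y. X' y v \<bullet> w) has_derivative (\<lambda>u. X'' y u v \<bullet> w)) (at y)"
  by (auto intro!: derivative_eq_intros has_derivative_X')

text \<open>Symmetry of the second derivative of each component of \<open>X\<close>. With
  \<open>X''_symmetric\<close>, which differentiates \<open>X'_symmetric\<close>, the third
  derivative of \<open>H\<close> becomes symmetric in all three arguments.\<close>

lemma X''_commute: assumes "y \<noteq> 0" shows "X'' y u v = X'' y v u"
proof -
  have "X'' y u v \<bullet> w = X'' y v u \<bullet> w" for w
    using second_derivative_symmetric[of "- {0}" y "\<lambda>y. X y \<bullet> w" "\<lambda>y v. X' y v \<bullet> w" "\<lambda>v u. X'' y u v \<bullet> w" v u]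
      assms by (simp add: has_derivative_X_inner has_derivative_X'_inner open_Compl)
  then show ?thesis by (metis vector_eq_rdot)
qed

lemma X''_symmetric: assumes "y \<noteq> 0" shows "X'' y u v \<bullet> w = X'' y u w \<bullet> v"
proof -
  have "((\<lambda>y. X' y v \<bullet> w) has_derivative (\<lambda>u. X'' y u w \<bullet> v)) (at y)"
    by (rule has_derivative_transform_within_open[OF has_derivative_X'_inner[OF assms], of "- {0}"])
       (use assms X'_symmetric in auto)
  then have "(\<lambda>u. X'' y u v \<bullet> w) = (\<lambda>u. X'' y u w \<bullet> v)"
    by (rule has_derivative_unique[OF has_derivative_X'_inner[OF assms]])
  then show ?thesis by metis
qed

lemma X_monotone: "x \<noteq> 0 \<Longrightarrow> y \<noteq> 0 \<Longrightarrow> 0 \<le> (X x - X y) \<bullet> (x - y)"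
  using support[of x y] support[of y x] by (simp add: inner_diff_left inner_diff_right)

text \<open>The infinitesimal form of \<open>X_monotone\<close>; the step \<open>h\<close> stays
  below \<open>r\<close> so that the line does not reach the origin.\<close>

lemma X'_psd: assumes "y \<noteq> 0" shows "0 \<le> X' y v \<bullet> v"
proof (rule ccontr)
  assume "\<not> ?thesis"
  have "((\<lambda>s. X (y + s *\<^sub>R v) \<bullet> v) has_real_derivative X' y v \<bullet> v) (at 0)"
    using has_real_derivative_line[of "\<lambda>y. X y \<bullet> v" "\<lambda>u. X' y u \<bullet> v" y 0 v]
      has_derivative_X_inner[OF assms] by simp
  from DERIV_neg_dec_right[OF this] \<open>\<not> ?thesis\<close> obtain d where
    d: "0 < d" "\<And>h. 0 < h \<Longrightarrow> h < d \<Longrightarrow> X (y + h *\<^sub>R v) \<bullet> v < X y \<bullet> v"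
    by auto
  define r where "r = norm y / (norm v + 1)"
  have "0 < r" using assms by (simp add: r_def add_nonneg_pos)
  define h where "h = min d r / 2"
  have h: "0 < h" "h < d" "h < r"
    using d(1) \<open>0 < r\<close> by (auto simp: h_def)
  then have "y + h *\<^sub>R v \<noteq> 0"
    by (intro add_scaleR_nonzero) (simp add: r_def)
  from X_monotone[OF this assms] have "0 \<le> h * ((X (y + h *\<^sub>R v) - X y) \<bullet> v)"
    by simp
  with d(2)[OF h(1,2)] h(1) show False
    by (simp add: zero_le_mult_iff inner_diff_left)
qed

lemma H_homogeneous: "y \<noteq> 0 \<Longrightarrow> 0 < t \<Longrightarrow> H (t *\<^sub>R y) = t * H y"
  by (simp add: H_def homogeneous)

lemma H_diff_le: "x \<noteq> 0 \<Longrightarrow> y \<noteq> 0 \<Longrightarrow> H x - H y \<le> X x \<bullet> (x - y)"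
  using support[of x y] by (simp add: H_def inner_diff_right)

text \<open>\<open>L\<close> is the supremum of the difference quotients over pairs of distinct unit
  vectors. That set of pairs is not compact: a maximising sequence may run into the diagonal.
  Recording the unit chord direction as a third component restores compactness and supplies
  \<open>e\<close> in that case.\<close>

lemma H_chord_lipschitz_sharp:
  assumes nonconst: "norm a = 1" "norm b = 1" "H a \<noteq> H b"
  obtains L where "0 < L" "\<And>x y. norm x = 1 \<Longrightarrow> norm y = 1 \<Longrightarrow> H x - H y \<le> L * norm (x - y)"
    and "(\<exists>x y. norm x = 1 \<and> norm y = 1 \<and> x \<noteq> y \<and> H x - H y = L * norm (x - y)) \<or>
         (\<exists>x e. norm x = 1 \<and> norm e = 1 \<and> e \<bullet> x = 0 \<and> L \<le> X x \<bullet> e)"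
proof -
  define S where "S = {(x, y). norm x = 1 \<and> norm y = 1 \<and> x \<noteq> (y::real^'m)}"
  define q where "q = (\<lambda>(x, y). (H x - H y) / norm (x - y))"
  define L where "L = (SUP p\<in>S. q p)"
  have "continuous_on (sphere 0 1) X"
    by (rule continuous_at_imp_continuous_on) (metis isCont_X mem_sphere_0 norm_zero zero_neq_one)
  then have "bounded (X ` sphere 0 1)"
    by (intro compact_imp_bounded compact_continuous_image) auto
  then obtain K where K: "\<And>x. norm x = 1 \<Longrightarrow> norm (X x) \<le> K"
    unfolding bounded_iff by (metis imageI mem_sphere_0)
  have "q p \<le> K" if pS: "p \<in> S" for p
  proof -
    obtain x y where p: "p = (x, y)" "norm x = 1" "norm y = 1" "x \<noteq> y"
      using pS by (cases p) (auto simp: S_def)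
    have "H x - H y \<le> X x \<bullet> (x - y)"
      using p by (intro H_diff_le) auto
    also have "\<dots> \<le> norm (X x) * norm (x - y)"
      by (rule norm_cauchy_schwarz)
    also have "\<dots> \<le> K * norm (x - y)"
      using K p by (intro mult_right_mono) auto
    finally show ?thesis using p by (simp add: q_def field_simps)
  qed
  then have bdd: "bdd_above (q ` S)" unfolding bdd_above_def by blast
  have ab: "(a, b) \<in> S" "(b, a) \<in> S" using nonconst by (auto simp: S_def)
  have L_ub: "q p \<le> L" if "p \<in> S" for p
    unfolding L_def using bdd that by (rule cSUP_upper2) simp
  \<comment> \<open>\<open>q\<close> changes sign when the pair is swapped, so one order of
    \<open>a\<close>, \<open>b\<close> gives a positive quotient.\<close>
  have "q (a, b) > 0 \<or> q (b, a) > 0"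
    using nonconst ab by (auto simp: q_def S_def zero_less_divide_iff)
  then have "0 < L" using L_ub[OF ab(1)] L_ub[OF ab(2)] by linarith
  have lip: "H x - H y \<le> L * norm (x - y)" if "norm x = 1" "norm y = 1" for x y
  proof (cases "x = y")
    case False
    then show ?thesis using L_ub[of "(x, y)"] that by (simp add: S_def q_def field_simps)
  qed simp
  have "\<exists>p\<in>S. L - 1 / Suc n < q p" for n
  proof -
    have "L - 1 / Suc n < L" by simp
    then show ?thesis
      unfolding L_def using less_cSUP_iff[OF _ bdd] ab by (metis (no_types, lifting) L_def empty_iff)
  qed
  then obtain p where p: "\<And>n. p n \<in> S" "\<And>n. L - 1 / Suc n < q (p n)" by metis
  define u where "u n = (fst (p n) - snd (p n)) /\<^sub>R norm (fst (p n) - snd (p n))" for n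
  define K3 where "K3 = sphere (0::real^'m) 1 \<times> sphere (0::real^'m) 1 \<times> sphere (0::real^'m) 1"
  have pn: "norm (fst (p n)) = 1" "norm (snd (p n)) = 1" "fst (p n) \<noteq> snd (p n)" for n
    using p(1)[of n] by (auto simp: S_def split: prod.splits)
  have inK3: "\<forall>n. (fst (p n), snd (p n), u n) \<in> K3"
    using pn by (auto simp: K3_def u_def)
  have "compact K3" unfolding K3_def by (intro compact_Times compact_sphere)
  then obtain l r where l: "l \<in> K3" "strict_mono r"
     "((\<lambda>n. (fst (p n), snd (p n), u n)) \<circ> r) \<longlonglongrightarrow> l"
    unfolding compact_eq_seq_compact_metric by (rule seq_compactE[OF _ inK3])
  obtain x y e where xye: "l = (x, y, e)" by (metis prod.exhaust)
  have lim: "(\<lambda>n. fst (p (r n))) \<longlonglongrightarrow> x" "(\<lambda>n. snd (p (r n))) \<longlonglongrightarrow> y" "(\<lambda>n. u (r n)) \<longlonglongrightarrow> e"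
    using tendsto_fst[OF l(3)] tendsto_fst[OF tendsto_snd[OF l(3)]] tendsto_snd[OF tendsto_snd[OF l(3)]]
    by (simp_all add: xye o_def)
  have n1: "norm x = 1" "norm y = 1" "norm e = 1" using l(1) by (auto simp: xye K3_def)
  then have nz: "x \<noteq> 0" "y \<noteq> 0" by auto
  have "(\<lambda>n. 1 / real (Suc n)) \<longlonglongrightarrow> 0" using LIMSEQ_inverse_real_of_nat by (simp add: inverse_eq_divide)
  then have "(\<lambda>n. L - 1 / real (Suc (r n))) \<longlonglongrightarrow> L - 0"
    using LIMSEQ_subseq_LIMSEQ[OF _ l(2)] by (intro tendsto_diff) (auto simp: o_def)
  then have limL: "(\<lambda>n. L - 1 / real (Suc (r n))) \<longlonglongrightarrow> L" by simp
  have limH: "(\<lambda>n. H (fst (p (r n)))) \<longlonglongrightarrow> H x" "(\<lambda>n. H (snd (p (r n)))) \<longlonglongrightarrow> H y"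
     "(\<lambda>n. X (fst (p (r n)))) \<longlonglongrightarrow> X x"
    using lim isCont_H isCont_X nz by (auto intro: isCont_tendsto_compose)
  show thesis
  proof (rule that[OF \<open>0 < L\<close> lip])
    show "(\<exists>x y. norm x = 1 \<and> norm y = 1 \<and> x \<noteq> y \<and> H x - H y = L * norm (x - y)) \<or>
         (\<exists>x e. norm x = 1 \<and> norm e = 1 \<and> e \<bullet> x = 0 \<and> L \<le> X x \<bullet> e)"
    proof (cases "x = y")
      case False
      have "(\<lambda>n. q (p (r n))) \<longlonglongrightarrow> (H x - H y) / norm (x - y)"
        unfolding q_def case_prod_unfold using False by (intro tendsto_intros lim limH) simp
      from LIMSEQ_le[OF limL this] p(2) have "L \<le> (H x - H y) / norm (x - y)"
        by (meson less_imp_le)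
      then have "L * norm (x - y) \<le> H x - H y"
        using False by (simp add: field_simps)
      with lip[OF n1(1,2)] False n1 show ?thesis by fastforce
    next
      case True
      \<comment> \<open>Convexity bounds the quotient by \<open>X\<close> paired with the chord
        direction, an expression that still has a limit when the two points merge.\<close>
      have "q (p n) \<le> X (fst (p n)) \<bullet> u n" for n
      proof -
        have "H (fst (p n)) - H (snd (p n)) \<le> X (fst (p n)) \<bullet> (fst (p n) - snd (p n))"
          using pn[of n] by (intro H_diff_le) auto
        from divide_right_mono[OF this norm_ge_zero, of "fst (p n) - snd (p n)"]
        show ?thesis by (simp add: q_def u_def case_prod_unfold divide_inverse mult.commute)
      qed
      then have "L - 1 / real (Suc (r n)) \<le> X (fst (p (r n))) \<bullet> u (r n)" for n
        using p(2)[of "r n"] by (metis less_imp_le order_trans)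
      then have "L \<le> X x \<bullet> e"
        by (intro LIMSEQ_le[OF limL tendsto_inner[OF limH(3) lim(3)]]) auto
      \<comment> \<open>A chord of the sphere is orthogonal to the sum of its endpoints; in the
        limit \<open>e\<close> becomes tangent at \<open>x\<close>.\<close>
      have "(fst (p n) - snd (p n)) \<bullet> (fst (p n) + snd (p n)) = 0" for n
        using pn[of n] by (simp add: inner_diff_left inner_add_right norm_eq_1) (simp add: inner_commute)
      then have "u n \<bullet> (fst (p n) + snd (p n)) = 0" for n
        by (simp add: u_def)
      moreover have "(\<lambda>n. u (r n) \<bullet> (fst (p (r n)) + snd (p (r n)))) \<longlonglongrightarrow> e \<bullet> (x + y)"
        by (intro tendsto_intros lim)
      ultimately have "e \<bullet> (x + y) = 0"
        by (simp add: LIMSEQ_const_iff)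
      then have "e \<bullet> x = 0" unfolding inner_add_right True[symmetric] by simp
      with \<open>L \<le> X x \<bullet> e\<close> n1 show ?thesis by blast
    qed
  qed
qed

text \<open>Both sides are homogeneous of degree one. Since \<open>R\<close> preserves norms, the
  inequality becomes available for \<open>z\<close>, \<open>R z\<close> anywhere off the
  origin.\<close>

lemma H_lipschitz_extend:
  assumes lip: "\<And>x y. norm x = 1 \<Longrightarrow> norm y = 1 \<Longrightarrow> H x - H y \<le> L * norm (x - y)"
    and "norm z = norm w" "z \<noteq> 0"
  shows "H z - H w \<le> L * norm (z - w)"
proof -
  define t where "t = norm z"
  have t: "0 < t" "w \<noteq> 0" using assms by (auto simp: t_def)
  have "H z = t * H (z /\<^sub>R t)" "H w = t * H (w /\<^sub>R t)"
    using H_homogeneous[of "z /\<^sub>R t" t] H_homogeneous[of "w /\<^sub>R t" t] t assms by auto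
  moreover have "H (z /\<^sub>R t) - H (w /\<^sub>R t) \<le> L * norm (z /\<^sub>R t - w /\<^sub>R t)"
    using assms t by (intro lip) (auto simp: t_def)
  moreover have "norm (z /\<^sub>R t - w /\<^sub>R t) = norm (z - w) / t"
    using t by (simp add: divide_inverse mult.commute flip: scaleR_diff_right)
  ultimately have le: "H (z /\<^sub>R t) - H (w /\<^sub>R t) \<le> L * (norm (z - w) / t)"
      and eq: "H z - H w = t * (H (z /\<^sub>R t) - H (w /\<^sub>R t))"
    by (simp_all add: right_diff_distrib)
  have "H z - H w \<le> t * (L * (norm (z - w) / t))"
    unfolding eq using t(1) by (intro mult_left_mono le) simp
  then show ?thesis using t by simp
qed

text \<open>On the half-space \<open>0 < z \<bullet> e\<close> the Lipschitz inequality for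
  \<open>z\<close>, \<open>R z\<close> reads \<open>W z \<le> 0\<close>, with equality at
  \<open>x\<close>. The chord contributes only a linear term to \<open>W\<close>, so the second
  order condition compares the Hessians of \<open>H\<close> and \<open>H \<circ> R\<close>
  directly.\<close>

lemma no_off_diagonal_maximum:
  assumes mono: "\<And>x y. norm x = 1 \<Longrightarrow> norm y = 1 \<Longrightarrow> H y < H x \<Longrightarrow> norm (X y) < norm (X x) \<Longrightarrow> F y < F x"
    and "0 < L" and lip: "\<And>x y. norm x = 1 \<Longrightarrow> norm y = 1 \<Longrightarrow> H x - H y \<le> L * norm (x - y)"
    and xy: "norm x = 1" "norm y = 1" "x \<noteq> y" "H x - H y = L * norm (x - y)"
  shows False
proof -
  define d where "d = norm (x - y)"
  have "0 < d" using xy by (simp add: d_def)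
  define e where "e = (x - y) /\<^sub>R d"
  have e: "norm e = 1" "x - y = d *\<^sub>R e" using \<open>0 < d\<close> xy by (auto simp: e_def d_def)
  define R where "R = reflection e"
  interpret R: linear R unfolding R_def by (rule linear_reflection)
  have R_adj: "R u \<bullet> v = u \<bullet> R v" for u v by (simp add: R_def inner_reflection_left)
  have RR: "R (R v) = v" for v using e by (simp add: R_def reflection_reflection)
  have nR: "norm (R v) = norm v" for v using e by (simp add: R_def norm_reflection)
  have "(x - y) \<bullet> (x + y) = 0"
    using xy by (simp add: inner_diff_left inner_add_right norm_eq_1) (simp add: inner_commute)
  then have "e \<bullet> (x + y) = 0" using \<open>0 < d\<close> e by simp
  moreover have "e \<bullet> (x - y) = d" using e by (simp add: dot_square_norm)
  ultimately have xe: "x \<bullet> e = d / 2" "y \<bullet> e = - d / 2"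
    by (simp_all add: inner_add_right inner_diff_right inner_commute)
  have Rx: "R x = y" unfolding R_def reflection_def xe using e(2) by (simp add: algebra_simps)
  then have Ry: "R y = x" using RR by metis
  have nz: "x \<noteq> 0" "y \<noteq> 0" using xy by auto
  define W where "W z = H z - H (R z) - 2 * L * (z \<bullet> e)" for z
  define W1 where "W1 z v = X z \<bullet> v - X (R z) \<bullet> R v - 2 * L * (v \<bullet> e)" for z v
  have Rnz: "R z \<noteq> 0" if "z \<noteq> 0" for z using that nR by (metis norm_eq_zero)
  have dR: "(R has_derivative R) (at z)" for z
    using R.linear_axioms by (simp add: linear_imp_has_derivative)
  have dW: "(W has_derivative W1 z) (at z)" if "z \<noteq> 0" for z
    unfolding W_def[abs_def] W1_def[abs_def] using that
    by (auto intro!: derivative_eq_intros has_derivative_H has_derivative_compose[OF dR has_derivative_H] Rnz)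
  have W_le: "W z \<le> 0" if "0 < z \<bullet> e" for z
  proof -
    have "z \<noteq> 0" using that by auto
    then have "H z - H (R z) \<le> L * norm (z - R z)"
      by (intro H_lipschitz_extend[OF lip]) (auto simp: nR)
    also have "z - R z = (2 * (z \<bullet> e)) *\<^sub>R e" by (simp add: R_def reflection_def)
    finally show ?thesis using that e by (simp add: W_def)
  qed
  have Wx: "W x = 0" using xy(4) by (simp add: W_def Rx xe d_def)
  have "open {z. 0 < z \<bullet> e}"
    by (intro open_Collect_less continuous_intros)
  \<comment> \<open>\<open>x\<close> maximises \<open>W\<close> on an open set, so the gradient of
    \<open>W\<close> vanishes there: \<open>X x\<close> is
    \<open>R (X y) + (2 * L) *\<^sub>R e\<close>.\<close>
  then have W1x: "W1 x = (\<lambda>v. 0)"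
    using dW[OF nz(1)] xe \<open>0 < d\<close> W_le Wx
    by (intro differential_zero_maxmin[of x "{z. 0 < z \<bullet> e}" W]) auto
  then have pq: "X x - R (X y) - (2 * L) *\<^sub>R e = 0"
  proof -
    have "(X x - R (X y) - (2 * L) *\<^sub>R e) \<bullet> v = W1 x v" for v
      by (simp add: W1_def Rx inner_diff_left R_adj inner_commute[of e])
    then show ?thesis using W1x by (metis inner_eq_zero_iff)
  qed
  have second: "X' x v \<bullet> v - X' y (R v) \<bullet> R v \<le> 0" for v
  proof -
    have "isCont (\<lambda>t. (x + t *\<^sub>R v) \<bullet> e) 0" by (intro continuous_intros)
    then have lim: "((\<lambda>t. (x + t *\<^sub>R v) \<bullet> e) \<longlongrightarrow> x \<bullet> e) (at 0)"
      by (simp add: isCont_def)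
    have "eventually (\<lambda>t. 0 < (x + t *\<^sub>R v) \<bullet> e) (at 0)"
      using xe \<open>0 < d\<close> by (intro order_tendstoD(1)[OF lim]) auto
    then obtain r where r: "0 < r" "\<And>t. t \<noteq> 0 \<Longrightarrow> \<bar>t\<bar> < r \<Longrightarrow> 0 < (x + t *\<^sub>R v) \<bullet> e"
      by (auto simp: eventually_at dist_real_def)
    have pos: "0 < (x + t *\<^sub>R v) \<bullet> e" if "\<bar>t\<bar> < r" for t
      using r(2)[of t] that xe \<open>0 < d\<close> by (cases "t = 0") auto
    have nz': "x + t *\<^sub>R v \<noteq> 0" if "\<bar>t\<bar> < r" for t using pos[OF that] by auto
    show ?thesis
    proof (rule second_derivative_le_0[OF r(1)])
      show "((\<lambda>t. W (x + t *\<^sub>R v)) has_real_derivative W1 (x + t *\<^sub>R v) v) (at t)" if "0 \<le> t" "t < r" for t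
        using that by (intro has_real_derivative_line dW nz') auto
      have "((\<lambda>z. W1 z v) has_derivative (\<lambda>u. X' x u \<bullet> v - X' y (R u) \<bullet> R v)) (at x)"
        unfolding W1_def using nz Rx
        by (auto intro!: derivative_eq_intros has_derivative has_derivative_compose[OF dR has_derivative])
      then show "((\<lambda>t. W1 (x + t *\<^sub>R v) v) has_real_derivative X' x v \<bullet> v - X' y (R v) \<bullet> R v) (at 0)"
        using has_real_derivative_line[of "\<lambda>z. W1 z v" "\<lambda>u. X' x u \<bullet> v - X' y (R u) \<bullet> R v" x 0 v] by simp
    qed (use W1x Wx W_le pos in auto)
  qed
  have "F x \<le> F y"
  proof -
    have "F x \<le> det (matrix (\<lambda>v. R (M y (R v))))"
      unfolding F_def
    proof (rule det_matrix_mono)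
      show "linear (M x)" using nz by (intro linear_M)
      interpret My: linear "M y" using nz by (intro linear_M)
      show "linear (\<lambda>v. R (M y (R v)))"
        by (rule linearI) (simp_all add: R.add R.scaleR My.add My.scaleR)
      \<comment> \<open>\<open>R y = x\<close> makes the rank one part the same as that of
        \<open>M x\<close>, so the two maps differ by Hessians only, as controlled by
        \<open>second\<close>.\<close>
      have RMR: "R (M y (R v)) = R (X' y (R v)) + (v \<bullet> x) *\<^sub>R x" for v
        by (simp add: M_def R.add R.scaleR Ry R_adj)
      show "0 \<le> v \<bullet> M x v" for v
        using X'_psd[OF nz(1), of v] by (simp add: M_def inner_add_right inner_commute)
      show "0 < det (matrix (M x))" using F_pos[OF xy(1)] by (simp add: F_def)
      show "u \<bullet> (R (M y (R v)) - M x v) = v \<bullet> (R (M y (R u)) - M x u)" for u v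
        using X'_symmetric[OF nz(1), of u v] X'_symmetric[OF nz(2), of "R u" "R v"]
        by (simp add: RMR) (simp add: M_def inner_add_right inner_diff_right R_adj[symmetric] inner_commute)
      show "v \<bullet> M x v \<le> v \<bullet> R (M y (R v))" for v
        using second[of v] by (simp add: RMR) (simp add: M_def inner_add_right R_adj[symmetric] inner_commute)
    qed
    also have "\<dots> = F y"
      unfolding F_def R_def using e nz by (intro det_reflection_conj linear_M)
    finally show ?thesis .
  qed
  moreover have "F y < F x"
  proof (rule mono[OF xy(1,2)])
    show "H y < H x" using xy(4) \<open>0 < L\<close> \<open>0 < d\<close> by (simp add: d_def[symmetric] algebra_simps)
    \<comment> \<open>\<open>X x - X y\<close> is parallel to \<open>x - y\<close>. Monotonicity
      gives the sign of the coefficient and injectivity makes it strict. With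
      \<open>s = L - X y \<bullet> e\<close>, the squared norm then grows by exactly
      \<open>4 * s * L\<close>.\<close>
    have Xx: "X x = X y + (2 * (L - X y \<bullet> e)) *\<^sub>R e"
      using pq by (simp add: R_def reflection_def algebra_simps)
    have "X x \<noteq> X y" using inj xy by (auto simp: inj_on_def)
    then have "L \<noteq> X y \<bullet> e" using Xx by auto
    moreover have "0 \<le> 2 * (L - X y \<bullet> e) * d"
      using X_monotone[OF nz] by (simp add: Xx e dot_square_norm mult.commute)
    ultimately have gt: "X y \<bullet> e < L" using \<open>0 < d\<close> by (simp add: zero_le_mult_iff)
    define s where "s = L - X y \<bullet> e"
    have Xye: "X y \<bullet> e = L - s" "e \<bullet> X y = L - s" by (simp_all add: s_def inner_commute)
    have "e \<bullet> e = 1" using e by (simp add: dot_square_norm)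
    then have "X x \<bullet> X x = X y \<bullet> X y + 4 * s * L"
      unfolding Xx s_def[symmetric]
      by (simp add: inner_add_left inner_add_right Xye) (simp add: algebra_simps)
    then have "(norm (X x))\<^sup>2 = (norm (X y))\<^sup>2 + 4 * s * L"
      by (simp add: power2_norm_eq_inner)
    moreover have "0 < 4 * s * L" using gt \<open>0 < L\<close> by (simp add: s_def)
    ultimately have "(norm (X y))\<^sup>2 < (norm (X x))\<^sup>2" by linarith
    then show "norm (X y) < norm (X x)" by (simp add: power2_less_imp_less)
  qed
  ultimately show False by simp
qed

text \<open>
  The second and third order conditions control \<open>X'' x e\<close> only on \<open>e\<close> and on the orthogonal complement
  of \<open>e\<close>. This suffices because \<open>M x\<close> commutes with the reflection \<open>R\<close> in that complement, so the
  derivative \<open>\<delta>\<close> of the determinant at \<open>M x\<close> does not see the mixed terms: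
  \<open>\<delta> S = \<delta> (R S R)\<close>.
\<close>

lemma no_diagonal_maximum:
  assumes pos: "\<And>D. 0 < X x \<bullet> X' x e \<Longrightarrow>
      ((\<lambda>t. F (cos t *\<^sub>R x + sin t *\<^sub>R e)) has_real_derivative D) (at 0) \<Longrightarrow> 0 < D"
    and "0 < L" and lip: "\<And>x y. norm x = 1 \<Longrightarrow> norm y = 1 \<Longrightarrow> H x - H y \<le> L * norm (x - y)"
    and xe: "norm x = 1" "norm e = 1" "e \<bullet> x = 0" "L \<le> X x \<bullet> e"
  shows False
proof -
  have nz: "x \<noteq> 0" "e \<noteq> 0" using xe by auto
  have xe0: "x \<bullet> e = 0" using xe by (simp add: inner_commute)
  have ee: "e \<bullet> e = 1" "x \<bullet> x = 1" using xe by (simp_all add: dot_square_norm)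
  \<comment> \<open>The points \<open>z + t *\<^sub>R e\<close> and \<open>z - t *\<^sub>R e\<close>
    are exchanged by the reflection in the complement of \<open>e\<close>; they have equal norms and
    distance \<open>2 * t\<close>.\<close>
  have odd_le: "H (z + t *\<^sub>R e) - H (z - t *\<^sub>R e) - 2 * L * t \<le> 0"
    if "z \<bullet> e = 0" "z \<noteq> 0" "0 \<le> t" for z t
  proof -
    have "(norm (z + t *\<^sub>R e))\<^sup>2 = (norm (z - t *\<^sub>R e))\<^sup>2"
      using that by (simp add: power2_norm_eq_inner inner_add_left inner_add_right
          inner_diff_left inner_diff_right inner_commute)
    then have n: "norm (z + t *\<^sub>R e) = norm (z - t *\<^sub>R e)" by simp
    have "z \<bullet> (z + t *\<^sub>R e) \<noteq> 0" using that by (simp add: inner_add_right)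
    then have "z + t *\<^sub>R e \<noteq> 0" by auto
    have "H (z + t *\<^sub>R e) - H (z - t *\<^sub>R e) \<le> L * norm (z + t *\<^sub>R e - (z - t *\<^sub>R e))"
      by (rule H_lipschitz_extend[OF lip n \<open>z + t *\<^sub>R e \<noteq> 0\<close>])
    then show ?thesis unfolding norm_add_diff_diff using that xe by simp
  qed
  have g0: "((\<lambda>t. H (z + t *\<^sub>R e) - H (z - t *\<^sub>R e) - 2 * L * t) has_real_derivative
      X (z + t *\<^sub>R e) \<bullet> e + X (z - t *\<^sub>R e) \<bullet> e - 2 * L) (at t)"
    if z: "z \<bullet> e = 0" "z \<noteq> 0" for z t
  proof -
    have nzt: "z + s *\<^sub>R e \<noteq> 0" for s
    proof -
      have "z \<bullet> (z + s *\<^sub>R e) \<noteq> 0" using z by (simp add: inner_add_right)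
      then show ?thesis by auto
    qed
    have "((\<lambda>t. H (z + t *\<^sub>R e)) has_real_derivative X (z + t *\<^sub>R e) \<bullet> e) (at t)"
      by (rule has_real_derivative_line[OF has_derivative_H[OF nzt]])
    moreover have "((\<lambda>t. H (z + t *\<^sub>R (- e))) has_real_derivative X (z + t *\<^sub>R (- e)) \<bullet> (- e)) (at t)"
      using nzt[of "- t"] by (intro has_real_derivative_line[OF has_derivative_H]) simp
    ultimately show ?thesis
      by (auto intro!: derivative_eq_intros)
  qed
  \<comment> \<open>The function in \<open>odd_le\<close> has derivative
    \<open>2 * (X z \<bullet> e - L)\<close> at \<open>0\<close>. As
    \<open>L \<le> X x \<bullet> e\<close>, the point \<open>x\<close> maximises
    \<open>X z \<bullet> e\<close> over non-zero \<open>z\<close> orthogonal to \<open>e\<close>;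
    \<open>perp\<close> states the first and second order conditions of this maximum.\<close>
  have Xe_le: "X z \<bullet> e \<le> L" if z: "z \<bullet> e = 0" "z \<noteq> 0" for z
  proof (rule ccontr)
    assume "\<not> ?thesis"
    then have "0 < X z \<bullet> e + X z \<bullet> e - 2 * L" by simp
    with DERIV_pos_inc_right[OF g0[OF z, of 0]]
    obtain d where "0 < d" "\<And>h. 0 < h \<Longrightarrow> h < d \<Longrightarrow> 0 < H (z + h *\<^sub>R e) - H (z - h *\<^sub>R e) - 2 * L * h"
      by auto
    from this(1) this(2)[of "d / 2"] odd_le[OF z, of "d / 2"] show False by simp
  qed
  have Xxe: "X x \<bullet> e = L" using Xe_le[OF xe0 nz(1)] xe by simp
  have perp: "X' x v \<bullet> e = 0" "X'' x v v \<bullet> e \<le> 0" if v: "v \<bullet> e = 0" for v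
  proof -
    define r where "r = norm x / (norm v + 1)"
    have "0 < r" using nz by (simp add: r_def add_nonneg_pos)
    have nzt: "x + t *\<^sub>R v \<noteq> 0" if "\<bar>t\<bar> < r" for t
      using that by (intro add_scaleR_nonzero) (simp add: r_def)
    have 1: "((\<lambda>t. X (x + t *\<^sub>R v) \<bullet> e - L) has_real_derivative X' (x + t *\<^sub>R v) v \<bullet> e) (at t)"
      if "\<bar>t\<bar> < r" for t
      using has_real_derivative_line[OF has_derivative_X_inner[OF nzt[OF that]], of e]
      by (auto intro!: derivative_eq_intros)
    have 2: "X (x + t *\<^sub>R v) \<bullet> e - L \<le> 0" if "\<bar>t\<bar> < r" for t
      using Xe_le[OF _ nzt[OF that]] xe0 v by (simp add: inner_add_left)
    have "X' (x + 0 *\<^sub>R v) v \<bullet> e = 0"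
      by (rule DERIV_local_max[OF 1 \<open>0 < r\<close>]) (use 2 Xxe \<open>0 < r\<close> in auto)
    then show *: "X' x v \<bullet> e = 0" by simp
    show "X'' x v v \<bullet> e \<le> 0"
    proof (rule second_derivative_le_0[OF \<open>0 < r\<close>])
      show "((\<lambda>t. X (x + t *\<^sub>R v) \<bullet> e - L) has_real_derivative X' (x + t *\<^sub>R v) v \<bullet> e) (at t)"
        if "0 \<le> t" "t < r" for t using 1 that by simp
      show "((\<lambda>t. X' (x + t *\<^sub>R v) v \<bullet> e) has_real_derivative X'' x v v \<bullet> e) (at 0)"
        using has_real_derivative_line[of "\<lambda>y. X' y v \<bullet> e" "\<lambda>u. X'' x u v \<bullet> e" x 0 v]
          has_derivative_X'_inner[OF nz(1)] by simp
    qed (use 1 2 * Xxe in auto)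
  qed
  \<comment> \<open>At \<open>z = x\<close> the odd function of \<open>t\<close> has vanishing
    value, first and second derivative at \<open>0\<close>, and third derivative
    \<open>2 * (X'' x e e \<bullet> e)\<close>.\<close>
  have Teee: "X'' x e e \<bullet> e \<le> 0"
  proof -
    have nzt: "x + s *\<^sub>R e \<noteq> 0" for s
    proof -
      have "x \<bullet> (x + s *\<^sub>R e) \<noteq> 0" using xe0 nz by (simp add: inner_add_right)
      then show ?thesis by auto
    qed
    have "2 * (X'' x e e \<bullet> e) \<le> 0"
    proof (rule third_derivative_le_0[OF zero_less_one])
      show "((\<lambda>t. H (x + t *\<^sub>R e) - H (x - t *\<^sub>R e) - 2 * L * t) has_real_derivative
        X (x + t *\<^sub>R e) \<bullet> e + X (x - t *\<^sub>R e) \<bullet> e - 2 * L) (at t)" for t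
        by (rule g0[OF xe0 nz(1)])
      show "((\<lambda>t. X (x + t *\<^sub>R e) \<bullet> e + X (x - t *\<^sub>R e) \<bullet> e - 2 * L) has_real_derivative
        X' (x + t *\<^sub>R e) e \<bullet> e - X' (x - t *\<^sub>R e) e \<bullet> e) (at t)" for t
      proof -
        interpret linear "X' (x - t *\<^sub>R e)" using nzt[of "- t"] by (intro linear_X') simp
        have "((\<lambda>t. X (x + t *\<^sub>R (- e)) \<bullet> e) has_real_derivative X' (x + t *\<^sub>R (- e)) (- e) \<bullet> e) (at t)"
          using nzt[of "- t"] by (intro has_real_derivative_line[OF has_derivative_X_inner]) simp
        moreover have "((\<lambda>t. X (x + t *\<^sub>R e) \<bullet> e) has_real_derivative X' (x + t *\<^sub>R e) e \<bullet> e) (at t)"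
          by (rule has_real_derivative_line[OF has_derivative_X_inner[OF nzt]])
        ultimately show ?thesis
          by (auto intro!: derivative_eq_intros simp: neg)
      qed
      have T: "((\<lambda>y. X' y e \<bullet> e) has_derivative (\<lambda>u. X'' x u e \<bullet> e)) (at x)"
        by (rule has_derivative_X'_inner[OF nz(1)])
      interpret T: bounded_linear "\<lambda>u. X'' x u e \<bullet> e"
        using T by (rule has_derivative_bounded_linear)
      have "((\<lambda>t. X' (x + t *\<^sub>R e) e \<bullet> e) has_real_derivative X'' x e e \<bullet> e) (at 0)"
        using has_real_derivative_line[of "\<lambda>y. X' y e \<bullet> e" "\<lambda>u. X'' x u e \<bullet> e" x 0 e] T by simp
      moreover have "((\<lambda>t. X' (x + t *\<^sub>R (- e)) e \<bullet> e) has_real_derivative X'' x (- e) e \<bullet> e) (at 0)"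
        using has_real_derivative_line[of "\<lambda>y. X' y e \<bullet> e" "\<lambda>u. X'' x u e \<bullet> e" x 0 "- e"] T by simp
      ultimately show "((\<lambda>t. X' (x + t *\<^sub>R e) e \<bullet> e - X' (x - t *\<^sub>R e) e \<bullet> e) has_real_derivative
          2 * (X'' x e e \<bullet> e)) (at 0)"
        by (auto intro!: derivative_eq_intros simp: T.neg)
    qed (use Xxe odd_le[OF xe0 nz(1)] in auto)
    then show ?thesis by simp
  qed
  define \<beta> where "\<beta> = X' x e \<bullet> e"
  \<comment> \<open>By symmetry \<open>perp\<close> says that \<open>X' x e\<close> is orthogonal to
    the complement of \<open>e\<close>. The eigenvalue \<open>\<beta>\<close> is positive because
    \<open>F x\<close> is, so \<open>X x \<bullet> X' x e = \<beta> * L\<close> is positive and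
    \<open>pos\<close> applies.\<close>
  have X'e: "X' x e = \<beta> *\<^sub>R e"
  proof -
    have "(X' x e - \<beta> *\<^sub>R e) \<bullet> w = 0" for w
    proof -
      have "X' x (w - (w \<bullet> e) *\<^sub>R e) \<bullet> e = 0"
        by (intro perp) (simp add: inner_diff_left ee)
      then have "X' x e \<bullet> (w - (w \<bullet> e) *\<^sub>R e) = 0"
        using X'_symmetric[OF nz(1)] by metis
      then show ?thesis
        by (simp add: \<beta>_def inner_diff_left inner_diff_right inner_commute)
    qed
    then show ?thesis by (metis eq_iff_diff_eq_0 inner_eq_zero_iff)
  qed
  have "\<beta> \<noteq> 0"
  proof
    assume "\<beta> = 0"
    then have "M x e = 0"
      using X'e xe by (simp add: M_def)
    then have "matrix (M x) *v e = 0"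
      using linear_matrix_works[OF linear_M[OF nz(1)]] by simp
    moreover have "invertible (matrix (M x))"
      using F_pos[OF xe(1)] by (simp add: invertible_det_nz F_def)
    ultimately show False
      using nz(2) by (metis matrix_left_invertible_ker invertible_left_inverse)
  qed
  moreover have "0 \<le> \<beta>" unfolding \<beta>_def by (rule X'_psd[OF nz(1)])
  ultimately have "0 < X x \<bullet> X' x e"
    using \<open>0 < L\<close> by (simp add: X'e Xxe)
  note pos = pos[OF this]
  define R where "R = reflection e"
  have linR: "linear R" unfolding R_def by (rule linear_reflection)
  interpret R: linear R by (rule linR)
  have R_adj: "R u \<bullet> v = u \<bullet> R v" for u v by (simp add: R_def inner_reflection_left)
  have RR: "R (R v) = v" for v using xe by (simp add: R_def reflection_reflection)
  have Rx: "R x = x" using xe0 by (simp add: R_def reflection_def)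
  define P where "P = matrix (M x)"
  \<comment> \<open>The derivative of \<open>M\<close> along the great circle through
    \<open>x\<close> with velocity \<open>e\<close>; the rank one terms come from
    \<open>(v \<bullet> y) *\<^sub>R y\<close>. Their form is
    \<open>2 * (v \<bullet> e) * (v \<bullet> x)\<close>, which vanishes at \<open>e\<close> and on
    the complement of \<open>e\<close>.\<close>
  define S where "S = matrix (\<lambda>v. X'' x e v + (v \<bullet> e) *\<^sub>R x + (v \<bullet> x) *\<^sub>R e)"
  interpret T2: bounded_linear "\<lambda>u. X'' x e u"
  proof -
    have "X'' x e = (\<lambda>u. X'' x u e)" by (intro ext X''_commute[OF nz(1)])
    then show "bounded_linear (\<lambda>u. X'' x e u)"
      using has_derivative_X'[OF nz(1), of e] has_derivative_bounded_linear by metis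
  qed
  have linS: "linear (\<lambda>v. X'' x e v + (v \<bullet> e) *\<^sub>R x + (v \<bullet> x) *\<^sub>R e)"
    by (rule linearI) (simp_all add: T2.add T2.scaleR inner_add_left algebra_simps)
  have Sv: "S *v v = X'' x e v + (v \<bullet> e) *\<^sub>R x + (v \<bullet> x) *\<^sub>R e" for v
    unfolding S_def by (rule linear_matrix_works[OF linS])
  have S_sym: "u \<bullet> (S *v v) = v \<bullet> (S *v u)" for u v
    using X''_symmetric[OF nz(1), of e u v]
    by (simp add: Sv inner_add_right inner_commute algebra_simps)
  obtain \<delta> where \<delta>: "(det has_derivative \<delta>) (at P)"
  proof -
    have "(\<lambda>A. det A) differentiable (at P)"
    proof (rule differentiable_det)
      show "(\<lambda>A. A $ i $ j) differentiable (at P)" for i j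
        by (intro differentiable_vec_nth) auto
    qed
    then show thesis using that by (auto simp: differentiable_def)
  qed
  interpret \<delta>: bounded_linear \<delta> using \<delta> by (rule has_derivative_bounded_linear)
  have "((\<lambda>t. F (cos t *\<^sub>R x + sin t *\<^sub>R e)) has_real_derivative \<delta> S) (at 0)"
  proof -
    let ?\<gamma> = "\<lambda>t. cos t *\<^sub>R x + sin t *\<^sub>R e"
    have \<gamma>: "(?\<gamma> has_derivative (\<lambda>h. h *\<^sub>R e)) (at 0)"
      by (auto intro!: derivative_eq_intros)
    have X'\<gamma>: "((\<lambda>t. X' (?\<gamma> t) v) has_derivative (\<lambda>h. X'' x (h *\<^sub>R e) v)) (at 0)" for v
      using has_derivative_compose[OF \<gamma>, of "\<lambda>y. X' y v" "\<lambda>u. X'' x u v"] has_derivative_X'[OF nz(1), of v]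
      by simp
    have M\<gamma>: "((\<lambda>t. M (?\<gamma> t) v) has_derivative (\<lambda>h. h *\<^sub>R (S *v v))) (at 0)" for v
    proof -
      interpret bounded_linear "\<lambda>u. X'' x u v"
        using has_derivative_X'[OF nz(1)] by (rule has_derivative_bounded_linear)
      show ?thesis
        unfolding M_def by (rule derivative_eq_intros X'\<gamma> \<gamma> refl)+
          (simp add: Sv scaleR algebra_simps)
    qed
    have "((\<lambda>t. matrix (M (?\<gamma> t))) has_derivative (\<lambda>h. h *\<^sub>R S)) (at 0)"
      unfolding has_derivative_componentwise_within[of "\<lambda>t. matrix (M (?\<gamma> t))"]
    proof
      fix b :: "real^'m^'m" assume "b \<in> Basis"
      then obtain i j where b: "b = axis i (axis j 1)"
        by (auto simp: Basis_vec_def)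
      have "S $ i $ j = (S *v axis j 1) $ i" by (simp add: matrix_vector_mult_basis column_def)
      moreover have "((\<lambda>t. M (?\<gamma> t) (axis j 1) $ i) has_derivative (\<lambda>h. (h *\<^sub>R (S *v axis j 1)) $ i)) (at 0)"
        by (rule bounded_linear.has_derivative[OF bounded_linear_vec_nth M\<gamma>])
      ultimately show "((\<lambda>t. matrix (M (?\<gamma> t)) \<bullet> b) has_derivative (\<lambda>h. h *\<^sub>R S \<bullet> b)) (at 0)"
        by (simp add: b inner_axis matrix_def)
    qed
    from has_derivative_compose[OF this, of det \<delta>] \<delta>
    show ?thesis
      by (simp add: F_def[abs_def] P_def has_field_derivative_def \<delta>.scaleR mult_commute_abs)
  qed
  from this have "0 < \<delta> S" by (rule pos)
  \<comment> \<open>Conjugation by \<open>R\<close> preserves determinants and fixes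
    \<open>P\<close>; differentiating this invariance at \<open>P\<close> gives the claim.\<close>
  have "\<delta> (matrix R ** S ** matrix R) = \<delta> S"
  proof -
    let ?c = "\<lambda>A. matrix R ** A ** matrix R"
    have lin: "linear ?c"
      by (rule linearI) (simp_all add: matrix_add_ldistrib matrix_add_rdistrib
          scalar_matrix_assoc[symmetric] matrix_scalar_ac flip: scalar_mult_eq_scaleR)
    have RMR: "R (M x (R v)) = M x v" for v
    proof -
      interpret X: linear "X' x" using nz(1) by (rule linear_X')
      have 1: "X' x v \<bullet> e = \<beta> * (v \<bullet> e)"
        using X'_symmetric[OF nz(1), of v e] by (simp add: X'e inner_commute)
      have 2: "X' x (R v) = X' x v - (2 * (v \<bullet> e) * \<beta>) *\<^sub>R e"
        by (simp add: R_def reflection_def X.diff X.scaleR X'e)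
      have "R (X' x (R v)) = X' x v"
        unfolding 2 by (simp add: R_def reflection_def inner_diff_left 1 ee algebra_simps)
      then show ?thesis
        by (simp add: M_def R.add R.scaleR Rx R_adj)
    qed
    have conj: "?c P = P"
      by (simp add: matrix_eq matrix_vector_mul_assoc[symmetric] linear_matrix_works[OF linR]
          P_def linear_matrix_works[OF linear_M[OF nz(1)]] RMR)
    have "matrix R ** matrix R = mat 1"
      by (simp add: matrix_eq matrix_vector_mul_assoc[symmetric] linear_matrix_works linR RR)
    then have "det (matrix R) * det (matrix R) = 1" by (metis det_I det_mul)
    then have "det (?c A) = det A" for A by (simp add: det_mul mult_ac)
    moreover have "((\<lambda>A. det (?c A)) has_derivative (\<lambda>A. \<delta> (?c A))) (at P)"
      using has_derivative_compose[OF linear_imp_has_derivative[OF lin], of det \<delta> P] \<delta> conj by simp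
    ultimately have "(det has_derivative (\<lambda>A. \<delta> (?c A))) (at P)" by simp
    from has_derivative_unique[OF this \<delta>] show ?thesis by metis
  qed
  then have \<delta>S: "\<delta> (- (S + matrix R ** S ** matrix R)) = - 2 * \<delta> S"
    by (simp add: \<delta>.neg \<delta>.add \<delta>.diff)
  \<comment> \<open>Adding the conjugate cancels the mixed terms, so \<open>Teee\<close> and
    \<open>perp\<close> suffice to make \<open>N\<close> positive semidefinite.\<close>
  define N where "N = - (S + matrix R ** S ** matrix R)"
  have Nv: "N *v v = - (S *v v + R (S *v R v))" for v
    by (simp add: N_def matrix_vector_mul_assoc[symmetric] linear_matrix_works[OF linR]
        matrix_vector_mult_diff_rdistrib matrix_vector_mult_add_rdistrib matrix_vector_mult_uminus)
  have "0 \<le> v \<bullet> (N *v v)" for v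
  proof -
    define a where "a = v \<bullet> e"
    define w where "w = v - a *\<^sub>R e"
    have w: "w \<bullet> e = 0" and v: "v = a *\<^sub>R e + w" and Rv: "R v = w - a *\<^sub>R e"
      unfolding w_def R_def reflection_def a_def mult_2 scaleR_left_distrib
      by (simp_all add: inner_diff_left ee)
    have "v \<bullet> (N *v v) = - (v \<bullet> (S *v v) + R v \<bullet> (S *v R v))"
      by (simp add: Nv inner_add_right inner_diff_right R_adj)
    also have "\<dots> = - 2 * (a\<^sup>2 * (e \<bullet> (S *v e)) + w \<bullet> (S *v w))"
      unfolding Rv unfolding v
      by (simp add: matrix_vector_right_distrib matrix_vector_mult_diff_distrib matrix_vector_mult_scaleR
          inner_add_left inner_add_right inner_diff_left inner_diff_right power2_eq_square algebra_simps)
    also have "e \<bullet> (S *v e) = X'' x e e \<bullet> e"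
      using xe0 xe(3) by (simp add: Sv inner_add_right inner_commute)
    also have "w \<bullet> (S *v w) = X'' x w w \<bullet> e"
      using X''_commute[OF nz(1), of e w] X''_symmetric[OF nz(1), of w e w] w
      by (simp add: Sv inner_add_right inner_commute)
    finally have eq: "v \<bullet> (N *v v) = - 2 * (a\<^sup>2 * (X'' x e e \<bullet> e) + X'' x w w \<bullet> e)" .
    show ?thesis
      unfolding eq
      by (intro mult_nonpos_nonpos add_nonpos_nonpos mult_nonneg_nonpos Teee perp(2)[OF w]) auto
  qed
  moreover have "transpose N = N"
  proof -
    have "u \<bullet> (N *v v) = v \<bullet> (N *v u)" for u v
      using S_sym[of u v] S_sym[of "R u" "R v"] by (simp add: Nv inner_add_right inner_diff_right R_adj[symmetric])
    then have "axis i 1 \<bullet> (N *v axis j 1) = axis j 1 \<bullet> (N *v axis i 1)" for i j by blast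
    then show ?thesis
      by (simp add: vec_eq_iff transpose_def matrix_vector_mult_basis inner_axis' column_def)
  qed
  ultimately have det_ge: "det P \<le> det (P + t *\<^sub>R N)" if "0 \<le> t" for t
  proof (intro det_add_psd_ge)
    show "0 \<le> v \<bullet> (P *v v)" for v
      using X'_psd[OF nz(1), of v] unfolding P_def linear_matrix_works[OF linear_M[OF nz(1)]]
      by (simp add: M_def inner_add_right inner_commute)
    show "0 < det P" using F_pos[OF xe(1)] by (simp add: F_def P_def)
    assume N: "transpose N = N" "\<And>v. 0 \<le> v \<bullet> (N *v v)"
    show "transpose (t *\<^sub>R N) = t *\<^sub>R N" using N(1) by (simp add: transpose_scalar)
    show "0 \<le> v \<bullet> (t *\<^sub>R N *v v)" for v
      using N(2)[of v] that by (simp add: scaleR_matrix_vector_assoc[symmetric])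
  qed
  \<comment> \<open>The determinant does not decrease along \<open>P + t *\<^sub>R N\<close> for
    \<open>t \<ge> 0\<close>, yet its derivative at \<open>0\<close> is
    \<open>\<delta> N = - 2 * \<delta> S\<close>, which is negative.\<close>
  have "((\<lambda>t. det (P + t *\<^sub>R N)) has_real_derivative \<delta> N) (at 0)"
    using has_real_derivative_line[of det \<delta> P 0 N] \<delta> by simp
  from DERIV_neg_dec_right[OF this] \<open>0 < \<delta> S\<close> \<delta>S obtain d where
    "0 < d" "\<And>h. 0 < h \<Longrightarrow> h < d \<Longrightarrow> det (P + h *\<^sub>R N) < det P"
    by (auto simp: N_def)
  from this(1) this(2)[of "d / 2"] det_ge[of "d / 2"] show False by simp
qed

text \<open>\<open>mono\<close> rules out a maximal chord with distinct endpoints and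
  \<open>pos\<close> one collapsed to a tangent direction, so \<open>H\<close> is constant on the
  sphere.\<close>

theorem X_eq_scaleR:
  assumes mono: "\<And>x y. norm x = 1 \<Longrightarrow> norm y = 1 \<Longrightarrow> H y < H x \<Longrightarrow> norm (X y) < norm (X x) \<Longrightarrow> F y < F x"
    and pos: "\<And>x e D. norm x = 1 \<Longrightarrow> norm e = 1 \<Longrightarrow> e \<bullet> x = 0 \<Longrightarrow> 0 < X x \<bullet> e \<Longrightarrow> 0 < X x \<bullet> X' x e \<Longrightarrow>
      ((\<lambda>t. F (cos t *\<^sub>R x + sin t *\<^sub>R e)) has_real_derivative D) (at 0) \<Longrightarrow> 0 < D"
  shows "\<exists>c. \<forall>x. norm x = 1 \<longrightarrow> X x = c *\<^sub>R x"
proof -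
  have const: "H a = H b" if ab: "norm a = 1" "norm b = 1" for a b
  proof (rule ccontr)
    assume "H a \<noteq> H b"
    then obtain L where L: "0 < L" "\<And>x y. norm x = 1 \<Longrightarrow> norm y = 1 \<Longrightarrow> H x - H y \<le> L * norm (x - y)"
      and "(\<exists>x y. norm x = 1 \<and> norm y = 1 \<and> x \<noteq> y \<and> H x - H y = L * norm (x - y)) \<or>
         (\<exists>x e. norm x = 1 \<and> norm e = 1 \<and> e \<bullet> x = 0 \<and> L \<le> X x \<bullet> e)"
      using H_chord_lipschitz_sharp[OF ab] by blast
    then consider (1) x y where "norm x = 1" "norm y = 1" "x \<noteq> y" "H x - H y = L * norm (x - y)"
      | (2) x e where "norm x = 1" "norm e = 1" "e \<bullet> x = 0" "L \<le> X x \<bullet> e"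
      by blast
    then show False
    proof cases
      case 1
      then show False using no_off_diagonal_maximum[OF mono L] by blast
    next
      case 2
      show False
      proof (rule no_diagonal_maximum[OF _ L 2])
        show "0 < D" if "0 < X x \<bullet> X' x e"
          "((\<lambda>t. F (cos t *\<^sub>R x + sin t *\<^sub>R e)) has_real_derivative D) (at 0)" for D
          using pos[OF 2(1-3) _ that] 2(4) \<open>0 < L\<close> by simp
      qed
    qed
  qed
  define c where "c = H (axis undefined 1)"
  have Hc: "H x = c" if "norm x = 1" for x
    unfolding c_def using that by (intro const) auto
  have "X x = c *\<^sub>R x" if x: "norm x = 1" for x
  proof -
    have "x \<noteq> 0" using x by auto
    have le: "norm (X x) * norm (X x) \<le> c * norm (X x)"
    proof (cases "X x = 0")
      case False
      have "norm (X x) * norm (X x) = X x \<bullet> X x" by (simp add: dot_square_norm power2_eq_square)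
      \<comment> \<open>Testing \<open>support\<close> in the direction \<open>X x\<close> itself
        bounds \<open>norm (X x)\<close> by \<open>c\<close>. As also
        \<open>X x \<bullet> x = c\<close>, this is the equality case of Cauchy-Schwarz.\<close>
      also have "\<dots> \<le> H (X x)" using support[OF \<open>x \<noteq> 0\<close> False] by (simp add: H_def)
      also have "\<dots> = H (norm (X x) *\<^sub>R (X x /\<^sub>R norm (X x)))" using False by simp
      also have "\<dots> = norm (X x) * c"
        using False by (subst H_homogeneous) (auto simp: Hc)
      finally show ?thesis by (simp add: mult.commute)
    qed simp
    have "norm (X x) \<le> c \<or> X x = 0" using le by auto
    moreover have Xxx: "X x \<bullet> x = c" using Hc[OF x] by (simp add: H_def)
    ultimately have "(norm (X x))\<^sup>2 \<le> c\<^sup>2" by (auto intro: power_mono)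
    moreover have "(norm (X x - c *\<^sub>R x))\<^sup>2 = (norm (X x))\<^sup>2 - 2 * c * (X x \<bullet> x) + c\<^sup>2 * (norm x)\<^sup>2"
      unfolding power2_norm_eq_inner
      by (simp add: inner_diff_left inner_diff_right inner_commute power2_eq_square)
    ultimately have "(norm (X x - c *\<^sub>R x))\<^sup>2 \<le> 0"
      using Xxx x by (simp add: power2_eq_square)
    then show ?thesis by simp
  qed
  then show ?thesis by blast
qed

end

subsection \<open>Regularity of the inverse Gauss map\<close>

lemma smooth_on_open_gradient:
  fixes f :: "'a::euclidean_space \<Rightarrow> real"
  assumes f: "smooth_on_open f U"
  obtains G' where "\<And>x. x \<in> U \<Longrightarrow> (f has_derivative (\<lambda>h. h \<bullet> gradient f x)) (at x)"
    and "\<And>x. x \<in> U \<Longrightarrow> (gradient f has_derivative G' x) (at x)"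
    and "\<And>x v. x \<in> U \<Longrightarrow> (\<lambda>y. G' y v) differentiable (at x)"
proof -
  define D where "D x = frechet_derivative f (at x)" for x
  define G where "G x = (\<Sum>b\<in>Basis. D x b *\<^sub>R b)" for x
  define D2 where "D2 b x = frechet_derivative (\<lambda>y. D y b) (at x)" for b x
  define G' where "G' x v = (\<Sum>b\<in>Basis. D2 b x v *\<^sub>R b)" for x v
  \<comment> \<open>Order three makes \<open>f\<close>, its gradient and the derivative of the
    gradient differentiable, which is what the existence of \<open>X''\<close> requires.\<close>
  have U: "open U" and "Ck_on (Suc (Suc (Suc 0))) f U"
    using f unfolding smooth_on_open_def by auto
  then have d1: "\<And>x. x \<in> U \<Longrightarrow> f differentiable (at x)"
    and d2: "\<And>x v. x \<in> U \<Longrightarrow> (\<lambda>y. D y v) differentiable (at x)"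
    and d3: "\<And>x v w. x \<in> U \<Longrightarrow> (\<lambda>y. D2 w y v) differentiable (at x)"
    by (auto simp: D_def[abs_def] D2_def[abs_def])
  have fD: "(f has_derivative D x) (at x)" if "x \<in> U" for x
    using d1[OF that] unfolding D_def frechet_derivative_works .
  have fG: "(f has_derivative (\<lambda>h. h \<bullet> G x)) (at x)" if "x \<in> U" for x
  proof -
    interpret D: linear "D x" using fD[OF that] by (rule has_derivative_linear)
    have "D x h = h \<bullet> G x" for h
    proof -
      have "D x h = D x (\<Sum>b\<in>Basis. (h \<bullet> b) *\<^sub>R b)" by (simp add: euclidean_representation)
      then show ?thesis by (simp add: D.sum D.scaleR G_def inner_sum_right mult.commute)
    qed
    then have "D x = (\<lambda>h. h \<bullet> G x)" by blast
    then show ?thesis using fD[OF that] by simp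
  qed
  have grad: "gradient f x = G x" if "x \<in> U" for x
  proof -
    have "GDERIV f x :> G x" using fG[OF that] by (simp add: gderiv_def)
    moreover have "g = G x" if "GDERIV f x :> g" for g
    proof -
      have "(\<lambda>h. h \<bullet> g) = (\<lambda>h. h \<bullet> G x)"
        using that fG[OF \<open>x \<in> U\<close>] unfolding gderiv_def by (rule has_derivative_unique)
      then show ?thesis by (metis vector_eq_ldot)
    qed
    ultimately show ?thesis unfolding gradient_def by (rule the_equality)
  qed
  have GG': "(G has_derivative G' x) (at x)" if "x \<in> U" for x
  proof -
    have "((\<lambda>y. D y b) has_derivative D2 b x) (at x)" for b
      using d2[OF that] unfolding D2_def frechet_derivative_works .
    then show ?thesis
      unfolding G_def[abs_def] G'_def[abs_def] by (auto intro!: derivative_eq_intros)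
  qed
  show thesis
  proof (rule that[of G'])
    show "(f has_derivative (\<lambda>h. h \<bullet> gradient f x)) (at x)" if "x \<in> U" for x
      using fG[OF that] grad[OF that] by simp
    show "(gradient f has_derivative G' x) (at x)" if "x \<in> U" for x
      using has_derivative_transform_within_open[OF GG'[OF that] U that] grad by simp
    show "(\<lambda>y. G' y v) differentiable (at x)" if "x \<in> U" for x v
      unfolding G'_def using d3[OF that]
      by (intro differentiable_sum_finite differentiable_scaleR differentiable_const) auto
  qed
qed

lemma has_derivative_normalize:
  fixes G :: "'a::real_normed_vector \<Rightarrow> 'b::real_inner"
  assumes "(G has_derivative G') (at x)" "G x \<noteq> 0"
  shows "((\<lambda>x. G x /\<^sub>R norm (G x)) has_derivative
    (\<lambda>v. G' v /\<^sub>R norm (G x) - ((G x \<bullet> G' v) / norm (G x) ^ 3) *\<^sub>R G x)) (at x)"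
proof -
  have n: "((\<lambda>x. norm (G x)) has_derivative (\<lambda>v. G' v \<bullet> sgn (G x))) (at x)"
    using has_derivative_compose[OF assms(1) has_derivative_norm[OF assms(2)]] .
  have "norm (G x) \<noteq> 0" using assms(2) by simp
  from has_derivative_scaleR[OF Deriv.has_derivative_inverse[OF this n] assms(1)]
  show ?thesis
    by (rule has_derivative_eq_rhs)
       (simp add: fun_eq_iff sgn_div_norm power3_eq_cube divide_inverse inner_commute mult_ac)
qed

lemma differentiable_normalize_derivative:
  fixes G :: "'a::real_normed_vector \<Rightarrow> 'b::euclidean_space"
  assumes "G differentiable (at x)" "(\<lambda>y. G' y v) differentiable (at x)" "G x \<noteq> 0"
  shows "(\<lambda>y. G' y v /\<^sub>R norm (G y) - ((G y \<bullet> G' y v) / norm (G y) ^ 3) *\<^sub>R G y) differentiable (at x)"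
proof -
  have n: "(\<lambda>y. norm (G y)) differentiable (at x)"
    using differentiable_compose[of norm G x] differentiable_norm_at[OF assms(3)] assms(1) by simp
  then have i: "(\<lambda>y. inverse (norm (G y))) differentiable (at x)"
    using assms(3) by (intro differentiable_inverse) auto
  have "(\<lambda>y. (G y \<bullet> G' y v) / norm (G y) ^ 3) differentiable (at x)"
    using assms n by (intro differentiable_divide differentiable_inner differentiable_power) auto
  then show ?thesis
    by (intro differentiable_diff differentiable_scaleR i assms)
qed

text \<open>A substitute for the implicit function theorem, obtained from the intermediate value theorem along lines parallel to \<open>g\<close>.\<close>

lemma zero_set_tangent_points:
  fixes f :: "'a::real_inner \<Rightarrow> real"
  assumes f: "(f has_derivative (\<lambda>h. h \<bullet> g)) (at p)" and "g \<noteq> 0" "f p = 0"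
    and U: "open U" "p \<in> U" "continuous_on U f"
    and w: "w \<bullet> g = 0" and "0 < \<epsilon>"
  shows "\<exists>d>0. \<forall>t. 0 < t \<and> t < d \<longrightarrow>
    (\<exists>s. \<bar>s\<bar> \<le> \<epsilon> * t \<and> p + t *\<^sub>R w + s *\<^sub>R g \<in> U \<and> f (p + t *\<^sub>R w + s *\<^sub>R g) = 0)"
proof -
  \<comment> \<open>\<open>t * K\<close> bounds the displacement while
    \<open>\<bar>s\<bar> \<le> \<epsilon> * t\<close>. Then \<open>\<eta>\<close> keeps the Taylor
    remainder within half of \<open>\<epsilon> * t * (g \<bullet> g)\<close>, the size of the linear
    term at both ends, so \<open>f\<close> changes sign.\<close>
  define K where "K = norm w + \<epsilon> * norm g"
  have "0 < K" using \<open>0 < \<epsilon>\<close> \<open>g \<noteq> 0\<close> by (simp add: K_def add_nonneg_pos)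
  define \<eta> where "\<eta> = \<epsilon> * (g \<bullet> g) / (2 * K)"
  have "0 < \<eta>" using \<open>0 < \<epsilon>\<close> \<open>g \<noteq> 0\<close> \<open>0 < K\<close> by (simp add: \<eta>_def)
  obtain d1 where d1: "0 < d1" "ball p d1 \<subseteq> U" using U open_contains_ball by blast
  obtain d2 where d2: "0 < d2" "\<And>y. norm (y - p) < d2 \<Longrightarrow> norm (f y - f p - (y - p) \<bullet> g) \<le> \<eta> * norm (y - p)"
    using f \<open>0 < \<eta>\<close> unfolding has_derivative_at_alt by blast
  define d where "d = min d1 d2 / K"
  have "0 < d" using d1 d2 \<open>0 < K\<close> by (simp add: d_def)
  have "\<exists>s. \<bar>s\<bar> \<le> \<epsilon> * t \<and> p + t *\<^sub>R w + s *\<^sub>R g \<in> U \<and> f (p + t *\<^sub>R w + s *\<^sub>R g) = 0"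
    if t: "0 < t" "t < d" for t
  proof -
    have nrm: "norm (t *\<^sub>R w + s *\<^sub>R g) \<le> t * K" if "\<bar>s\<bar> \<le> \<epsilon> * t" for s
    proof -
      have "norm (t *\<^sub>R w + s *\<^sub>R g) \<le> t * norm w + \<bar>s\<bar> * norm g"
        using norm_triangle_ineq[of "t *\<^sub>R w" "s *\<^sub>R g"] t by simp
      also have "\<dots> \<le> t * norm w + (\<epsilon> * t) * norm g"
        using that by (intro add_left_mono mult_right_mono) auto
      finally show ?thesis by (simp add: K_def algebra_simps)
    qed
    have tK: "t * K < min d1 d2" using t \<open>0 < K\<close> by (simp add: d_def field_simps)
    have inU: "p + t *\<^sub>R w + s *\<^sub>R g \<in> U" if "\<bar>s\<bar> \<le> \<epsilon> * t" for s
    proof -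
      have "dist p (p + t *\<^sub>R w + s *\<^sub>R g) = norm (t *\<^sub>R w + s *\<^sub>R g)"
        by (metis add.assoc dist_add_cancel dist_0_norm add.right_neutral)
      then show ?thesis using nrm[OF that] tK d1(2) by (auto simp: subset_iff)
    qed
    have approx: "\<bar>f (p + t *\<^sub>R w + s *\<^sub>R g) - s * (g \<bullet> g)\<bar> \<le> \<epsilon> * t * (g \<bullet> g) / 2"
      if s: "\<bar>s\<bar> \<le> \<epsilon> * t" for s
    proof -
      have eq: "p + t *\<^sub>R w + s *\<^sub>R g - p = t *\<^sub>R w + s *\<^sub>R g" by simp
      have "norm (f (p + t *\<^sub>R w + s *\<^sub>R g) - f p - (t *\<^sub>R w + s *\<^sub>R g) \<bullet> g) \<le> \<eta> * norm (t *\<^sub>R w + s *\<^sub>R g)"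
        using d2(2)[of "p + t *\<^sub>R w + s *\<^sub>R g"] nrm[OF s] tK unfolding eq by linarith
      also have "\<dots> \<le> \<eta> * (t * K)" using nrm[OF s] \<open>0 < \<eta>\<close> by simp
      also have "\<dots> = \<epsilon> * t * (g \<bullet> g) / 2" using \<open>0 < K\<close> by (simp add: \<eta>_def)
      finally show ?thesis by (simp add: \<open>f p = 0\<close> inner_add_left w)
    qed
    have pos: "0 < \<epsilon> * t * (g \<bullet> g)" using \<open>0 < \<epsilon>\<close> t \<open>g \<noteq> 0\<close> by simp
    define k where "k s = f (p + t *\<^sub>R w + s *\<^sub>R g)" for s
    have "continuous_on {- (\<epsilon> * t)..\<epsilon> * t} k"
      unfolding k_def by (rule continuous_on_compose2[OF U(3)]) (auto intro!: continuous_intros inU)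
    moreover have "\<bar>k (- (\<epsilon> * t)) + \<epsilon> * t * (g \<bullet> g)\<bar> \<le> \<epsilon> * t * (g \<bullet> g) / 2"
        "\<bar>k (\<epsilon> * t) - \<epsilon> * t * (g \<bullet> g)\<bar> \<le> \<epsilon> * t * (g \<bullet> g) / 2"
      using approx[of "- (\<epsilon> * t)"] approx[of "\<epsilon> * t"] t \<open>0 < \<epsilon>\<close> by (simp_all add: k_def)
    then have "k (- (\<epsilon> * t)) \<le> 0" "0 \<le> k (\<epsilon> * t)"
      using pos by linarith+
    moreover have "- (\<epsilon> * t) \<le> \<epsilon> * t" using t \<open>0 < \<epsilon>\<close> by simp
    ultimately obtain s where "- (\<epsilon> * t) \<le> s" "s \<le> \<epsilon> * t" "k s = 0"
      using IVT'[of k "- (\<epsilon> * t)" 0 "\<epsilon> * t"] by blast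
    then show ?thesis using inU[of s] by (intro exI[of _ s]) (auto simp: k_def)
  qed
  with \<open>0 < d\<close> show ?thesis by blast
qed

text \<open>A relational form of \<open>outer_normal\<close>, usable before the uniqueness behind
  its definite description is established.\<close>

definition is_outer_normal :: "'a::euclidean_space set \<Rightarrow> 'a \<Rightarrow> 'a \<Rightarrow> bool" where
  "is_outer_normal C p u \<longleftrightarrow> norm u = 1 \<and> (\<forall>q\<in>C. (q - p) \<bullet> u \<le> 0)"

lemma outer_normal_exists:
  fixes C :: "'a::euclidean_space set"
  assumes "closed C" "convex C" "interior C \<noteq> {}" "p \<in> frontier C"
  shows "\<exists>u. is_outer_normal C p u"
proof -
  have "p \<in> C" "p \<notin> interior C"
    using assms by (auto simp: frontier_def)
  then obtain a where a: "a \<noteq> 0" "\<And>y. y \<in> C \<Longrightarrow> a \<bullet> p \<le> a \<bullet> y"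
    using supporting_hyperplane_rel_boundary[OF assms(2), of p] rel_interior_nonempty_interior[OF assms(3)]
    by metis
  \<comment> \<open>\<open>a\<close> is minimal on \<open>C\<close> at \<open>p\<close>, so it
    points inward.\<close>
  have "is_outer_normal C p (- (a /\<^sub>R norm a))"
    using a by (auto simp: is_outer_normal_def inner_diff_left inner_diff_right inner_commute divide_simps)
  then show ?thesis ..
qed

text \<open>A ball around \<open>c\<close> fits into \<open>C\<close>, so \<open>c\<close> can be
  moved a little in direction \<open>u\<close> and still not pass the supporting hyperplane.\<close>

lemma is_outer_normal_interior:
  assumes "is_outer_normal C p u" "c \<in> interior C"
  shows "(c - p) \<bullet> u < 0"
proof -
  obtain r where r: "0 < r" "cball c r \<subseteq> C"
    using assms(2) by (auto simp: mem_interior_cball)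
  have "c + r *\<^sub>R u \<in> C"
    using r assms(1) by (intro subsetD[OF r(2)]) (simp add: is_outer_normal_def dist_norm)
  then have "(c + r *\<^sub>R u - p) \<bullet> u \<le> 0"
    using assms(1) by (simp add: is_outer_normal_def)
  moreover have "u \<bullet> u = 1" using assms(1) by (simp add: is_outer_normal_def norm_eq_1)
  ultimately show ?thesis using r(1) by (simp add: inner_add_left inner_diff_left)
qed

lemma is_outer_normal_imp_frontier:
  assumes "is_outer_normal C p u" "p \<in> C"
  shows "p \<in> frontier C"
  using is_outer_normal_interior[OF assms(1), of p] assms(2) closure_subset[of C]
  by (auto simp: frontier_def)

text \<open>For \<open>w\<close> orthogonal to \<open>g\<close>, the zero set contains points
  \<open>p + t *\<^sub>R w\<close> up to an error of smaller order, and they lie in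
  \<open>C\<close>. Hence \<open>w \<bullet> u \<le> 0\<close>; using \<open>- w\<close> as well,
  \<open>u\<close> has no component orthogonal to \<open>g\<close>.\<close>

lemma is_outer_normal_parallel_gradient:
  fixes C :: "'a::euclidean_space set"
  assumes "closed C" and u: "is_outer_normal C p u"
    and f: "(f has_derivative (\<lambda>h. h \<bullet> g)) (at p)" "g \<noteq> 0" "f p = 0"
    and U: "open U" "p \<in> U" "continuous_on U f" "{x\<in>U. f x = 0} \<subseteq> C"
  shows "u = ((u \<bullet> g) / (g \<bullet> g)) *\<^sub>R g"
proof -
  have le: "w \<bullet> u \<le> 0" if w: "w \<bullet> g = 0" for w
  proof (rule field_le_epsilon)
    fix e :: real assume "0 < e"
    define \<epsilon> where "\<epsilon> = e / norm g"
    have \<epsilon>: "0 < \<epsilon>" using \<open>0 < e\<close> f(2) by (simp add: \<epsilon>_def)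
    obtain d where "0 < d" and d: "\<And>t. 0 < t \<Longrightarrow> t < d \<Longrightarrow>
        \<exists>s. \<bar>s\<bar> \<le> \<epsilon> * t \<and> p + t *\<^sub>R w + s *\<^sub>R g \<in> U \<and> f (p + t *\<^sub>R w + s *\<^sub>R g) = 0"
      using zero_set_tangent_points[OF f U(1-3) w \<epsilon>] by blast
    define t where "t = d / 2"
    have t: "0 < t" "t < d" using \<open>0 < d\<close> by (auto simp: t_def)
    obtain s where s: "\<bar>s\<bar> \<le> \<epsilon> * t" "p + t *\<^sub>R w + s *\<^sub>R g \<in> U" "f (p + t *\<^sub>R w + s *\<^sub>R g) = 0"
      using d[OF t] by blast
    then have "p + t *\<^sub>R w + s *\<^sub>R g \<in> C" using U(4) by blast
    then have "(p + t *\<^sub>R w + s *\<^sub>R g - p) \<bullet> u \<le> 0"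
      using u unfolding is_outer_normal_def by blast
    then have "t * (w \<bullet> u) \<le> - (s * (g \<bullet> u))"
      by (simp add: inner_add_left)
    also have "\<dots> \<le> \<bar>s\<bar> * \<bar>g \<bullet> u\<bar>"
      by (metis abs_ge_minus_self abs_mult)
    also have "\<dots> \<le> (\<epsilon> * t) * norm g"
      using s(1) Cauchy_Schwarz_ineq2[of g u] u by (intro mult_mono) (auto simp: is_outer_normal_def)
    also have "\<dots> = t * e" using f(2) by (simp add: \<epsilon>_def)
    finally show "w \<bullet> u \<le> 0 + e" using t by simp
  qed
  define w where "w = u - ((u \<bullet> g) / (g \<bullet> g)) *\<^sub>R g"
  have wg: "w \<bullet> g = 0" using f(2) by (simp add: w_def inner_diff_left)
  have "w \<bullet> u = 0" using le[OF wg] le[of "- w"] wg by simp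
  then have "w \<bullet> w = 0"
    using wg by (subst (2) w_def) (simp add: inner_diff_right)
  then show ?thesis by (simp add: w_def)
qed

text \<open>\<open>outer_normal\<close> has meaning on the frontier only, and its derivative there
  is a derivative within a thin set. The chart extends it to a unit field \<open>N\<close> on an
  open set, so that ordinary derivatives can be used.\<close>

locale normal_chart =
  fixes C V :: "(real^'m) set" and f :: "real^'m \<Rightarrow> real" and G N :: "real^'m \<Rightarrow> real^'m"
    and N' :: "real^'m \<Rightarrow> real^'m \<Rightarrow> real^'m"
  assumes open_chart: "open V"
    and f: "x \<in> V \<Longrightarrow> (f has_derivative (\<lambda>h. h \<bullet> G x)) (at x)"
    and differentiable_G: "x \<in> V \<Longrightarrow> G differentiable (at x)"
    and G_nonzero: "x \<in> V \<Longrightarrow> G x \<noteq> 0"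
    and continuous_f: "continuous_on V f"
    and frontier: "frontier C \<inter> V = {x\<in>V. f x = 0}"
    and N': "x \<in> V \<Longrightarrow> (N has_derivative N' x) (at x)"
    and differentiable_N': "x \<in> V \<Longrightarrow> (\<lambda>y. N' y v) differentiable (at x)"
    and norm_N: "x \<in> V \<Longrightarrow> norm (N x) = 1"
    and G_parallel: "x \<in> V \<Longrightarrow> \<exists>c. c \<noteq> 0 \<and> G x = c *\<^sub>R N x"
    and N: "x \<in> V \<inter> frontier C \<Longrightarrow> outer_normal C x = N x"

lemma (in normal_chart) N'_inner_N:
  assumes "x \<in> V" shows "N' x v \<bullet> N x = 0"
proof -
  have "((\<lambda>z. N z \<bullet> N z) has_derivative (\<lambda>v. N x \<bullet> N' x v + N' x v \<bullet> N x)) (at x)"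
    by (rule has_derivative_inner[OF N'[OF assms] N'[OF assms]])
  moreover have "((\<lambda>z. N z \<bullet> N z) has_derivative (\<lambda>v. 0)) (at x)"
    by (rule has_derivative_transform_within_open[OF has_derivative_const[of 1] open_chart assms])
       (use norm_N in \<open>simp add: dot_square_norm\<close>)
  ultimately have "(\<lambda>v. N x \<bullet> N' x v + N' x v \<bullet> N x) = (\<lambda>v. 0)"
    by (rule has_derivative_unique)
  then show ?thesis by (metis inner_commute mult_2 mult_eq_0_iff zero_neq_numeral)
qed

section \<open>Normals and curvature of a smooth convex body\<close>

locale smooth_convex_body =
  fixes C :: "(real^'m) set"
  assumes body: "bounds_smooth_strictly_convex C"
begin

lemma compact: "compact C" and closed: "closed C" and convex: "convex C"
  and interior: "interior C \<noteq> {}" and hypersurface: "smooth_hypersurface (frontier C)"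
  and curvature_pos: "p \<in> frontier C \<Longrightarrow> 0 < gauss_curvature C p"
  using body compact_imp_closed by (auto simp: bounds_smooth_strictly_convex_def)

lemma frontier_subset: "frontier C \<subseteq> C"
  using closed by (simp add: frontier_subset_eq)

text \<open>A fixed interior point, used to tell which unit multiple of a gradient points
  outward.\<close>

definition "center = (SOME c. c \<in> interior C)"

lemma center: "center \<in> interior C"
  unfolding center_def using interior by (simp add: some_in_eq)

text \<open>\<open>u\<close> is a multiple of \<open>g\<close>. Unit length fixes the modulus of the
  factor, and the strict inequality at the interior point \<open>center\<close> its sign. The
  resulting formula no longer mentions \<open>u\<close>, which gives uniqueness.\<close>

lemma normal_eq_gradient:
  assumes u: "is_outer_normal C p u"
    and f: "(f has_derivative (\<lambda>h. h \<bullet> g)) (at p)" "g \<noteq> 0" "f p = 0"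
    and U: "open U" "p \<in> U" "continuous_on U f" "frontier C \<inter> U = {x\<in>U. f x = 0}"
  shows "(center - p) \<bullet> g \<noteq> 0" "u = (- sgn ((center - p) \<bullet> g)) *\<^sub>R (g /\<^sub>R norm g)"
proof -
  define a where "a = (u \<bullet> g) / (g \<bullet> g)"
  have ua: "u = a *\<^sub>R g"
    unfolding a_def using U(4) frontier_subset
    by (intro is_outer_normal_parallel_gradient[OF closed u f U(1-3)]) auto
  have neg: "a * ((center - p) \<bullet> g) < 0"
    using is_outer_normal_interior[OF u center] by (simp add: ua)
  then show nz: "(center - p) \<bullet> g \<noteq> 0" by auto
  have "\<bar>a\<bar> * norm g = 1" using u by (simp add: ua is_outer_normal_def)
  then have "\<bar>a\<bar> = 1 / norm g" using f(2) by (simp add: field_simps)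
  moreover have "sgn a = - sgn ((center - p) \<bullet> g)"
    using neg by (auto simp: mult_less_0_iff)
  ultimately have "a = - sgn ((center - p) \<bullet> g) / norm g"
    by (metis mult.commute mult_sgn_abs times_divide_eq_right mult.right_neutral)
  then show "u = (- sgn ((center - p) \<bullet> g)) *\<^sub>R (g /\<^sub>R norm g)"
    by (simp add: ua divide_inverse)
qed

lemma defining_function:
  assumes "p \<in> frontier C"
  obtains U f G G' where "open U" "p \<in> U"
    and "\<And>x. x \<in> U \<Longrightarrow> (f has_derivative (\<lambda>h. h \<bullet> G x)) (at x)"
    and "\<And>x. x \<in> U \<Longrightarrow> (G has_derivative G' x) (at x)"
    and "\<And>x v. x \<in> U \<Longrightarrow> (\<lambda>y. G' y v) differentiable (at x)"
    and "\<And>x. x \<in> U \<Longrightarrow> G x \<noteq> 0" "continuous_on U f" "frontier C \<inter> U = {x\<in>U. f x = 0}"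
proof -
  obtain U f where U: "p \<in> U" "smooth_on_open f U" "\<forall>x\<in>U. gradient f x \<noteq> 0" "frontier C \<inter> U = {x\<in>U. f x = 0}"
    using hypersurface assms unfolding smooth_hypersurface_def by blast
  obtain G' where G': "\<And>x. x \<in> U \<Longrightarrow> (f has_derivative (\<lambda>h. h \<bullet> gradient f x)) (at x)"
    "\<And>x. x \<in> U \<Longrightarrow> (gradient f has_derivative G' x) (at x)"
    "\<And>x v. x \<in> U \<Longrightarrow> (\<lambda>y. G' y v) differentiable (at x)"
    using smooth_on_open_gradient[OF U(2)] by blast
  have "continuous_on U f"
    using G'(1) has_derivative_continuous by (blast intro: continuous_at_imp_continuous_on)
  then show thesis
    using U G' by (intro that[of U f "gradient f" G']) (auto simp: smooth_on_open_def)
qed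

lemma outer_normal_unique:
  assumes p: "p \<in> frontier C" and u: "is_outer_normal C p u"
  shows "outer_normal C p = u"
  unfolding outer_normal_def
proof (rule the_equality)
  show "norm u = 1 \<and> (\<forall>q\<in>C. (q - p) \<bullet> u \<le> 0)" using u by (simp add: is_outer_normal_def)
  fix v assume v: "norm v = 1 \<and> (\<forall>q\<in>C. (q - p) \<bullet> v \<le> 0)"
  obtain U f G G' where U: "open U" "p \<in> U"
    "\<And>x. x \<in> U \<Longrightarrow> (f has_derivative (\<lambda>h. h \<bullet> G x)) (at x)"
    "\<And>x. x \<in> U \<Longrightarrow> (G has_derivative G' x) (at x)"
    "\<And>x v. x \<in> U \<Longrightarrow> (\<lambda>y. G' y v) differentiable (at x)"
    "\<And>x. x \<in> U \<Longrightarrow> G x \<noteq> 0" "continuous_on U f" "frontier C \<inter> U = {x\<in>U. f x = 0}"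
    using defining_function[OF p] by blast
  have "f p = 0" using p U by blast
  note * = U(3)[OF U(2)] U(6)[OF U(2)] \<open>f p = 0\<close> U(1,2,7,8)
  show "v = u"
    using normal_eq_gradient(2)[OF u *] normal_eq_gradient(2)[OF _ *, of v] v by (simp add: is_outer_normal_def)
qed

lemma outer_normal: "p \<in> frontier C \<Longrightarrow> is_outer_normal C p (outer_normal C p)"
  using outer_normal_exists[OF closed convex interior] outer_normal_unique by metis

text \<open>The formula for the normal contains a sign that may jump. Freezing it at its value
  \<open>\<sigma>\<close> at \<open>p\<close>, and shrinking \<open>U\<close> to the open set
  \<open>V\<close> where it stays the same, leaves a differentiable field.\<close>

lemma normal_chart_exists:
  assumes p: "p \<in> frontier C"
  shows "\<exists>V f G N N'. normal_chart C V f G N N' \<and> p \<in> V"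
proof -
  obtain U f G G' where U: "open U" "p \<in> U"
    and f: "\<And>x. x \<in> U \<Longrightarrow> (f has_derivative (\<lambda>h. h \<bullet> G x)) (at x)"
    and G: "\<And>x. x \<in> U \<Longrightarrow> (G has_derivative G' x) (at x)"
    and G': "\<And>x v. x \<in> U \<Longrightarrow> (\<lambda>y. G' y v) differentiable (at x)"
    and Gnz: "\<And>x. x \<in> U \<Longrightarrow> G x \<noteq> 0" and cont: "continuous_on U f" and fr: "frontier C \<inter> U = {x\<in>U. f x = 0}"
    using defining_function[OF p] by blast
  have normal: "(center - x) \<bullet> G x \<noteq> 0" "outer_normal C x = (- sgn ((center - x) \<bullet> G x)) *\<^sub>R (G x /\<^sub>R norm (G x))"
    if "x \<in> frontier C" "x \<in> U" for x
  proof -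
    have "f x = 0" using that fr by blast
    note * = outer_normal[OF that(1)] f[OF that(2)] Gnz[OF that(2)] \<open>f x = 0\<close> U(1) that(2) cont fr
    show "(center - x) \<bullet> G x \<noteq> 0" "outer_normal C x = (- sgn ((center - x) \<bullet> G x)) *\<^sub>R (G x /\<^sub>R norm (G x))"
      using normal_eq_gradient[OF *] .
  qed
  define \<sigma> where "\<sigma> = - sgn ((center - p) \<bullet> G p)"
  have \<sigma>: "\<bar>\<sigma>\<bar> = 1" using normal(1)[OF p U(2)] by (simp add: \<sigma>_def abs_sgn_eq)
  define V where "V = {x\<in>U. \<sigma> * ((center - x) \<bullet> G x) < 0}"
  have contG: "continuous_on U G"
    using G has_derivative_continuous by (blast intro: continuous_at_imp_continuous_on)
  have "open V"
  proof -
    have "open (U \<inter> (\<lambda>x. \<sigma> * ((center - x) \<bullet> G x)) -` {..<0})"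
      by (rule continuous_open_preimage[OF _ U(1) open_lessThan]) (intro continuous_intros contG)
    then show ?thesis by (simp add: V_def vimage_def Int_def)
  qed
  moreover have "p \<in> V"
    using normal(1)[OF p U(2)] U(2) by (auto simp: V_def \<sigma>_def sgn_if)
  moreover have sub: "V \<subseteq> U" by (auto simp: V_def)
  define N where "N x = \<sigma> *\<^sub>R (G x /\<^sub>R norm (G x))" for x
  define N' where "N' x v = \<sigma> *\<^sub>R (G' x v /\<^sub>R norm (G x) - ((G x \<bullet> G' x v) / norm (G x) ^ 3) *\<^sub>R G x)" for x v
  have "(N has_derivative N' x) (at x)" if "x \<in> V" for x
    unfolding N_def[abs_def] N'_def[abs_def] using that sub
    by (intro has_derivative_scaleR_right has_derivative_normalize G Gnz) auto
  moreover have "(\<lambda>y. N' y v) differentiable (at x)" if "x \<in> V" for x v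
    unfolding N'_def using that sub G[of x] G'[of x v] Gnz[of x]
    by (intro differentiable_scaleR differentiable_const differentiable_normalize_derivative)
       (auto simp: differentiable_def)
  moreover have "norm (N x) = 1" if "x \<in> V" for x
    using Gnz[of x] that sub \<sigma> by (auto simp: N_def abs_mult)
  moreover have "\<exists>c. c \<noteq> 0 \<and> G x = c *\<^sub>R N x" if "x \<in> V" for x
    using Gnz[of x] that sub \<sigma> by (intro exI[of _ "norm (G x) / \<sigma>"]) (auto simp: N_def)
  moreover have "outer_normal C x = N x" if "x \<in> V \<inter> frontier C" for x
  proof -
    have "sgn ((center - x) \<bullet> G x) = - \<sigma>"
      using that \<sigma> by (auto simp: V_def sgn_if mult_less_0_iff abs_if split: if_splits)
    then show ?thesis using that sub normal(2)[of x] by (auto simp: N_def)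
  qed
  moreover have "frontier C \<inter> V = {x\<in>V. f x = 0}" using fr sub by blast
  moreover have "continuous_on V f" using cont sub by (rule continuous_on_subset)
  moreover have "G differentiable (at x)" if "x \<in> V" for x
    using G that sub unfolding differentiable_def by blast
  ultimately have "normal_chart C V f G N N'"
    using f Gnz sub by unfold_locales auto
  then show ?thesis using \<open>p \<in> V\<close> by blast
qed

text \<open>Derivatives within the frontier may differ in the normal direction. Their difference
  \<open>E\<close> is a derivative of zero, so it is of smaller order on frontier points
  \<open>p + t *\<^sub>R w + s *\<^sub>R g\<close> with \<open>s\<close> small relative to
  \<open>t\<close>; linearity and division by \<open>t\<close> give \<open>E w = 0\<close>.\<close>

lemma tangential_derivative_unique:
  assumes p: "p \<in> frontier C"
    and D: "(outer_normal C has_derivative D1) (at p within frontier C)"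
      "(outer_normal C has_derivative D2) (at p within frontier C)"
    and w: "w \<bullet> outer_normal C p = 0"
  shows "D1 w = D2 w"
proof -
  obtain V f G N N' where "normal_chart C V f G N N'" and pV: "p \<in> V"
    using normal_chart_exists[OF p] by blast
  then interpret c: normal_chart C V f G N N' by simp
  define g where "g = G p"
  have wg: "w \<bullet> g = 0" using w c.G_parallel[OF pV] c.N[of p] p pV by (auto simp: g_def)
  have fp: "f p = 0" using p pV c.frontier by blast
  define E where "E h = D1 h - D2 h" for h
  have E: "((\<lambda>x. 0) has_derivative E) (at p within frontier C)"
    using has_derivative_diff[OF D] by (simp add: E_def[abs_def])
  interpret E: bounded_linear E using E by (rule has_derivative_bounded_linear)
  define K where "K = norm w + norm g + norm (E g) + 1"
  have "0 < K" unfolding K_def by (intro add_nonneg_pos add_nonneg_nonneg) auto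
  have "norm (E w) \<le> 0"
  proof (rule field_le_epsilon)
    fix e :: real assume "0 < e"
    define \<epsilon> where "\<epsilon> = min 1 (e / K)"
    have \<epsilon>: "0 < \<epsilon>" "\<epsilon> \<le> 1" "\<epsilon> * K \<le> e"
      using \<open>0 < e\<close> \<open>0 < K\<close> by (auto simp: \<epsilon>_def min_def field_simps)
    obtain d1 where d1: "0 < d1" "\<And>y. y \<in> frontier C \<Longrightarrow> norm (y - p) < d1 \<Longrightarrow> norm (E (y - p)) \<le> \<epsilon> * norm (y - p)"
      using E \<epsilon>(1) unfolding has_derivative_within_alt by fastforce
    obtain d2 where "0 < d2" and d2: "\<And>t. 0 < t \<Longrightarrow> t < d2 \<Longrightarrow>
        \<exists>s. \<bar>s\<bar> \<le> \<epsilon> * t \<and> p + t *\<^sub>R w + s *\<^sub>R g \<in> V \<and> f (p + t *\<^sub>R w + s *\<^sub>R g) = 0"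
      using zero_set_tangent_points[OF c.f[OF pV] c.G_nonzero[OF pV] fp c.open_chart pV c.continuous_f, folded g_def, OF wg \<epsilon>(1)] by blast
    define r where "r = d1 / K"
    have "0 < r" using d1(1) \<open>0 < K\<close> by (simp add: r_def)
    define t where "t = min d2 r / 2"
    have "0 < t" "t < d2" "t < r"
      using \<open>0 < d2\<close> \<open>0 < r\<close> by (auto simp: t_def)
    then have t: "0 < t" "t < d2" "t < d1 / K" by (simp_all add: r_def)
    obtain s where s: "\<bar>s\<bar> \<le> \<epsilon> * t" "p + t *\<^sub>R w + s *\<^sub>R g \<in> V" "f (p + t *\<^sub>R w + s *\<^sub>R g) = 0"
      using d2[OF t(1,2)] by blast
    define h where "h = t *\<^sub>R w + s *\<^sub>R g"
    have ph: "p + h \<in> frontier C" using s(2,3) c.frontier by (auto simp: h_def add.assoc)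
    have "norm h \<le> t * norm w + \<bar>s\<bar> * norm g"
      using norm_triangle_ineq[of "t *\<^sub>R w" "s *\<^sub>R g"] t by (simp add: h_def)
    also have "\<dots> \<le> t * norm w + (\<epsilon> * t) * norm g"
      using s by (intro add_left_mono mult_right_mono) auto
    also have "\<dots> \<le> t * norm w + (1 * t) * norm g"
      using \<epsilon> t by (intro add_left_mono mult_right_mono) auto
    finally have nh: "norm h \<le> t * (norm w + norm g)" by (simp add: algebra_simps)
    also have "\<dots> \<le> t * K" using t by (intro mult_left_mono) (auto simp: K_def)
    also have "\<dots> < d1" using t \<open>0 < K\<close> by (simp add: field_simps)
    finally have "norm (E h) \<le> \<epsilon> * norm h"
      using d1(2)[OF ph] by simp
    also have "\<dots> \<le> \<epsilon> * (t * (norm w + norm g))" using nh \<epsilon> by (intro mult_left_mono) auto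
    finally have Eh: "norm (E h) \<le> \<epsilon> * (t * (norm w + norm g))" .
    have "t *\<^sub>R E w = E h - s *\<^sub>R E g" by (simp add: h_def E.add E.scaleR)
    then have "t * norm (E w) = norm (E h - s *\<^sub>R E g)" using t(1) by (metis abs_of_pos norm_scaleR)
    also have "\<dots> \<le> norm (E h) + \<bar>s\<bar> * norm (E g)"
      using norm_triangle_ineq4[of "E h" "s *\<^sub>R E g"] by simp
    also have "\<dots> \<le> \<epsilon> * (t * (norm w + norm g)) + (\<epsilon> * t) * norm (E g)"
      using Eh s by (intro add_mono mult_right_mono) auto
    also have "\<dots> = t * (\<epsilon> * (norm w + norm g + norm (E g)))" by (simp add: algebra_simps)
    finally have "norm (E w) \<le> \<epsilon> * (norm w + norm g + norm (E g))" using t by simp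
    also have "\<dots> \<le> \<epsilon> * K" using \<epsilon> by (intro mult_left_mono) (auto simp: K_def)
    finally show "norm (E w) \<le> 0 + e" using \<epsilon>(3) by simp
  qed
  then show ?thesis by (simp add: E_def)
qed

text \<open>The \<open>frechet_derivative\<close> in the definition is an arbitrary choice among
  derivatives within the frontier. \<open>hyperplane_det\<close> evaluates it on tangent vectors,
  where it must agree with \<open>N'\<close>.\<close>

lemma gauss_curvature_local:
  assumes p: "p \<in> frontier C" "open V" "p \<in> V"
    and N: "(N has_derivative N') (at p)" "\<And>x. x \<in> V \<inter> frontier C \<Longrightarrow> outer_normal C x = N x"
  shows "gauss_curvature C p = det (matrix (\<lambda>v. N' (v - (v \<bullet> N p) *\<^sub>R N p) + (v \<bullet> N p) *\<^sub>R N p))"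
proof -
  have Np: "outer_normal C p = N p" using p N(2) by blast
  obtain r where r: "0 < r" "ball p r \<subseteq> V" using p open_contains_ball by blast
  have "(outer_normal C has_derivative N') (at p within frontier C)"
    by (rule has_derivative_transform_within[OF has_derivative_at_withinI[OF N(1)] r(1) p(1)])
       (use r N(2) in \<open>auto simp: dist_commute subset_iff\<close>)
  moreover from this have "(outer_normal C has_derivative frechet_derivative (outer_normal C) (at p within frontier C))
      (at p within frontier C)"
    using frechet_derivative_works differentiable_def by blast
  moreover have "norm (N p) = 1" using outer_normal[OF p(1)] by (simp add: Np is_outer_normal_def)
  then have "(v - (v \<bullet> N p) *\<^sub>R N p) \<bullet> outer_normal C p = 0" for v
    by (simp add: Np inner_diff_left dot_square_norm)
  ultimately have "frechet_derivative (outer_normal C) (at p within frontier C) (v - (v \<bullet> N p) *\<^sub>R N p) =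
      N' (v - (v \<bullet> N p) *\<^sub>R N p)" for v
    using tangential_derivative_unique[OF p(1)] by blast
  then show ?thesis
    by (simp add: gauss_curvature_def hyperplane_det_def Np)
qed

lemma shape_operator_injective:
  assumes p: "p \<in> frontier C" "open V" "p \<in> V"
    and N: "(N has_derivative N') (at p)" "\<And>x. x \<in> V \<inter> frontier C \<Longrightarrow> outer_normal C x = N x"
    and w: "w \<bullet> N p = 0" "N' w = 0"
  shows "w = 0"
proof -
  interpret N': bounded_linear N' using N(1) by (rule has_derivative_bounded_linear)
  let ?A = "\<lambda>v. N' (v - (v \<bullet> N p) *\<^sub>R N p) + (v \<bullet> N p) *\<^sub>R N p"
  have "linear ?A"
    by (rule linearI) (simp_all add: N'.add N'.diff N'.scaleR inner_add_left algebra_simps)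
  then have "matrix ?A *v w = 0" using w by (simp add: linear_matrix_works)
  moreover have "invertible (matrix ?A)"
    using curvature_pos[OF p(1)] gauss_curvature_local[OF p N] by (simp add: invertible_det_nz)
  ultimately show ?thesis
    using invertible_mult_vec_eq_0 by blast
qed

text \<open>If \<open>p\<close> and \<open>q\<close> share the normal \<open>u\<close>, the segment
  between them lies in \<open>C\<close> and in the supporting hyperplane, hence in the frontier with
  constant normal. Then the shape operator kills \<open>q - p\<close>, against positive
  curvature.\<close>

lemma inj_on_outer_normal: "inj_on (outer_normal C) (frontier C)"
proof (rule inj_onI, rule ccontr)
  fix p q assume p: "p \<in> frontier C" and q: "q \<in> frontier C"
    and eq: "outer_normal C p = outer_normal C q" and "p \<noteq> q"
  define u where "u = outer_normal C p"
  define w where "w = q - p"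
  have up: "is_outer_normal C p u"
    unfolding u_def by (rule outer_normal[OF p])
  have uq: "is_outer_normal C q u"
    unfolding u_def eq by (rule outer_normal[OF q])
  have "p \<in> C" "q \<in> C" using p q frontier_subset by auto
  then have "(q - p) \<bullet> u \<le> 0" "(p - q) \<bullet> u \<le> 0" using up uq by (auto simp: is_outer_normal_def)
  then have wu: "w \<bullet> u = 0" by (simp add: w_def inner_diff_left)
  have seg: "p + t *\<^sub>R w \<in> frontier C \<and> outer_normal C (p + t *\<^sub>R w) = u" if "0 \<le> t" "t \<le> 1" for t
  proof -
    have "(1 - t) *\<^sub>R p + t *\<^sub>R q \<in> C"
      using convexD_alt[OF convex \<open>p \<in> C\<close> \<open>q \<in> C\<close> that] .
    then have inC: "p + t *\<^sub>R w \<in> C" by (simp add: w_def algebra_simps)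
    have "is_outer_normal C (p + t *\<^sub>R w) u"
      using up wu by (auto simp: is_outer_normal_def inner_diff_left inner_add_left)
    then show ?thesis using is_outer_normal_imp_frontier[OF _ inC] outer_normal_unique by blast
  qed
  obtain V f G N N' where "normal_chart C V f G N N'" and pV: "p \<in> V"
    using normal_chart_exists[OF p] by blast
  then interpret c: normal_chart C V f G N N' by simp
  note V = c.open_chart pV and N' = c.N' and N = c.N
  have Np: "N p = u" using N[of p] p V by (simp add: u_def)
  have "N' p w = 0"
  proof (rule ccontr)
    assume nz: "N' p w \<noteq> 0"
    have "((\<lambda>x. N x \<bullet> N' p w) has_derivative (\<lambda>h. N' p h \<bullet> N' p w)) (at p)"
      using N'[OF V(2)] by (auto intro!: derivative_eq_intros)
    then have "((\<lambda>t. N (p + t *\<^sub>R w) \<bullet> N' p w) has_real_derivative N' p w \<bullet> N' p w) (at 0)"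
      using has_real_derivative_line[of "\<lambda>x. N x \<bullet> N' p w" "\<lambda>h. N' p h \<bullet> N' p w" p 0 w] by simp
    from DERIV_pos_inc_right[OF this] nz obtain d where
      d: "0 < d" "\<And>t. 0 < t \<Longrightarrow> t < d \<Longrightarrow> N p \<bullet> N' p w < N (p + t *\<^sub>R w) \<bullet> N' p w"
      by auto
    obtain r where r: "0 < r" "ball p r \<subseteq> V" using V open_contains_ball by blast
    define r' where "r' = r / (norm w + 1)"
    have "0 < r'" using r by (simp add: r'_def add_nonneg_pos)
    define t where "t = min (min d 1) r' / 2"
    have "0 < t" "t < d" "t \<le> 1" "t < r'"
      using d(1) \<open>0 < r'\<close> by (auto simp: t_def)
    then have t: "0 < t" "t < d" "t \<le> 1" "t < r / (norm w + 1)" by (simp_all add: r'_def)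
    have "t * norm w \<le> t * (norm w + 1)" using t by simp
    also have "\<dots> < r" using t(4) by (subst (asm) pos_less_divide_eq) (auto simp: add_nonneg_pos)
    finally have "p + t *\<^sub>R w \<in> V" using r(2) t(1) by (auto simp: subset_iff dist_norm)
    then have "N (p + t *\<^sub>R w) = u" using N seg[of t] t by auto
    then show False using d(2)[OF t(1,2)] Np by simp
  qed
  then have "w = 0"
    using shape_operator_injective[OF p V N'[OF V(2)] N] wu by (simp add: Np)
  then show False using \<open>p \<noteq> q\<close> by (simp add: w_def)
qed

text \<open>A maximiser over \<open>C\<close> of the inner product with \<open>u\<close> has outer
  normal \<open>u\<close>.\<close>

lemma outer_normal_image: "outer_normal C ` frontier C = sphere 0 1"
proof
  show "outer_normal C ` frontier C \<subseteq> sphere 0 1"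
    using outer_normal by (auto simp: is_outer_normal_def)
  show "sphere 0 1 \<subseteq> outer_normal C ` frontier C"
  proof
    fix u :: "real^'m" assume u: "u \<in> sphere 0 1"
    have "C \<noteq> {}" using interior interior_subset by blast
    moreover have "continuous_on C (\<lambda>q. q \<bullet> u)" by (intro continuous_intros)
    ultimately obtain p where p: "p \<in> C" "\<And>q. q \<in> C \<Longrightarrow> q \<bullet> u \<le> p \<bullet> u"
      using continuous_attains_sup[OF compact] by blast
    then have "is_outer_normal C p u" using u by (simp add: is_outer_normal_def inner_diff_left)
    then show "u \<in> outer_normal C ` frontier C"
      using is_outer_normal_imp_frontier[OF _ p(1)] outer_normal_unique by blast
  qed
qed

lemma continuous_on_outer_normal: "continuous_on (frontier C) (outer_normal C)"
  unfolding continuous_on_eq_continuous_within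
proof
  fix p assume p: "p \<in> frontier C"
  obtain V f G N N' where "normal_chart C V f G N N'" and pV: "p \<in> V"
    using normal_chart_exists[OF p] by blast
  then interpret c: normal_chart C V f G N N' by simp
  note V = c.open_chart pV and N' = c.N' and N = c.N
  obtain r where r: "0 < r" "ball p r \<subseteq> V" using V open_contains_ball by blast
  have "(N has_derivative N' p) (at p within frontier C)"
    using N'[OF V(2)] by (rule has_derivative_at_withinI)
  then have "continuous (at p within frontier C) N" by (rule has_derivative_continuous)
  then show "continuous (at p within frontier C) (outer_normal C)"
    by (rule continuous_transform_within[OF _ r(1) p]) (use r N in \<open>auto simp: dist_commute subset_iff\<close>)
qed

definition "X y = gauss_map_inv C (y /\<^sub>R norm y)"

lemma X_frontier: assumes "y \<noteq> 0" shows "X y \<in> frontier C" "outer_normal C (X y) = y /\<^sub>R norm y"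
proof -
  have "y /\<^sub>R norm y \<in> outer_normal C ` frontier C"
    using assms unfolding outer_normal_image by simp
  then show "X y \<in> frontier C" "outer_normal C (X y) = y /\<^sub>R norm y"
    unfolding X_def gauss_map_inv_def by (rule inv_into_into, rule f_inv_into_f)
qed

text \<open>The Gauss map is a continuous bijection from a compact set, so its inverse is
  continuous.\<close>

lemma isCont_X: assumes "y \<noteq> 0" shows "isCont X y"
proof -
  have "continuous_on (outer_normal C ` frontier C) (gauss_map_inv C)"
    unfolding gauss_map_inv_def
    by (rule continuous_on_inv[OF continuous_on_outer_normal])
       (auto simp: compact_frontier compact inv_into_f_f[OF inj_on_outer_normal])
  then have "continuous_on (- {0}) X"
    unfolding X_def[abs_def] outer_normal_image
  proof (rule continuous_on_compose2)
    show "continuous_on (- {0}) (\<lambda>y :: real^'m. y /\<^sub>R norm y)"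
      by (intro continuous_intros) auto
    show "(\<lambda>y :: real^'m. y /\<^sub>R norm y) ` (- {0}) \<subseteq> sphere 0 1"
      by (rule image_subsetI) simp
  qed
  then show ?thesis using assms by (simp add: continuous_on_eq_continuous_at open_Compl)
qed

lemma chart_at_X:
  assumes "y0 \<noteq> 0"
  obtains V f G N N' W where "normal_chart C V f G N N'" "X y0 \<in> V" "open W" "y0 \<in> W"
    "\<And>y. y \<in> W \<Longrightarrow> y \<noteq> 0" "\<And>y. y \<in> W \<Longrightarrow> X y \<in> V"
    "\<And>y. y \<in> W \<Longrightarrow> f (X y) = 0" "\<And>y. y \<in> W \<Longrightarrow> N (X y) = y /\<^sub>R norm y"
proof -
  obtain V f G N N' where c: "normal_chart C V f G N N'" and pV: "X y0 \<in> V"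
    using normal_chart_exists[OF X_frontier(1)[OF assms]] by blast
  then interpret c: normal_chart C V f G N N' by simp
  define W where "W = (- {0}) \<inter> X -` V"
  have "continuous_on (- {0}) X"
    by (intro continuous_at_imp_continuous_on) (simp add: isCont_X)
  then have "open W"
    unfolding W_def by (rule continuous_open_preimage[OF _ _ c.open_chart]) (simp add: open_Compl)
  moreover have "f (X y) = 0" if "y \<in> W" for y
    using that X_frontier(1)[of y] c.frontier by (auto simp: W_def)
  moreover have "N (X y) = y /\<^sub>R norm y" if "y \<in> W" for y
    using that X_frontier[of y] c.N[of "X y"] by (auto simp: W_def)
  ultimately show thesis
    using pV assms c by (intro that[of V f G N N' W]) (auto simp: W_def)
qed

text \<open>\<open>\<Phi> z = N z + f z *\<^sub>R u\<close> with \<open>u = N (X y0)\<close>: the second summand makes the derivative of the extended Gauss map injective in the normal direction.\<close>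

lemma X_implicit_equation:
  assumes "y0 \<noteq> 0"
  shows "\<exists>\<Phi> A W. open W \<and> y0 \<in> W \<and> (\<forall>y\<in>W. y \<noteq> 0 \<and> \<Phi> (X y) = y /\<^sub>R norm y \<and> (\<Phi> has_derivative A (X y)) (at (X y))) \<and>
    (\<forall>v. (\<lambda>z. A z v) differentiable (at (X y0))) \<and> inj (A (X y0))"
proof (rule chart_at_X[OF assms])
  fix V f G N N' W
  assume chart: "normal_chart C V f G N N'" and pV: "X y0 \<in> V" and W: "open W" "y0 \<in> W"
    "\<And>y. y \<in> W \<Longrightarrow> y \<noteq> 0" "\<And>y. y \<in> W \<Longrightarrow> X y \<in> V"
    "\<And>y. y \<in> W \<Longrightarrow> f (X y) = 0" "\<And>y. y \<in> W \<Longrightarrow> N (X y) = y /\<^sub>R norm y"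
  interpret c: normal_chart C V f G N N' by fact
  define u where "u = y0 /\<^sub>R norm y0"
  define \<Phi> where "\<Phi> z = N z + f z *\<^sub>R u" for z
  define A where "A z v = N' z v + (v \<bullet> G z) *\<^sub>R u" for z v
  have \<Phi>: "(\<Phi> has_derivative A z) (at z)" if "z \<in> V" for z
    unfolding \<Phi>_def[abs_def] A_def[abs_def]
    by (intro has_derivative_add has_derivative_scaleR_left c.N'[OF that] c.f[OF that])
  have dA: "(\<lambda>z. A z v) differentiable (at (X y0))" for v
    unfolding A_def
    by (intro differentiable_add differentiable_scaleR differentiable_inner differentiable_const
        c.differentiable_N'[OF pV] c.differentiable_G[OF pV])
  have Nu: "N (X y0) = u" using W(2,6) by (simp add: u_def)
  have uu: "u \<bullet> u = 1" using c.norm_N[OF pV] by (simp add: Nu dot_square_norm)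
  interpret A: linear "A (X y0)" using \<Phi>[OF pV] by (rule has_derivative_linear)
  have "v = 0" if v: "A (X y0) v = 0" for v
  proof -
    \<comment> \<open>Pairing with \<open>u\<close> isolates the second summand, because
      \<open>N'\<close> takes values orthogonal to \<open>N (X y0) = u\<close>.\<close>
    have "A (X y0) v \<bullet> u = v \<bullet> G (X y0)"
      using c.N'_inner_N[OF pV, of v] uu by (simp add: A_def inner_add_left Nu)
    then have vG: "v \<bullet> G (X y0) = 0" using v by simp
    then have "v \<bullet> N (X y0) = 0" using c.G_parallel[OF pV] by auto
    moreover have "N' (X y0) v = 0" using v vG by (simp add: A_def)
    ultimately show ?thesis
      by (rule shape_operator_injective[OF X_frontier(1)[OF assms] c.open_chart pV c.N'[OF pV] c.N, rotated])
  qed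
  then have "inj (A (X y0))" using linear_injective_0[OF A.linear_axioms] by blast
  then show ?thesis
    using W \<Phi> dA by (intro exI[of _ \<Phi>] exI[of _ A] exI[of _ W]) (auto simp: \<Phi>_def)
qed

section \<open>Derivatives of the inverse Gauss map\<close>

definition "X' y = frechet_derivative X (at y)"

lemma has_derivative_X: assumes "y \<noteq> 0" shows "(X has_derivative X' y) (at y)"
proof -
  obtain \<Phi> A W where W: "open W" "y \<in> W"
    and \<Phi>: "\<forall>y\<in>W. y \<noteq> 0 \<and> \<Phi> (X y) = y /\<^sub>R norm y \<and> (\<Phi> has_derivative A (X y)) (at (X y))"
    and inj: "inj (A (X y))"
    using X_implicit_equation[OF assms] by blast
  have dA: "(\<Phi> has_derivative A (X y)) (at (X y))" using W \<Phi> by blast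
  obtain L where L: "linear L" "L \<circ> A (X y) = id"
    using linear_injective_left_inverse[OF has_derivative_linear[OF dA] inj] by blast
  have "(X has_derivative (\<lambda>v. L (v /\<^sub>R norm y - ((y \<bullet> v) / norm y ^ 3) *\<^sub>R y))) (at y)"
  proof (rule has_derivative_implicit[where L = L and \<Phi> = \<Phi> and A = "A (X y)"
        and \<rho>' = "\<lambda>v. v /\<^sub>R norm y - ((y \<bullet> v) / norm y ^ 3) *\<^sub>R y"])
    show "eventually (\<lambda>z. \<Phi> (X z) = z /\<^sub>R norm z) (nhds y)"
      using W \<Phi> by (auto simp: eventually_nhds)
    show "((\<lambda>z. z /\<^sub>R norm z) has_derivative (\<lambda>v. v /\<^sub>R norm y - ((y \<bullet> v) / norm y ^ 3) *\<^sub>R y)) (at y)"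
      by (rule has_derivative_normalize[OF has_derivative_ident assms])
    show "L (A (X y) v) = v" for v using L(2) by (metis comp_apply id_apply)
  qed (use isCont_X[OF assms] dA L(1) linear_conv_bounded_linear in auto)
  then show ?thesis
    unfolding X'_def using frechet_derivative_works differentiable_def by blast
qed

text \<open>Differentiating \<open>\<Phi> (X y) = y /\<^sub>R norm y\<close> shows that
  \<open>X' y v\<close> solves a linear system whose coefficients depend differentiably on
  \<open>y\<close>; at \<open>y0\<close> its matrix is invertible.\<close>

lemma differentiable_X': assumes "y0 \<noteq> 0" shows "(\<lambda>y. X' y v) differentiable (at y0)"
proof -
  obtain \<Phi> A W where W: "open W" "y0 \<in> W"
    and \<Phi>: "\<forall>y\<in>W. y \<noteq> 0 \<and> \<Phi> (X y) = y /\<^sub>R norm y \<and> (\<Phi> has_derivative A (X y)) (at (X y))"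
    and dA: "\<forall>v. (\<lambda>z. A z v) differentiable (at (X y0))" and inj: "inj (A (X y0))"
    using X_implicit_equation[OF assms] by blast
  have lin: "linear (A (X y))" if "y \<in> W" for y
    using \<Phi> that has_derivative_linear by blast
  have X: "X differentiable (at y0)"
    using has_derivative_X[OF assms] by (auto simp: differentiable_def)
  show ?thesis
  proof (rule differentiable_linear_system)
    show "(\<lambda>y. matrix (A (X y)) $ i $ j) differentiable (at y0)" for i j
    proof -
      have "(\<lambda>y. A (X y) (axis j 1)) differentiable (at y0)"
        using differentiable_compose[of "\<lambda>z. A z (axis j 1)" X y0] dA X by blast
      then show ?thesis by (simp add: matrix_def differentiable_vec_nth)
    qed
    show "(\<lambda>y. v /\<^sub>R norm y - ((y \<bullet> v) / norm y ^ 3) *\<^sub>R y) differentiable (at y0)"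
      using differentiable_normalize_derivative[of "\<lambda>y. y" y0 "\<lambda>y v. v" v] assms by simp
    have "matrix (A (X y)) *v X' y v = v /\<^sub>R norm y - ((y \<bullet> v) / norm y ^ 3) *\<^sub>R y" if y: "y \<in> W" for y
    proof -
      have y0: "y \<noteq> 0" and dy: "(\<Phi> has_derivative A (X y)) (at (X y))" using \<Phi> y by auto
      have "((\<lambda>y. \<Phi> (X y)) has_derivative (\<lambda>v. A (X y) (X' y v))) (at y)"
        by (rule has_derivative_compose[OF has_derivative_X[OF y0] dy])
      moreover have "((\<lambda>y. \<Phi> (X y)) has_derivative (\<lambda>v. v /\<^sub>R norm y - ((y \<bullet> v) / norm y ^ 3) *\<^sub>R y)) (at y)"
        by (rule has_derivative_transform_within_open[OF has_derivative_normalize[OF has_derivative_ident y0] W(1) y])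
           (use \<Phi> in auto)
      ultimately have "(\<lambda>v. A (X y) (X' y v)) = (\<lambda>v. v /\<^sub>R norm y - ((y \<bullet> v) / norm y ^ 3) *\<^sub>R y)"
        by (rule has_derivative_unique)
      then show ?thesis
        unfolding linear_matrix_works[OF lin[OF y]] by metis
    qed
    then show "eventually (\<lambda>y. matrix (A (X y)) *v X' y v = v /\<^sub>R norm y - ((y \<bullet> v) / norm y ^ 3) *\<^sub>R y) (nhds y0)"
      using W by (auto simp: eventually_nhds)
    show "det (matrix (A (X y0))) \<noteq> 0"
      using det_nz_iff_inj[OF lin[OF W(2)]] inj by simp
  qed
qed

text \<open>Differentiating \<open>N (X y) = y /\<^sub>R norm y\<close> shows that the shape
  operator and \<open>X' x\<close> are inverse to each other on the complement of \<open>x\<close>.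
  Both are completed by the identity on \<open>x\<close>, so the full matrices \<open>K\<close> and
  \<open>B\<close> are inverse as well.\<close>

lemma det_X'_curvature:
  assumes x: "norm x = 1"
  shows "det (matrix (\<lambda>v. X' x v + (v \<bullet> x) *\<^sub>R x)) * gauss_curvature C (X x) = 1"
proof -
  have x0: "x \<noteq> 0" using x by auto
  show ?thesis
  proof (rule chart_at_X[OF x0])
    fix V f G N N' W
    assume chart: "normal_chart C V f G N N'" and pV: "X x \<in> V" and W: "open W" "x \<in> W"
      "\<And>y. y \<in> W \<Longrightarrow> y \<noteq> 0" "\<And>y. y \<in> W \<Longrightarrow> X y \<in> V"
      "\<And>y. y \<in> W \<Longrightarrow> f (X y) = 0" "\<And>y. y \<in> W \<Longrightarrow> N (X y) = y /\<^sub>R norm y"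
    interpret c: normal_chart C V f G N N' by fact
    interpret X': linear "X' x" using has_derivative_X[OF x0] by (rule has_derivative_linear)
    interpret N': linear "N' (X x)" using c.N'[OF pV] by (rule has_derivative_linear)
    have Nx: "N (X x) = x" using W(2,6) x by simp
    have xx: "x \<bullet> x = 1" using x by (simp add: dot_square_norm)
    have "((\<lambda>y. N (X y)) has_derivative (\<lambda>v. N' (X x) (X' x v))) (at x)"
      by (rule has_derivative_compose[OF has_derivative_X[OF x0] c.N'[OF pV]])
    moreover have "((\<lambda>y. N (X y)) has_derivative (\<lambda>v. v /\<^sub>R norm x - ((x \<bullet> v) / norm x ^ 3) *\<^sub>R x)) (at x)"
      by (rule has_derivative_transform_within_open[OF has_derivative_normalize[OF has_derivative_ident x0] W(1,2)])
         (use W in auto)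
    ultimately have "(\<lambda>v. N' (X x) (X' x v)) = (\<lambda>v. v /\<^sub>R norm x - ((x \<bullet> v) / norm x ^ 3) *\<^sub>R x)"
      by (rule has_derivative_unique)
    then have N'X': "N' (X x) (X' x v) = v - (v \<bullet> x) *\<^sub>R x" for v
      using x by (simp add: fun_eq_iff inner_commute)
    \<comment> \<open>\<open>X\<close> stays in the zero set of \<open>f\<close>, so
      \<open>X' x v\<close> is tangent; this is why \<open>B\<close> preserves the component along
      \<open>x\<close>.\<close>
    have "((\<lambda>y. f (X y)) has_derivative (\<lambda>v. X' x v \<bullet> G (X x))) (at x)"
      by (rule has_derivative_compose[OF has_derivative_X[OF x0] c.f[OF pV]])
    moreover have "((\<lambda>y. f (X y)) has_derivative (\<lambda>v. 0)) (at x)"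
      by (rule has_derivative_transform_within_open[OF has_derivative_const W(1,2)]) (use W in auto)
    ultimately have "(\<lambda>v. X' x v \<bullet> G (X x)) = (\<lambda>v. 0)"
      by (rule has_derivative_unique)
    then have "X' x v \<bullet> G (X x) = 0" for v by metis
    then have X'x: "X' x v \<bullet> x = 0" for v
      using c.G_parallel[OF pV] by (auto simp: Nx)
    have "X' x x = 0"
      by (rule shape_operator_injective[OF X_frontier(1)[OF x0] c.open_chart pV c.N'[OF pV]])
         (simp_all add: Nx X'x N'X' xx c.N)
    define B where "B v = X' x v + (v \<bullet> x) *\<^sub>R x" for v
    define K where "K v = N' (X x) (v - (v \<bullet> N (X x)) *\<^sub>R N (X x)) + (v \<bullet> N (X x)) *\<^sub>R N (X x)" for v
    have linB: "linear B" unfolding B_def[abs_def]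
      by (rule linearI) (simp_all add: X'.add X'.scaleR inner_add_left algebra_simps)
    have linK: "linear K" unfolding K_def[abs_def]
      by (rule linearI) (simp_all add: N'.add N'.diff N'.scaleR inner_add_left algebra_simps)
    have "K (B v) = v" for v
    proof -
      have "B v \<bullet> x = v \<bullet> x" by (simp add: B_def inner_add_left X'x xx)
      then show ?thesis by (simp add: K_def Nx) (simp add: B_def N'X')
    qed
    then have "matrix K ** matrix B = mat 1"
      by (simp add: matrix_eq matrix_vector_mul_assoc[symmetric] linear_matrix_works linB linK)
    then have "det (matrix B) * det (matrix K) = 1"
      by (metis det_I det_mul mult.commute)
    moreover have "gauss_curvature C (X x) = det (matrix K)"
      unfolding K_def[abs_def]
      by (rule gauss_curvature_local[OF X_frontier(1)[OF x0] c.open_chart pV c.N'[OF pV]]) (rule c.N)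
    ultimately show ?thesis by (simp add: B_def[abs_def])
  qed
qed

sublocale support: smooth_support X X'
proof
  show "X (t *\<^sub>R y) = X y" if "y \<noteq> 0" "0 < t" for y t
  proof -
    have "inverse (t * norm y) * t = inverse (norm y)" using that by (simp add: field_simps)
    then have "(t *\<^sub>R y) /\<^sub>R norm (t *\<^sub>R y) = y /\<^sub>R norm y" using that by simp
    then show ?thesis by (simp only: X_def)
  qed
  show "X x \<bullet> y \<le> X y \<bullet> y" if "x \<noteq> 0" "y \<noteq> 0" for x y
  proof -
    have "(X x - X y) \<bullet> (y /\<^sub>R norm y) \<le> 0"
      using outer_normal[OF X_frontier(1)[OF that(2)]] X_frontier(1)[OF that(1)] frontier_subset
      unfolding X_frontier(2)[OF that(2)] is_outer_normal_def by blast
    then show ?thesis using that by (simp add: inner_diff_left divide_simps)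
  qed
  show "inj_on X (sphere 0 1)"
  proof (rule inj_onI)
    fix x y :: "real^'m" assume xy: "x \<in> sphere 0 1" "y \<in> sphere 0 1" and eq: "X x = X y"
    then have "x \<noteq> 0" "y \<noteq> 0" by auto
    then have "x /\<^sub>R norm x = y /\<^sub>R norm y" using X_frontier(2) eq by metis
    then show "x = y" using xy by simp
  qed
  show "0 < det (matrix (\<lambda>v. X' x v + (v \<bullet> x) *\<^sub>R x))" if "norm x = 1" for x
  proof -
    have "x \<noteq> 0" using that by auto
    then show ?thesis
      using det_X'_curvature[OF that] curvature_pos[OF X_frontier(1)[of x]]
      by (metis mult.commute zero_less_mult_pos zero_less_one)
  qed
qed (use has_derivative_X differentiable_X' in auto)

section \<open>The stated quantities in terms of \<open>X\<close>, \<open>H\<close> and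
  \<open>F\<close>\<close>

lemma support_fun_eq: "norm x = 1 \<Longrightarrow> support_fun C x = support.H x"
  by (simp add: support_fun_def support.H_def X_def)

lemma sphere_curvature_eq: "norm x = 1 \<Longrightarrow> support.F x * sphere_curvature C x = 1"
  using det_X'_curvature[of x] by (simp add: support.F_def support.M_def sphere_curvature_def X_def)

lemma support_grad_eq: assumes "norm x = 1" shows "support_grad C x = X x"
proof -
  have x0: "x \<noteq> 0" using assms by auto
  have "((\<lambda>y. norm y * support_fun C (y /\<^sub>R norm y)) has_derivative (\<lambda>v. X x \<bullet> v)) (at x)"
  proof (rule has_derivative_transform_within_open[OF support.has_derivative_H[OF x0], of "- {0}"])
    show "support.H y = norm y * support_fun C (y /\<^sub>R norm y)" if "y \<in> - {0}" for y
      using that by (simp add: support_fun_def support.H_def X_def)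
  qed (use x0 in auto)
  then have *: "GDERIV (\<lambda>y. norm y * support_fun C (y /\<^sub>R norm y)) x :> X x"
    by (simp add: gderiv_def inner_commute)
  show ?thesis
    unfolding support_grad_def gradient_def
  proof (rule the_equality, rule *)
    fix g assume "GDERIV (\<lambda>y. norm y * support_fun C (y /\<^sub>R norm y)) x :> g"
    then have "(\<lambda>h. h \<bullet> g) = (\<lambda>h. h \<bullet> X x)"
      using * unfolding gderiv_def by (rule has_derivative_unique)
    then show "g = X x" by (metis vector_eq_ldot)
  qed
qed

lemma frontier_eq: "frontier C = X ` sphere 0 1"
proof
  show "X ` sphere 0 1 \<subseteq> frontier C" using X_frontier(1) by (metis image_subsetI mem_sphere_0 norm_zero zero_neq_one)
  show "frontier C \<subseteq> X ` sphere 0 1"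
  proof
    fix p assume p: "p \<in> frontier C"
    have u: "norm (outer_normal C p) = 1" using outer_normal[OF p] by (simp add: is_outer_normal_def)
    then have "X (outer_normal C p) = p"
      using p by (simp add: X_def gauss_map_inv_def inv_into_f_f[OF inj_on_outer_normal])
    then show "p \<in> X ` sphere 0 1" using u by (metis imageI mem_sphere_0)
  qed
qed

lemma frontier_sphere:
  assumes c: "\<And>x. norm x = 1 \<Longrightarrow> X x = c *\<^sub>R x"
  shows "\<exists>r>0. frontier C = (\<lambda>x. r *\<^sub>R x) ` sphere 0 1"
proof -
  define e :: "real^'m" where "e = axis undefined 1"
  have e: "norm e = 1" "norm (- e) = 1" "e \<noteq> 0" "- e \<noteq> 0" by (auto simp: e_def)
  \<comment> \<open>With \<open>X x = c *\<^sub>R x\<close> this reads \<open>- c \<le> c\<close>;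
    \<open>c = 0\<close> would then contradict injectivity of \<open>X\<close> at \<open>e\<close>
    and \<open>- e\<close>.\<close>
  have "X (- e) \<bullet> e \<le> X e \<bullet> e" using e by (intro support.support) auto
  then have "0 \<le> c" using c e by (simp add: dot_square_norm)
  moreover have "c \<noteq> 0"
  proof
    assume "c = 0"
    then have "X e = X (- e)" using c e by simp
    then have "e = - e" using inj_onD[OF support.inj, of e "- e"] e by simp
    from arg_cong[OF this, of "\<lambda>v. v \<bullet> e"] show False using e(3) by simp
  qed
  moreover have "frontier C = (\<lambda>x. c *\<^sub>R x) ` sphere 0 1"
    unfolding frontier_eq using c by (intro image_cong) auto
  ultimately show ?thesis by (intro exI[of _ c]) auto
qed

end

subsection \<open>Monotone curvature functions\<close>

context smooth_support begin

lemma has_derivative_along_circle: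
  assumes x: "x \<noteq> 0" and g: "(g has_derivative g') (at x)"
  shows "((\<lambda>t. g (cos t *\<^sub>R x + sin t *\<^sub>R e)) has_derivative (\<lambda>h. g' (h *\<^sub>R e))) (at 0)"
proof -
  have "((\<lambda>t. cos t *\<^sub>R x + sin t *\<^sub>R e) has_derivative (\<lambda>h. h *\<^sub>R e)) (at 0)"
    by (auto intro!: derivative_eq_intros)
  from has_derivative_compose[OF this, of g g'] g show ?thesis by simp
qed

lemma H_along_circle:
  assumes "x \<noteq> 0"
  shows "((\<lambda>t. H (cos t *\<^sub>R x + sin t *\<^sub>R e)) has_real_derivative X x \<bullet> e) (at 0)"
  using has_derivative_along_circle[OF assms has_derivative_H[OF assms], of e]
  by (simp add: has_field_derivative_def mult_commute_abs)

lemma norm_X_along_circle: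
  assumes "x \<noteq> 0" "X x \<noteq> 0"
  shows "((\<lambda>t. norm (X (cos t *\<^sub>R x + sin t *\<^sub>R e))) has_real_derivative (X x \<bullet> X' x e) / norm (X x)) (at 0)"
proof -
  have "((\<lambda>y. norm (X y)) has_derivative (\<lambda>v. X' x v \<bullet> sgn (X x))) (at x)"
    using has_derivative_compose[OF has_derivative[OF assms(1)] has_derivative_norm[OF assms(2)]] .
  from has_derivative_along_circle[OF assms(1) this, of e]
  show ?thesis
    using linear_scale[OF linear_X'[OF assms(1)]]
    by (simp add: has_field_derivative_def mult_commute_abs sgn_div_norm inner_commute divide_inverse mult_ac)
qed

text \<open>Gives \<open>F\<close> as a limit at a unit vector where \<open>X\<close> vanishes and
  no curvature equation is assumed.\<close>

lemma isCont_F: assumes "y \<noteq> 0" shows "isCont F y"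
proof -
  have "F differentiable (at y)"
    unfolding F_def[abs_def]
  proof (rule differentiable_det)
    fix i j
    have "(\<lambda>z. M z (axis j 1)) differentiable (at y)"
      unfolding M_def using assms
      by (intro differentiable_add differentiable_scaleR differentiable_inner differentiable_X') auto
    then show "(\<lambda>z. matrix (M z) $ i $ j) differentiable (at y)"
      by (simp add: matrix_def differentiable_vec_nth)
  qed
  then show ?thesis by (rule differentiable_imp_continuous_within)
qed

end

locale C1_increasing =
  fixes \<phi> :: "real \<Rightarrow> real \<Rightarrow> real"
  assumes C1: "Ck_on 1 (\<lambda>(s, t). \<phi> s t) ({0<..} \<times> {0<..})"
    and d1_nonneg: "\<And>s t. s > 0 \<Longrightarrow> t > 0 \<Longrightarrow> deriv (\<lambda>a. \<phi> a t) s \<ge> 0"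
    and d2_nonneg: "\<And>s t. s > 0 \<Longrightarrow> t > 0 \<Longrightarrow> deriv (\<lambda>b. \<phi> s b) t \<ge> 0"
    and strict: "(\<forall>s>0. \<forall>t>0. deriv (\<lambda>a. \<phi> a t) s > 0) \<or> (\<forall>s>0. \<forall>t>0. deriv (\<lambda>b. \<phi> s b) t > 0)"
begin

text \<open>The hypotheses speak of one-variable derivatives. Joint differentiability identifies
  them with the components of the total derivative, so the chain rule applies along curves.\<close>

lemma has_derivative_pair:
  assumes "0 < s" "0 < t"
  shows "((\<lambda>p. \<phi> (fst p) (snd p)) has_derivative
    (\<lambda>(u, v). deriv (\<lambda>a. \<phi> a t) s * u + deriv (\<lambda>b. \<phi> s b) t * v)) (at (s, t))"
proof -
  have "(\<lambda>(s, t). \<phi> s t) differentiable (at (s, t))"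
    using C1 assms by auto
  then obtain D where "((\<lambda>(s, t). \<phi> s t) has_derivative D) (at (s, t))"
    by (auto simp: differentiable_def)
  then have D: "((\<lambda>p. \<phi> (fst p) (snd p)) has_derivative D) (at (s, t))"
    by (simp add: case_prod_unfold)
  interpret D: linear D using D by (rule has_derivative_linear)
  define d1 d2 where "d1 = D (1, 0)" and "d2 = D (0, 1)"
  have D1: "D (h, 0) = d1 * h" and D2: "D (0, h) = d2 * h" for h
    using D.scaleR[of h "(1, 0)"] D.scaleR[of h "(0, 1)"] by (simp_all add: d1_def d2_def)
  have "((\<lambda>a. (a, t)) has_derivative (\<lambda>h. (h, 0))) (at s)"
    by (auto intro!: derivative_eq_intros)
  from has_derivative_compose[OF this D]
  have "((\<lambda>a. \<phi> a t) has_real_derivative d1) (at s)"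
    by (simp add: has_field_derivative_def D1)
  then have 1: "deriv (\<lambda>a. \<phi> a t) s = d1" by (rule DERIV_imp_deriv)
  have "((\<lambda>b. (s, b)) has_derivative (\<lambda>h. (0, h))) (at t)"
    by (auto intro!: derivative_eq_intros)
  from has_derivative_compose[OF this D]
  have "((\<lambda>b. \<phi> s b) has_real_derivative d2) (at t)"
    by (simp add: has_field_derivative_def D2)
  then have 2: "deriv (\<lambda>b. \<phi> s b) t = d2" by (rule DERIV_imp_deriv)
  have "D (u, v) = d1 * u + d2 * v" for u v
    using D.add[of "(u, 0)" "(0, v)"] by (simp add: D1 D2)
  then have "D = (\<lambda>(u, v). d1 * u + d2 * v)" by auto
  with D show ?thesis unfolding 1 2 by simp
qed

lemma has_derivative_curve:
  assumes p: "(p has_real_derivative p') (at r)" "0 < p r" and q: "(q has_real_derivative q') (at r)" "0 < q r"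
  shows "((\<lambda>r. \<phi> (p r) (q r)) has_real_derivative
    deriv (\<lambda>a. \<phi> a (q r)) (p r) * p' + deriv (\<lambda>b. \<phi> (p r) b) (q r) * q') (at r)"
proof -
  have "((\<lambda>r. (p r, q r)) has_derivative (\<lambda>h. (p' * h, q' * h))) (at r)"
    using p(1) q(1) unfolding has_field_derivative_def by (rule has_derivative_Pair)
  from has_derivative_compose[OF this has_derivative_pair[OF p(2) q(2)]]
  have "((\<lambda>r. \<phi> (p r) (q r)) has_derivative (\<lambda>h. deriv (\<lambda>a. \<phi> a (q r)) (p r) * (p' * h) +
      deriv (\<lambda>b. \<phi> (p r) b) (q r) * (q' * h))) (at r)" by simp
  then show ?thesis
    unfolding has_field_derivative_def by (rule has_derivative_eq_rhs) (simp add: fun_eq_iff algebra_simps)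
qed

lemma DERIV_fst: "0 < s \<Longrightarrow> 0 < t \<Longrightarrow> ((\<lambda>a. \<phi> a t) has_real_derivative deriv (\<lambda>a. \<phi> a t) s) (at s)"
  using has_derivative_curve[of "\<lambda>a. a" 1 s "\<lambda>a. t" 0] by simp

lemma DERIV_snd: "0 < s \<Longrightarrow> 0 < t \<Longrightarrow> ((\<lambda>b. \<phi> s b) has_real_derivative deriv (\<lambda>b. \<phi> s b) t) (at t)"
  using has_derivative_curve[of "\<lambda>a. s" 0 t "\<lambda>a. a" 1] by simp

lemma mono_fst:
  assumes "0 < s" "s \<le> s'" "0 < t" shows "\<phi> s t \<le> \<phi> s' t"
proof (rule DERIV_nonneg_imp_nondecreasing[OF assms(2)])
  fix a assume "s \<le> a"
  then have "0 < a" using assms(1) by simp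
  then show "\<exists>y. ((\<lambda>a. \<phi> a t) has_real_derivative y) (at a) \<and> 0 \<le> y"
    using DERIV_fst d1_nonneg assms(3) by blast
qed

lemma mono_snd:
  assumes "0 < s" "0 < t" "t \<le> t'" shows "\<phi> s t \<le> \<phi> s t'"
proof (rule DERIV_nonneg_imp_nondecreasing[OF assms(3)])
  fix b assume "t \<le> b"
  then have "0 < b" using assms(2) by simp
  then show "\<exists>y. ((\<lambda>b. \<phi> s b) has_real_derivative y) (at b) \<and> 0 \<le> y"
    using DERIV_snd d2_nonneg assms(1) by blast
qed

text \<open>Both arguments grow strictly, so it is enough that one of the two steps is strict,
  whichever partial derivative is positive.\<close>

lemma strict_mono_both:
  assumes "0 < s" "s < s'" "0 < t" "t < t'" shows "\<phi> s t < \<phi> s' t'"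
  using strict
proof
  assume pos: "\<forall>s>0. \<forall>t>0. deriv (\<lambda>a. \<phi> a t) s > 0"
  have "\<phi> s t < \<phi> s' t"
  proof (rule DERIV_pos_imp_increasing[OF assms(2)])
    fix a assume "s \<le> a"
    then have "0 < a" using assms(1) by simp
    then show "\<exists>y. ((\<lambda>a. \<phi> a t) has_real_derivative y) (at a) \<and> 0 < y"
      using DERIV_fst pos assms(3) by blast
  qed
  also have "\<dots> \<le> \<phi> s' t'" using assms by (intro mono_snd) auto
  finally show ?thesis .
next
  assume pos: "\<forall>s>0. \<forall>t>0. deriv (\<lambda>b. \<phi> s b) t > 0"
  have "\<phi> s t \<le> \<phi> s' t" using assms by (intro mono_fst) auto
  also have "\<phi> s' t < \<phi> s' t'"
  proof (rule DERIV_pos_imp_increasing[OF assms(4)])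
    fix b assume "t \<le> b"
    then have "0 < b" "0 < s'" using assms by simp_all
    then show "\<exists>y. ((\<lambda>b. \<phi> s' b) has_real_derivative y) (at b) \<and> 0 < y"
      using DERIV_snd pos by blast
  qed
  finally show ?thesis .
qed

text \<open>The curvature equation says \<open>F = \<phi> H (norm X)\<close> on the sphere, and
  positivity of \<open>H\<close> keeps both arguments in the domain of \<open>\<phi>\<close>. Along
  the circle both arguments have positive derivative, and at least one partial derivative of
  \<open>\<phi>\<close> is positive.\<close>

lemma sphere_if_positive_support:
  fixes C :: "(real^'m) set"
  assumes C: "bounds_smooth_strictly_convex C"
    and h: "\<forall>x\<in>sphere 0 1. support_fun C x > 0"
    and K: "\<forall>x\<in>sphere 0 1. \<phi> (support_fun C x) (norm (support_grad C x)) * sphere_curvature C x = 1"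
  shows "\<exists>r>0. frontier C = (\<lambda>x. r *\<^sub>R x) ` sphere 0 1"
proof -
  interpret smooth_convex_body C by unfold_locales (rule C)
  have H: "0 < support.H x" if "norm x = 1" for x
    using h that by (simp add: support_fun_eq)
  have X: "0 < norm (X x)" if "norm x = 1" for x
    using H[OF that] by (auto simp: support.H_def)
  have F: "support.F x = \<phi> (support.H x) (norm (X x))" if "norm x = 1" for x
  proof -
    have "\<phi> (support.H x) (norm (X x)) * sphere_curvature C x = support.F x * sphere_curvature C x"
      using K that by (simp add: support_fun_eq support_grad_eq sphere_curvature_eq)
    moreover have "sphere_curvature C x \<noteq> 0" using sphere_curvature_eq[OF that] by auto
    ultimately show ?thesis by simp
  qed
  have "\<exists>c. \<forall>x. norm x = 1 \<longrightarrow> X x = c *\<^sub>R x"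
  proof (rule support.X_eq_scaleR)
    show "support.F y < support.F x"
      if "norm x = 1" "norm y = 1" "support.H y < support.H x" "norm (X y) < norm (X x)" for x y
      using that H X by (simp add: F strict_mono_both)
  next
    fix x e D
    assume xe: "norm x = 1" "norm e = 1" "e \<bullet> x = 0" "0 < X x \<bullet> e" "0 < X x \<bullet> X' x e"
      and D: "((\<lambda>t. support.F (cos t *\<^sub>R x + sin t *\<^sub>R e)) has_real_derivative D) (at 0)"
    define a where "a = deriv (\<lambda>a. \<phi> a (norm (X x))) (support.H x)"
    define b where "b = deriv (\<lambda>b. \<phi> (support.H x) b) (norm (X x))"
    have nz: "x \<noteq> 0" "X x \<noteq> 0" using xe X[of x] by auto
    have "((\<lambda>t. \<phi> (support.H (cos t *\<^sub>R x + sin t *\<^sub>R e)) (norm (X (cos t *\<^sub>R x + sin t *\<^sub>R e)))) has_real_derivative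
        a * (X x \<bullet> e) + b * ((X x \<bullet> X' x e) / norm (X x))) (at 0)"
      using has_derivative_curve[OF support.H_along_circle[OF nz(1)] _ support.norm_X_along_circle[OF nz]] H X xe
      by (simp add: a_def b_def)
    then have "((\<lambda>t. support.F (cos t *\<^sub>R x + sin t *\<^sub>R e)) has_real_derivative
        a * (X x \<bullet> e) + b * ((X x \<bullet> X' x e) / norm (X x))) (at 0)"
      using xe by (simp add: F norm_cos_sin)
    then have "D = a * (X x \<bullet> e) + b * ((X x \<bullet> X' x e) / norm (X x))"
      using D DERIV_unique by blast
    moreover have "0 \<le> a" "0 \<le> b" "0 < a \<or> 0 < b"
      using d1_nonneg d2_nonneg strict H X xe(1) by (auto simp: a_def b_def)
    moreover have "0 < (X x \<bullet> X' x e) / norm (X x)" using xe X by simp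
    ultimately show "0 < D"
      using xe(4) by (metis add_nonneg_pos add_pos_nonneg less_imp_le mult_nonneg_nonneg mult_pos_pos)
  qed
  then show ?thesis using frontier_sphere by blast
qed

lemma fst_irrelevant:
  assumes "\<forall>s>0. \<forall>t>0. deriv (\<lambda>a. \<phi> a t) s = 0" "0 < s" "0 < t"
  shows "\<phi> s t = \<phi> 1 t"
proof -
  have "\<phi> a t = \<phi> b t" if "0 < a" "a \<le> b" for a b
  proof (rule antisym)
    show "\<phi> a t \<le> \<phi> b t" using mono_fst that assms by blast
    show "\<phi> b t \<le> \<phi> a t"
    proof (rule DERIV_nonpos_imp_nonincreasing[OF that(2)])
      fix c assume "a \<le> c"
      then have "0 < c" using that(1) by simp
      then show "\<exists>y. ((\<lambda>a. \<phi> a t) has_real_derivative y) (at c) \<and> y \<le> 0"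
        using DERIV_fst[of c t] assms(1,3) by (metis order_refl)
    qed
  qed
  then show ?thesis using assms(2) by (metis linear zero_less_one)
qed

text \<open>The equation is silent where \<open>X\<close> vanishes. In the diagonal case
  \<open>0 < X x \<bullet> e\<close> excludes this at \<open>x\<close>; in the comparison of two
  points it can happen only at \<open>y\<close>, where \<open>F y\<close> is reached as a limit
  along a circle.\<close>

lemma sphere_if_independent_of_support:
  fixes C :: "(real^'m) set"
  assumes dim: "2 \<le> CARD('m)" and C: "bounds_smooth_strictly_convex C"
    and zero: "\<forall>s>0. \<forall>t>0. deriv (\<lambda>a. \<phi> a t) s = 0"
    and K: "\<forall>x\<in>sphere 0 1. norm (support_grad C x) > 0 \<longrightarrow>
      \<phi> 1 (norm (support_grad C x)) * sphere_curvature C x = 1"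
  shows "\<exists>r>0. frontier C = (\<lambda>x. r *\<^sub>R x) ` sphere 0 1"
proof -
  interpret smooth_convex_body C by unfold_locales (rule C)
  \<comment> \<open>\<open>zero\<close> excludes the first alternative of
    \<open>strict\<close>.\<close>
  have pos: "0 < deriv (\<lambda>b. \<phi> 1 b) t" if "0 < t" for t
    using strict zero that by (metis less_irrefl zero_less_one)
  have strict_mono: "\<phi> 1 t < \<phi> 1 t'" if "0 < t" "t < t'" for t t'
  proof (rule DERIV_pos_imp_increasing[OF that(2)])
    fix b assume "t \<le> b"
    then have "0 < b" using that(1) by simp
    then show "\<exists>y. (\<phi> 1 has_real_derivative y) (at b) \<and> 0 < y"
      using DERIV_snd[of 1 b] pos by auto
  qed
  have F: "support.F x = \<phi> 1 (norm (X x))" if "norm x = 1" "X x \<noteq> 0" for x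
  proof -
    have "\<phi> 1 (norm (X x)) * sphere_curvature C x = support.F x * sphere_curvature C x"
      using K that by (simp add: support_grad_eq sphere_curvature_eq)
    moreover have "sphere_curvature C x \<noteq> 0" using sphere_curvature_eq[OF that(1)] by auto
    ultimately show ?thesis by simp
  qed
  have "\<exists>c. \<forall>x. norm x = 1 \<longrightarrow> X x = c *\<^sub>R x"
  proof (rule support.X_eq_scaleR)
    fix x y :: "real^'m"
    assume xy: "norm x = 1" "norm y = 1" and lt: "norm (X y) < norm (X x)"
    then have Fx: "support.F x = \<phi> 1 (norm (X x))" by (intro F) auto
    show "support.F y < support.F x"
    proof (cases "X y = 0")
      case False
      then show ?thesis using lt xy by (simp add: F Fx strict_mono)
    next
      case True
      \<comment> \<open>\<open>dim\<close> supplies a tangent direction at \<open>y\<close>, hence a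
        circle of unit vectors along which to approach it.\<close>
      have y0: "y \<noteq> 0" using xy by auto
      obtain e0 where e0: "e0 \<noteq> 0" "orthogonal y e0"
        using orthogonal_to_vector_exists[of y] dim by auto
      define e where "e = e0 /\<^sub>R norm e0"
      have e: "norm e = 1" "e \<bullet> y = 0"
        using e0 by (auto simp: e_def orthogonal_def inner_commute)
      define \<gamma> where "\<gamma> t = cos t *\<^sub>R y + sin t *\<^sub>R e" for t
      have \<gamma>: "norm (\<gamma> t) = 1" for t using norm_cos_sin[OF xy(2) e] by (simp add: \<gamma>_def)
      have "isCont \<gamma> 0" unfolding \<gamma>_def by (intro continuous_intros)
      then have lim\<gamma>: "(\<gamma> \<longlongrightarrow> y) (at_right 0)"
        using filterlim_at_split isContD by (fastforce simp: \<gamma>_def)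
      have limX: "((\<lambda>t. norm (X (\<gamma> t))) \<longlongrightarrow> norm (X y)) (at_right 0)"
        by (intro tendsto_norm isCont_tendsto_compose[OF isCont_X[OF y0] lim\<gamma>])
      have limF: "((\<lambda>t. support.F (\<gamma> t)) \<longlongrightarrow> support.F y) (at_right 0)"
        by (rule isCont_tendsto_compose[OF support.isCont_F[OF y0] lim\<gamma>])
      have X2: "0 < norm (X x) / 2" using lt by (smt (verit) norm_ge_zero half_gt_zero)
      have "eventually (\<lambda>t. 0 < t \<and> t < pi) (at_right (0::real))"
        unfolding eventually_at_right_field using pi_gt_zero by blast
      moreover have "eventually (\<lambda>t. norm (X (\<gamma> t)) < norm (X x) / 2) (at_right 0)"
        using X2 True by (intro order_tendstoD(2)[OF limX]) simp
      \<comment> \<open>Limits preserve only weak inequalities; half of \<open>norm (X x)\<close>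
        leaves a gap below \<open>\<phi> 1 (norm (X x))\<close>.\<close>
      ultimately have "eventually (\<lambda>t. support.F (\<gamma> t) \<le> \<phi> 1 (norm (X x) / 2)) (at_right 0)"
      proof eventually_elim
        case (elim t)
        have ye: "y \<bullet> e = 0" using e by (simp add: inner_commute)
        then have "\<gamma> t \<bullet> e = sin t" using e(1) by (simp add: \<gamma>_def inner_add_left dot_square_norm)
        moreover note ye
        moreover have "0 < sin t" using elim by (simp add: sin_gt_zero)
        \<comment> \<open>Their components along \<open>e\<close> are \<open>sin t > 0\<close> and
          \<open>0\<close>. By injectivity \<open>X (\<gamma> t)\<close> then differs from
          \<open>X y = 0\<close>, so the equation holds there.\<close>
        ultimately have "\<gamma> t \<noteq> y" by auto
        then have "X (\<gamma> t) \<noteq> 0"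
          using inj_onD[OF support.inj, of "\<gamma> t" y] \<gamma> xy True by auto
        then show ?case using elim strict_mono[of "norm (X (\<gamma> t))" "norm (X x) / 2"] by (simp add: F[OF \<gamma>])
      qed
      then have "support.F y \<le> \<phi> 1 (norm (X x) / 2)"
        by (rule tendsto_upperbound[OF limF]) simp
      also have "\<dots> < support.F x" unfolding Fx using X2 by (intro strict_mono) auto
      finally show ?thesis .
    qed
  next
    fix x e D
    assume xe: "norm x = 1" "norm e = 1" "e \<bullet> x = 0" "0 < X x \<bullet> e" "0 < X x \<bullet> X' x e"
      and D: "((\<lambda>t. support.F (cos t *\<^sub>R x + sin t *\<^sub>R e)) has_real_derivative D) (at 0)"
    define b where "b = deriv (\<lambda>b. \<phi> 1 b) (norm (X x))"
    have nz: "x \<noteq> 0" "X x \<noteq> 0" using xe by auto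
    note dX = support.norm_X_along_circle[OF nz, of e]
    have dF: "((\<lambda>t. \<phi> 1 (norm (X (cos t *\<^sub>R x + sin t *\<^sub>R e)))) has_real_derivative
        b * ((X x \<bullet> X' x e) / norm (X x))) (at 0)"
      using has_derivative_curve[OF DERIV_const _ dX, of 1] nz by (simp add: b_def)
    \<comment> \<open>\<open>X\<close> does not vanish near \<open>x\<close>, so the equation holds
      on a neighbourhood of \<open>t = 0\<close> and can be differentiated.\<close>
    have "eventually (\<lambda>t. support.F (cos t *\<^sub>R x + sin t *\<^sub>R e) = \<phi> 1 (norm (X (cos t *\<^sub>R x + sin t *\<^sub>R e)))) (nhds 0)"
    proof -
      have "((\<lambda>t. norm (X (cos t *\<^sub>R x + sin t *\<^sub>R e))) \<longlongrightarrow> norm (X x)) (at 0)"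
        using DERIV_isCont[OF dX] by (simp add: isCont_def)
      from order_tendstoD(1)[OF this, of 0]
      have "eventually (\<lambda>t. 0 < norm (X (cos t *\<^sub>R x + sin t *\<^sub>R e))) (nhds 0)"
        using nz by (simp add: eventually_nhds_conv_at)
      then show ?thesis
        by eventually_elim (use norm_cos_sin[OF xe(1-3)] F in auto)
    qed
    then have "((\<lambda>t. support.F (cos t *\<^sub>R x + sin t *\<^sub>R e)) has_real_derivative
        b * ((X x \<bullet> X' x e) / norm (X x))) (at 0)"
      using DERIV_cong_ev[OF refl _ refl, THEN iffD2, OF _ dF] by simp
    then have "D = b * ((X x \<bullet> X' x e) / norm (X x))"
      by (rule DERIV_unique[OF D])
    then show "0 < D" using pos[of "norm (X x)"] xe nz by (simp add: b_def)
  qed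
  then show ?thesis using frontier_sphere by blast
qed

end

theorem theorem1p2:
  fixes \<phi> :: "real \<Rightarrow> real \<Rightarrow> real"
  assumes dim: "CARD('m::finite) \<ge> 2"
    and pos: "\<And>s t. s > 0 \<Longrightarrow> t > 0 \<Longrightarrow> \<phi> s t > 0"
    and C1: "Ck_on 1 (\<lambda>(s, t). \<phi> s t) ({0<..} \<times> {0<..})"
    and d1_nonneg: "\<And>s t. s > 0 \<Longrightarrow> t > 0 \<Longrightarrow> deriv (\<lambda>a. \<phi> a t) s \<ge> 0"
    and d2_nonneg: "\<And>s t. s > 0 \<Longrightarrow> t > 0 \<Longrightarrow> deriv (\<lambda>b. \<phi> s b) t \<ge> 0"
    and strict: "(\<forall>s>0. \<forall>t>0. deriv (\<lambda>a. \<phi> a t) s > 0) \<or> (\<forall>s>0. \<forall>t>0. deriv (\<lambda>b. \<phi> s b) t > 0)"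
  shows
    "(\<forall>C :: (real ^ 'm) set.
        bounds_smooth_strictly_convex C \<and>
        (\<forall>x\<in>sphere 0 1. support_fun C x > 0) \<and>
        (\<forall>x\<in>sphere 0 1. \<phi> (support_fun C x) (norm (support_grad C x)) * sphere_curvature C x = 1)
        \<longrightarrow> (\<exists>r>0. frontier C = (\<lambda>x. r *\<^sub>R x) ` sphere 0 1))
     \<and>
     ((\<forall>s>0. \<forall>t>0. deriv (\<lambda>a. \<phi> a t) s = 0) \<longrightarrow>
       (\<exists>\<psi> :: real \<Rightarrow> real.
          (\<forall>t>0. \<psi> t > 0) \<and> (\<forall>s>0. \<forall>t>0. \<phi> s t = \<psi> t) \<and>
          (\<forall>C :: (real ^ 'm) set.
             bounds_smooth_strictly_convex C \<and>
             (\<forall>x\<in>sphere 0 1. norm (support_grad C x) > 0 \<longrightarrow>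
                \<psi> (norm (support_grad C x)) * sphere_curvature C x = 1)
             \<longrightarrow> (\<exists>r>0. frontier C = (\<lambda>x. r *\<^sub>R x) ` sphere 0 1))))"
proof -
  interpret C1_increasing \<phi>
    by unfold_locales (fact C1 d1_nonneg d2_nonneg strict)+
  show ?thesis
  proof (intro conjI allI impI)
    fix C :: "(real ^ 'm) set"
    assume "bounds_smooth_strictly_convex C \<and> (\<forall>x\<in>sphere 0 1. support_fun C x > 0) \<and>
        (\<forall>x\<in>sphere 0 1. \<phi> (support_fun C x) (norm (support_grad C x)) * sphere_curvature C x = 1)"
    then show "\<exists>r>0. frontier C = (\<lambda>x. r *\<^sub>R x) ` sphere 0 1"
      using sphere_if_positive_support by blast
  next
    assume zero: "\<forall>s>0. \<forall>t>0. deriv (\<lambda>a. \<phi> a t) s = 0"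
    show "\<exists>\<psi> :: real \<Rightarrow> real.
          (\<forall>t>0. \<psi> t > 0) \<and> (\<forall>s>0. \<forall>t>0. \<phi> s t = \<psi> t) \<and>
          (\<forall>C :: (real ^ 'm) set.
             bounds_smooth_strictly_convex C \<and>
             (\<forall>x\<in>sphere 0 1. norm (support_grad C x) > 0 \<longrightarrow>
                \<psi> (norm (support_grad C x)) * sphere_curvature C x = 1)
             \<longrightarrow> (\<exists>r>0. frontier C = (\<lambda>x. r *\<^sub>R x) ` sphere 0 1))"
    \<comment> \<open>\<open>\<phi>\<close> does not depend on its first argument, so any fixed
      positive value of it gives \<open>\<psi>\<close>.\<close>
    proof (intro exI[of _ "\<phi> 1"] conjI allI impI)
      show "0 < \<phi> 1 t" if "0 < t" for t using pos that by simp
      show "\<phi> s t = \<phi> 1 t" if "0 < s" "0 < t" for s t by (rule fst_irrelevant[OF zero that])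
      fix C :: "(real ^ 'm) set"
      assume "bounds_smooth_strictly_convex C \<and> (\<forall>x\<in>sphere 0 1. norm (support_grad C x) > 0 \<longrightarrow>
                \<phi> 1 (norm (support_grad C x)) * sphere_curvature C x = 1)"
      then show "\<exists>r>0. frontier C = (\<lambda>x. r *\<^sub>R x) ` sphere 0 1"
        using sphere_if_independent_of_support[OF dim _ zero] by blast
    qed
  qed
qed

end
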